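(* There exist constants $0<c,C<\infty$ such that for all $n\ge1$ and all $v=(v_1,v_2)\in[0,n]^2\cap\mathbb{Z}^2$ with $|v|_1\le n$: (i) if $v\neq 0$, then $\displaystyle \mathbb{P}\big(v\in\pi(0,n\mathbf{e}_+)\big)\le C\exp\Big(-c\frac{|v_2-v_1|^3}{|v|_1^2}\Big)$; (ii) if $|v|_1\ge 2$, then $\displaystyle \mathbb{P}\big(v\in\pi(0,n\mathbf{e}_+)\big)\le C\Big(\frac{\log|v|_1}{|v|_1}\Big)^{2/3}$.
   Context: Fix $p\in(0,1)$ and let $(\omega_x)_{x\in\mathbb{Z}^2}$ be i.i.d. with $\mathbb{P}(\omega_x=k)=p(1-p)^k$, $k\in\{0,1,2,\dots\}$. For $u\le v$ (coordinatewise), a directed path from $u$ to $v$ is a sequence $u=x_0,\dots,x_m=v$ with increments in $\{(1,0),(0,1)\}$; $T(u,v)$ is the maximum of $\sum_{x\in\gamma}\omega_x$ over directed paths $\gamma$ from $u$ to $v$, and a geodesic is a maximizing path. $\pi(u,v)$ is the set of vertices lying on at least one geodesic from $u$ to $v$. $\mathbf{e}_+=(1,1)$, $|v|_1=|v_1|+|v_2|$. The constants may depend on $p$. *)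

theory Defs
  imports "HOL-Probability.Probability"
begin

type_synonym site = "int \<times> int"

definition dpath :: "site \<Rightarrow> site \<Rightarrow> site list \<Rightarrow> bool" where
  "dpath u v \<gamma> \<longleftrightarrow> \<gamma> \<noteq> [] \<and> hd \<gamma> = u \<and> last \<gamma> = v \<and>
     (\<forall>i. Suc i < length \<gamma> \<longrightarrow>
        (\<gamma> ! Suc i = (fst (\<gamma> ! i) + 1, snd (\<gamma> ! i)) \<or>
         \<gamma> ! Suc i = (fst (\<gamma> ! i), snd (\<gamma> ! i) + 1)))"

definition pweight :: "(site \<Rightarrow> nat) \<Rightarrow> site list \<Rightarrow> nat" where
  "pweight \<omega> \<gamma> = sum_list (map \<omega> \<gamma>)"

definition lpp :: "(site \<Rightarrow> nat) \<Rightarrow> site \<Rightarrow> site \<Rightarrow> nat" where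
  "lpp \<omega> u v = Max {pweight \<omega> \<gamma> | \<gamma>. dpath u v \<gamma>}"

definition geodesic :: "(site \<Rightarrow> nat) \<Rightarrow> site \<Rightarrow> site \<Rightarrow> site list \<Rightarrow> bool" where
  "geodesic \<omega> u v \<gamma> \<longleftrightarrow> dpath u v \<gamma> \<and> pweight \<omega> \<gamma> = lpp \<omega> u v"

definition geo_union :: "(site \<Rightarrow> nat) \<Rightarrow> site \<Rightarrow> site \<Rightarrow> site set" where
  "geo_union \<omega> u v = (\<Union>{set \<gamma> | \<gamma>. geodesic \<omega> u v \<gamma>})"

text \<open>i.i.d. Geometric(p) environment on Z^2: P(omega_x = k) = p (1-p)^k.\<close>
definition env :: "real \<Rightarrow> (site \<Rightarrow> nat) measure" where
  "env p = PiM UNIV (\<lambda>_. measure_pmf (geometric_pmf p))"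

end

theory Submission
  imports Defs
begin

text \<open>
  Add independent geometric weights on two boundary sides so that the model becomes stationary
  (Burke property: a queueing cell maps independent geometric inputs to independent geometric
  outputs). A change of measure on one side turns the resulting identity, passage time equals
  left side plus top side, into an exact exponential moment, and Chernoff's bound then shows that
  the stationary optimum leaves the boundary on the wrong side with probability at most
  \<open>3 exp (- c \<delta>^3 n)\<close>, where \<open>\<delta>\<close> is the tilt of the boundary parameter.

  (i) With tilt \<open>\<delta>\<close> of order \<open>|v2 - v1| / |v|\<close>, monotonicity of increments forces a wrong exit at
  scale \<open>n\<close> or in the rectangle spanned by \<open>0\<close> and \<open>v\<close> whenever \<open>v\<close> lies on a geodesic.

  (ii) Near the diagonal, a geodesic leaving \<open>v\<close> upwards makes \<open>v\<close> a maximiser, along its row, of a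
  two-sided walk whose increments are, off an event of polynomially small probability, dominated on
  each side by geometric variables of parameter \<open>s e^{2\<delta>}\<close> or \<open>s e^{-2\<delta>}\<close> with \<open>s = sqrt (1 - p)\<close> and \<open>\<delta>\<close> of order
  \<open>(log |v| / |v|)^{1/3}\<close>. The dominating variables to the left and to the right are independent by
  an exchange relation for tandem queues, so each side contributes a persistence probability
  of order \<open>\<delta>\<close>.
\<close>

section \<open>Geometric weights and the Burke property\<close>

text \<open>No distributional estimate for passage times is at hand: the only analytic input is an
  exact generating function, a ratio f(b')/f(b) with f(x) = (1 - x)^h / (1 - q/x)^m. An exit event
  compares two passage times, so a threshold separates them. Three Chernoff bounds, with parameters
  in geometric progression, are balanced by that threshold, and only a second difference of log f
  survives. It is of order \<delta>^2 times the difference of two variances; this difference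
  vanishes in a square at the critical parameter, and the tilt makes it of order \<delta>: hence
  \<delta>^3. In (ii) there are two persistence events, forward against backward increments on each
  side of v, so their product is of order \<delta>^2. The windows have about \<delta>^-2 steps, the
  scale on which the drift left by the tilt is still harmless, and \<delta>^3 |v| must be a multiple
  of log |v| for the exit errors to be negligible. Both comparison systems use the same bulk
  weights, so independence of the left and the right bound is not automatic. Duals, exchange and
  sweep exist to produce it.\<close>

definition EE :: "'a pmf \<Rightarrow> ('a \<Rightarrow> ennreal) \<Rightarrow> ennreal" where
  "EE P f = (\<integral>\<^sup>+x. f x \<partial>measure_pmf P)"

lemma EE_return [simp]: "EE (return_pmf x) f = f x"
  by (simp add: EE_def)

lemma EE_bind [simp]: "EE (bind_pmf P N) f = EE P (\<lambda>x. EE (N x) f)"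
  by (simp add: EE_def)

lemma EE_const [simp]: "EE P (\<lambda>_. c) = c"
  by (simp add: EE_def measure_pmf.emeasure_space_1)

lemma EE_cmult: "EE P (\<lambda>x. c * f x) = c * EE P f"
  by (simp add: EE_def nn_integral_cmult)

lemma EE_multc: "EE P (\<lambda>x. f x * c) = EE P f * c"
  by (simp add: EE_def nn_integral_multc)

lemma EE_add: "EE P (\<lambda>x. f x + g x) = EE P f + EE P g"
  by (simp add: EE_def nn_integral_add)

lemma EE_mono: "(\<And>x. x \<in> set_pmf P \<Longrightarrow> f x \<le> g x) \<Longrightarrow> EE P f \<le> EE P g"
  unfolding EE_def by (intro nn_integral_mono_AE) (auto simp: AE_measure_pmf_iff)

lemma EE_cong: "(\<And>x. x \<in> set_pmf P \<Longrightarrow> f x = g x) \<Longrightarrow> EE P f = EE P g"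
  by (intro antisym EE_mono) auto

text \<open>The pair pmf commutes. Values in \<open>ennreal\<close> leave no integrability
  condition, so independent sources may be integrated in any order; the long chains of reorderings
  below rest on this alone.\<close>

lemma EE_swap: "EE P (\<lambda>x. EE Q (\<lambda>y. f x y)) = EE Q (\<lambda>y. EE P (\<lambda>x. f x y))"
proof -
  have "EE (pair_pmf P Q) (\<lambda>(x,y). f x y) = EE (pair_pmf Q P) (\<lambda>(y,x). f x y)"
    by (subst pair_commute_pmf) (simp add: EE_def case_prod_unfold)
  then show ?thesis
    by (simp add: EE_def nn_integral_pair_pmf')
qed

text \<open>Parametrised by the ratio of successive probabilities, because Burke's property then
  reads: inputs with ratios a and b, weight with ratio ab.\<close>

definition geo :: "real \<Rightarrow> nat pmf" where
  "geo a = geometric_pmf (1 - a)"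

lemma pmf_geo: "0 \<le> a \<Longrightarrow> a < 1 \<Longrightarrow> pmf (geo a) k = a ^ k * (1 - a)"
  by (simp add: geo_def)

abbreviation iid :: "nat \<Rightarrow> real \<Rightarrow> nat list pmf" where
  "iid m a \<equiv> replicate_pmf m (geo a)"

abbreviation iidm :: "nat \<Rightarrow> nat \<Rightarrow> real \<Rightarrow> nat list list pmf" where
  "iidm h m a \<equiv> replicate_pmf h (iid m a)"

lemma EE_iid_length: "(\<And>xs. length xs = m \<Longrightarrow> f xs = g xs) \<Longrightarrow> EE (replicate_pmf m P) f = EE (replicate_pmf m P) g"
  by (rule EE_cong) (auto simp: set_replicate_pmf)

lemma EE_iid_append: "EE (replicate_pmf (m + n) P) f
   = EE (replicate_pmf m P) (\<lambda>xs. EE (replicate_pmf n P) (\<lambda>ys. f (xs @ ys)))"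
  by (simp add: replicate_pmf_distrib)

lemma EE_geo_suminf:
  assumes "0 \<le> a" "a < 1"
  shows "EE (geo a) f = (\<Sum>k. ennreal (a ^ k * (1 - a)) * f k)"
  unfolding EE_def by (simp add: nn_integral_measure_pmf nn_integral_count_space_nat pmf_geo assms)

lemma EE_geo_change:
  assumes "0 < a" "a < 1" "0 \<le> a'" "a' < 1"
  shows "EE (geo a') f = EE (geo a) (\<lambda>k. ennreal ((1 - a') / (1 - a) * (a' / a) ^ k) * f k)"
proof -
  have "ennreal (a ^ k * (1 - a)) * (ennreal ((1 - a') / (1 - a) * (a' / a) ^ k) * f k)
       = ennreal (a' ^ k * (1 - a')) * f k" for k
  proof -
    have "a ^ k * (1 - a) * ((1 - a') / (1 - a) * (a' / a) ^ k) = a' ^ k * (1 - a')"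
      using assms by (simp add: power_divide)
    then have "ennreal (a ^ k * (1 - a)) * ennreal ((1 - a') / (1 - a) * (a' / a) ^ k) = ennreal (a' ^ k * (1 - a'))"
      using assms by (subst ennreal_mult[symmetric]) auto
    then show ?thesis
      by (simp only: mult.assoc[symmetric])
  qed
  then show ?thesis
    using assms by (simp only: EE_geo_suminf less_imp_le)
qed

lemma EE_geo_power:
  assumes "0 \<le> a" "a < 1" "0 \<le> u" "a * u < 1"
  shows "EE (geo a) (\<lambda>k. ennreal (u ^ k)) = ennreal ((1 - a) / (1 - a * u))"
proof -
  have "(\<lambda>k. (a * u) ^ k * (1 - a)) sums (1 / (1 - a * u) * (1 - a))"
    using assms by (intro sums_mult2 geometric_sums) (simp add: abs_mult)
  then have "(\<lambda>k. ennreal ((a * u) ^ k * (1 - a))) sums ennreal (1 / (1 - a * u) * (1 - a))"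
    using assms by (subst sums_ennreal) (auto intro!: mult_nonneg_nonneg)
  moreover have "ennreal (a ^ k * (1 - a)) * ennreal (u ^ k) = ennreal ((a * u) ^ k * (1 - a))" for k
    using assms by (simp add: ennreal_mult''[symmetric] power_mult_distrib mult_ac)
  ultimately show ?thesis
    using assms by (simp add: EE_geo_suminf sums_iff)
qed

text \<open>The density depends on the list only through its sum, so on the left side it can be
  cancelled exactly against the passage time.\<close>

lemma EE_iid_change:
  assumes "0 < a" "a < 1" "0 \<le> a'" "a' < 1"
  shows "EE (iid n a') f = EE (iid n a)
     (\<lambda>xs. ennreal (((1 - a') / (1 - a)) ^ n * (a' / a) ^ sum_list xs) * f xs)"
proof (induction n arbitrary: f)
  case (Suc n)
  have "EE (iid (Suc n) a') f = EE (geo a) (\<lambda>x. ennreal ((1 - a') / (1 - a) * (a' / a) ^ x) *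
     EE (iid n a) (\<lambda>xs. ennreal (((1 - a') / (1 - a)) ^ n * (a' / a) ^ sum_list xs) * f (x # xs)))"
    by (simp add: Suc EE_geo_change[OF assms])
  also have "\<dots> = EE (geo a) (\<lambda>x. EE (iid n a) (\<lambda>xs.
      ennreal ((1 - a') / (1 - a) * (a' / a) ^ x) * (ennreal (((1 - a') / (1 - a)) ^ n * (a' / a) ^ sum_list xs) * f (x # xs))))"
    by (simp add: EE_cmult)
  also have "\<dots> = EE (geo a) (\<lambda>x. EE (iid n a) (\<lambda>xs.
      ennreal (((1 - a') / (1 - a)) ^ Suc n * (a' / a) ^ sum_list (x # xs)) * f (x # xs)))"
  proof -
    have "ennreal ((1 - a') / (1 - a) * (a' / a) ^ x) * ennreal (((1 - a') / (1 - a)) ^ n * (a' / a) ^ sum_list xs)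
       = ennreal (((1 - a') / (1 - a)) ^ Suc n * (a' / a) ^ sum_list (x # xs))" for x :: nat and xs
      using assms by (subst ennreal_mult[symmetric]) (auto simp: power_add)
    then show ?thesis
      by (simp only: mult.assoc[symmetric])
  qed
  finally show ?case by simp
qed simp

lemma EE_iid_power:
  assumes "0 \<le> a" "a < 1" "0 \<le> u" "a * u < 1"
  shows "EE (iid n a) (\<lambda>xs. ennreal (u ^ sum_list xs)) = ennreal (((1 - a) / (1 - a * u)) ^ n)"
proof (induction n)
  case (Suc n)
  have "EE (iid (Suc n) a) (\<lambda>xs. ennreal (u ^ sum_list xs))
      = EE (geo a) (\<lambda>x. ennreal (u ^ x) * ennreal (((1 - a) / (1 - a * u)) ^ n))"
    using assms by (simp add: power_add ennreal_mult'' EE_cmult Suc)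
  also have "\<dots> = ennreal ((1 - a) / (1 - a * u)) * ennreal (((1 - a) / (1 - a * u)) ^ n)"
    by (simp only: EE_multc EE_geo_power[OF assms])
  finally show ?case
    using assms by (simp add: ennreal_mult''[symmetric])
qed simp

text \<open>One row of cells, processed from left to right. A cell with bottom increment \<open>x\<close>, left increment
  \<open>J\<close> and weight \<open>w\<close> has top increment \<open>w + (x - J)\<close> and right increment \<open>w + (J - x)\<close>; truncated
  subtraction on \<open>nat\<close> is the positive part. The dual weight is \<open>min x J\<close>.\<close>

fun dep :: "nat \<Rightarrow> nat list \<Rightarrow> nat list \<Rightarrow> nat list" where
  "dep J (x # xs) (w # ws) = (w + (x - J)) # dep (w + (J - x)) xs ws"
| "dep J _ _ = []"

fun carry :: "nat \<Rightarrow> nat list \<Rightarrow> nat list \<Rightarrow> nat" where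
  "carry J (x # xs) (w # ws) = carry (w + (J - x)) xs ws"
| "carry J _ _ = J"

fun dual :: "nat \<Rightarrow> nat list \<Rightarrow> nat list \<Rightarrow> nat list" where
  "dual J (x # xs) (w # ws) = min x J # dual (w + (J - x)) xs ws"
| "dual J _ _ = []"

fun tops :: "nat list \<Rightarrow> nat list \<Rightarrow> nat list list \<Rightarrow> nat list" where
  "tops xs (J # Js) (ws # wss) = tops (dep J xs ws) Js wss"
| "tops xs _ _ = xs"

fun rights :: "nat list \<Rightarrow> nat list \<Rightarrow> nat list list \<Rightarrow> nat list" where
  "rights xs (J # Js) (ws # wss) = carry J xs ws # rights (dep J xs ws) Js wss"
| "rights xs _ _ = []"

fun duals :: "nat list \<Rightarrow> nat list \<Rightarrow> nat list list \<Rightarrow> nat list list" where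
  "duals xs (J # Js) (ws # wss) = dual J xs ws # duals (dep J xs ws) Js wss"
| "duals xs _ _ = []"

text \<open>The cell map is an involution that preserves the product weight, since \<open>x + w\<close> and \<open>J + w\<close> are invariant.\<close>

lemma burke_cell:
  assumes "0 < a" "a < 1" "0 < b" "b < 1"
  shows "EE (geo a) (\<lambda>x. EE (geo b) (\<lambda>J. EE (geo (a * b)) (\<lambda>w. f (w + (x - J)) (w + (J - x)) (min x J))))
       = EE (geo a) (\<lambda>x. EE (geo b) (\<lambda>J. EE (geo (a * b)) (\<lambda>w. f x J w)))"
proof -
  define P where "P = pair_pmf (geo a) (pair_pmf (geo b) (geo (a * b)))"
  define \<phi> :: "nat \<times> nat \<times> nat \<Rightarrow> nat \<times> nat \<times> nat" where
    "\<phi> = (\<lambda>(x, J, w). (w + (x - J), w + (J - x), min x J))"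
  have ab: "0 \<le> a * b" "a * b < 1"
    using assms mult_less_le_imp_less[of a 1 b 1] by auto
  have inv: "\<phi> (\<phi> t) = t" for t
    by (cases t) (auto simp: \<phi>_def min_def)
  have inj: "inj \<phi>"
    by (rule inj_on_inverseI[of _ \<phi>]) (simp add: inv)
  have pm: "pmf P (\<phi> t) = pmf P t" for t
  proof (cases t)
    case (fields x J w)
    have *: "pmf P (x, J, w) = a ^ (x + w) * b ^ (J + w) * ((1 - a) * (1 - b) * (1 - a * b))" for x J w
      using assms ab by (simp add: P_def pmf_pair pmf_geo power_mult_distrib power_add)
    have "w + (x - J) + min x J = x + w" "w + (J - x) + min x J = J + w"
      by auto
    then show ?thesis
      using fields by (simp only: \<phi>_def * prod.case)
  qed
  have "map_pmf \<phi> P = P"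
  proof (rule pmf_eqI)
    fix t
    have "pmf (map_pmf \<phi> P) (\<phi> (\<phi> t)) = pmf P (\<phi> t)"
      by (rule pmf_map_inj'[OF inj])
    then show "pmf (map_pmf \<phi> P) t = pmf P t"
      by (simp add: inv pm)
  qed
  then have "EE P (\<lambda>(x, J, w). f x J w) = EE (map_pmf \<phi> P) (\<lambda>(x, J, w). f x J w)"
    by simp
  then show ?thesis
    by (simp add: P_def EE_def nn_integral_pair_pmf' \<phi>_def case_prod_unfold)
qed

text \<open>The top and dual outputs of the first cell are independent of the carry, which enters
  the rest of the row with its stationary law. The duals are kept because \<open>dominate\<close>
  reuses them as bulk weights independent of the top row.\<close>

lemma burke_row:
  assumes "0 < a" "a < 1" "0 < b" "b < 1"
  shows "EE (geo b) (\<lambda>J. EE (iid m a) (\<lambda>xs. EE (iid m (a * b)) (\<lambda>ws.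
            f (dep J xs ws) (carry J xs ws) (dual J xs ws))))
       = EE (geo b) (\<lambda>J. EE (iid m a) (\<lambda>xs. EE (iid m (a * b)) (\<lambda>ws. f xs J ws)))"
proof (induction m arbitrary: f)
  case (Suc m)
  have reorder: "EE (geo b) (\<lambda>J. EE (iid (Suc m) a) (\<lambda>xs. EE (iid (Suc m) (a * b)) (\<lambda>ws. F J xs ws)))
     = EE (geo a) (\<lambda>x. EE (geo b) (\<lambda>J. EE (geo (a * b)) (\<lambda>w.
         EE (iid m a) (\<lambda>xs. EE (iid m (a * b)) (\<lambda>ws. F J (x # xs) (w # ws))))))" for F
  proof -
    have "EE (geo b) (\<lambda>J. EE (iid (Suc m) a) (\<lambda>xs. EE (iid (Suc m) (a * b)) (\<lambda>ws. F J xs ws)))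
      = EE (geo b) (\<lambda>J. EE (geo a) (\<lambda>x. EE (iid m a) (\<lambda>xs. EE (geo (a * b)) (\<lambda>w. EE (iid m (a * b)) (\<lambda>ws. F J (x # xs) (w # ws))))))"
      by simp
    also have "\<dots> = EE (geo a) (\<lambda>x. EE (geo b) (\<lambda>J. EE (iid m a) (\<lambda>xs. EE (geo (a * b)) (\<lambda>w. EE (iid m (a * b)) (\<lambda>ws. F J (x # xs) (w # ws))))))"
      by (rule EE_swap)
    also have "\<dots> = EE (geo a) (\<lambda>x. EE (geo b) (\<lambda>J. EE (geo (a * b)) (\<lambda>w. EE (iid m a) (\<lambda>xs. EE (iid m (a * b)) (\<lambda>ws. F J (x # xs) (w # ws))))))"
      by (subst EE_swap[of "iid m a" "geo (a * b)"]) simp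
    finally show ?thesis .
  qed
  have "EE (geo b) (\<lambda>J. EE (iid (Suc m) a) (\<lambda>xs. EE (iid (Suc m) (a * b)) (\<lambda>ws.
            f (dep J xs ws) (carry J xs ws) (dual J xs ws))))
    = EE (geo a) (\<lambda>x. EE (geo b) (\<lambda>J. EE (geo (a * b)) (\<lambda>w. EE (iid m a) (\<lambda>xs. EE (iid m (a * b)) (\<lambda>ws.
        f (x # dep J xs ws) (carry J xs ws) (w # dual J xs ws))))))"
    unfolding reorder dep.simps carry.simps dual.simps
    by (rule burke_cell[OF assms, of "\<lambda>x J w. EE (iid m a) (\<lambda>xs. EE (iid m (a * b)) (\<lambda>ws.
        f (x # dep J xs ws) (carry J xs ws) (w # dual J xs ws)))"])
  also have "\<dots> = EE (geo a) (\<lambda>x. EE (geo (a * b)) (\<lambda>w. EE (geo b) (\<lambda>J. EE (iid m a) (\<lambda>xs. EE (iid m (a * b)) (\<lambda>ws.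
        f (x # dep J xs ws) (carry J xs ws) (w # dual J xs ws))))))"
    by (subst EE_swap) simp
  also have "\<dots> = EE (geo a) (\<lambda>x. EE (geo (a * b)) (\<lambda>w. EE (geo b) (\<lambda>J. EE (iid m a) (\<lambda>xs. EE (iid m (a * b)) (\<lambda>ws.
        f (x # xs) J (w # ws))))))"
    by (subst Suc[of "\<lambda>xs J ws. f (_ # xs) J (_ # ws)"]) simp
  also have "\<dots> = EE (geo a) (\<lambda>x. EE (geo b) (\<lambda>J. EE (geo (a * b)) (\<lambda>w. EE (iid m a) (\<lambda>xs. EE (iid m (a * b)) (\<lambda>ws.
        f (x # xs) J (w # ws))))))"
    by (subst EE_swap) simp
  also have "\<dots> = EE (geo b) (\<lambda>J. EE (iid (Suc m) a) (\<lambda>xs. EE (iid (Suc m) (a * b)) (\<lambda>ws. f xs J ws)))"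
    by (simp only: reorder)
  finally show ?case .
qed simp

lemma burke_block:
  assumes "0 < a" "a < 1" "0 < b" "b < 1"
  shows "EE (iid h b) (\<lambda>Js. EE (iid m a) (\<lambda>xs. EE (iidm h m (a * b)) (\<lambda>wss.
            f (tops xs Js wss) (rights xs Js wss) (duals xs Js wss))))
       = EE (iid h b) (\<lambda>Js. EE (iid m a) (\<lambda>xs. EE (iidm h m (a * b)) (\<lambda>wss. f xs Js wss)))"
proof (induction h arbitrary: f)
  case (Suc h)
  have reorder: "EE (iid (Suc h) b) (\<lambda>Js. EE (iid m a) (\<lambda>xs. EE (iidm (Suc h) m (a * b)) (\<lambda>wss. F Js xs wss)))
     = EE (geo b) (\<lambda>J. EE (iid m a) (\<lambda>xs. EE (iid m (a * b)) (\<lambda>ws. EE (iid h b) (\<lambda>Js.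
         EE (iidm h m (a * b)) (\<lambda>wss. F (J # Js) xs (ws # wss))))))" for F
  proof -
    have "EE (iid (Suc h) b) (\<lambda>Js. EE (iid m a) (\<lambda>xs. EE (iidm (Suc h) m (a * b)) (\<lambda>wss. F Js xs wss)))
      = EE (geo b) (\<lambda>J. EE (iid h b) (\<lambda>Js. EE (iid m a) (\<lambda>xs. EE (iid m (a * b)) (\<lambda>ws. EE (iidm h m (a * b)) (\<lambda>wss. F (J # Js) xs (ws # wss))))))"
      by simp
    also have "\<dots> = EE (geo b) (\<lambda>J. EE (iid m a) (\<lambda>xs. EE (iid h b) (\<lambda>Js. EE (iid m (a * b)) (\<lambda>ws. EE (iidm h m (a * b)) (\<lambda>wss. F (J # Js) xs (ws # wss))))))"
      by (subst EE_swap) simp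
    also have "\<dots> = EE (geo b) (\<lambda>J. EE (iid m a) (\<lambda>xs. EE (iid m (a * b)) (\<lambda>ws. EE (iid h b) (\<lambda>Js. EE (iidm h m (a * b)) (\<lambda>wss. F (J # Js) xs (ws # wss))))))"
      by (subst EE_swap[of "iid h b" "iid m (a * b)"]) simp
    finally show ?thesis .
  qed
  have reorder2: "EE (geo b) (\<lambda>J. EE (iid m a) (\<lambda>xs. EE (iid m (a * b)) (\<lambda>ws. EE (iid h b) (\<lambda>Js.
         EE (iidm h m (a * b)) (\<lambda>wss. F J xs ws Js wss)))))
     = EE (geo b) (\<lambda>J. EE (iid m (a * b)) (\<lambda>ws. EE (iid h b) (\<lambda>Js. EE (iid m a) (\<lambda>xs.
         EE (iidm h m (a * b)) (\<lambda>wss. F J xs ws Js wss)))))" for F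
    by (subst EE_swap[of "iid m a" "iid m (a * b)"], subst EE_swap[of "iid m a" "iid h b"]) simp
  have "EE (iid (Suc h) b) (\<lambda>Js. EE (iid m a) (\<lambda>xs. EE (iidm (Suc h) m (a * b)) (\<lambda>wss.
            f (tops xs Js wss) (rights xs Js wss) (duals xs Js wss))))
    = EE (geo b) (\<lambda>J. EE (iid m a) (\<lambda>xs. EE (iid m (a * b)) (\<lambda>ws. EE (iid h b) (\<lambda>Js. EE (iidm h m (a * b)) (\<lambda>wss.
        f (tops xs Js wss) (J # rights xs Js wss) (ws # duals xs Js wss))))))"
    unfolding reorder tops.simps rights.simps duals.simps
    by (rule burke_row[OF assms, of _ "\<lambda>xs J ws. EE (iid h b) (\<lambda>Js. EE (iidm h m (a * b)) (\<lambda>wss.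
        f (tops xs Js wss) (J # rights xs Js wss) (ws # duals xs Js wss)))"])
  also have "\<dots> = EE (geo b) (\<lambda>J. EE (iid m a) (\<lambda>xs. EE (iid m (a * b)) (\<lambda>ws. EE (iid h b) (\<lambda>Js. EE (iidm h m (a * b)) (\<lambda>wss.
        f xs (J # Js) (ws # wss))))))"
    unfolding reorder2
    by (subst Suc[of "\<lambda>xs Js wss. f xs (_ # Js) (_ # wss)"]) simp
  finally show ?case
    by (simp only: reorder)
qed simp

section \<open>Last-passage recursion and increments\<close>

text \<open>\<open>A\<close> and \<open>B\<close> are passage times (not increments) on the bottom row and the left column, and
  \<open>w i j\<close> is the weight of the cell \<open>(i + 1, j + 1)\<close>.\<close>

fun LP :: "(nat \<Rightarrow> nat) \<Rightarrow> (nat \<Rightarrow> nat) \<Rightarrow> (nat \<Rightarrow> nat \<Rightarrow> nat) \<Rightarrow> nat \<Rightarrow> nat \<Rightarrow> nat" where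
  "LP A B w i 0 = A i"
| "LP A B w 0 (Suc j) = B (Suc j)"
| "LP A B w (Suc i) (Suc j) = w i j + max (LP A B w i (Suc j)) (LP A B w (Suc i) j)"

lemma grid_induct [case_names bottom left step]:
  assumes "\<And>i. P i 0" "\<And>j. P 0 (Suc j)" "\<And>i j. P i (Suc j) \<Longrightarrow> P (Suc i) j \<Longrightarrow> P (Suc i) (Suc j)"
  shows "P i (j::nat)"
proof (induction j arbitrary: i)
  case (Suc j)
  show ?case by (induction i) (use assms Suc in auto)
qed (use assms in auto)

lemma LP_0: "A 0 = B 0 \<Longrightarrow> LP A B w 0 j = B j"
  by (cases j) auto

lemma LP_mono_abs:
  assumes "\<And>i. A i \<le> A' i" "\<And>j. B j \<le> B' j"
  shows "LP A B w i j \<le> LP A' B' w i j"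
proof (induction i j rule: grid_induct)
  case (step i j)
  then show ?case by (auto intro: max.mono)
qed (use assms in auto)

lemma LP_cong:
  assumes "\<And>i'. i' \<le> i \<Longrightarrow> A i' = A' i'" "\<And>j'. j' \<le> j \<Longrightarrow> B j' = B' j'"
    "\<And>i' j'. i' < i \<Longrightarrow> j' < j \<Longrightarrow> w i' j' = w' i' j'"
  shows "LP A B w i j = LP A' B' w' i j"
  using assms by (induction i j rule: grid_induct) auto

text \<open>With \<open>LP_max\<close>, this is max-plus linearity of the recursion in its boundary
  data. It lets a sub-rectangle be normalised by its corner value and the two boundary sides be
  treated separately.\<close>

lemma LP_shift: "LP (\<lambda>i. t + A i) (\<lambda>j. t + B j) w i j = t + LP A B w i j"
  by (induction i j rule: grid_induct) (auto simp: max_def)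

lemma LP_max: "LP (\<lambda>i. max (A i) (A' i)) (\<lambda>j. max (B j) (B' j)) w i j = max (LP A B w i j) (LP A' B' w i j)"
  by (induction i j rule: grid_induct) (auto simp: max_def)

text \<open>The recursion is local: row \<open>h\<close> and column \<open>i0\<close> screen off
  everything below and to the left of them.\<close>

lemma LP_rebase:
  "LP A B w (i0 + i) (h + j) = LP (\<lambda>i. LP A B w (i0 + i) h) (\<lambda>j. LP A B w i0 (h + j)) (\<lambda>i j. w (i0 + i) (h + j)) i j"
proof -
  define A1 B1 w1 where "A1 = (\<lambda>i. LP A B w (i0 + i) h)" "B1 = (\<lambda>j. LP A B w i0 (h + j))"
     "w1 = (\<lambda>i j. w (i0 + i) (h + j))"
  have "LP A1 B1 w1 i j = LP A B w (i0 + i) (h + j)"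
    by (induction i j rule: grid_induct) (auto simp: A1_B1_w1_def)
  then show ?thesis
    by (simp add: A1_B1_w1_def)
qed

text \<open>Each cell turns steeper horizontal and flatter vertical input into steeper horizontal
  and flatter vertical output, so the order propagates. The inductions interlock: the vertical
  comparison at \<open>Suc i\<close> uses the horizontal one in the row below. Sums are compared to
  avoid truncated subtraction.\<close>

lemma LP_incr:
  assumes A: "\<And>i. A (Suc i) + A' i \<le> A' (Suc i) + A i"
    and B: "\<And>j. B' (Suc j) + B j \<le> B (Suc j) + B' j"
    and z: "A 0 = B 0" "A' 0 = B' 0"
  shows "LP A B w (Suc i) j + LP A' B' w i j \<le> LP A' B' w (Suc i) j + LP A B w i j" (is "?H i j")
    and "LP A' B' w i (Suc j) + LP A B w i j \<le> LP A B w i (Suc j) + LP A' B' w i j" (is "?V i j")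
proof -
  have step: "(\<forall>i. ?H i j) \<Longrightarrow> ?V i j \<and> ?H i (Suc j)" for i j
  proof (induction i)
    case 0
    have "?V 0 j" using B[of j] z by (simp add: LP_0)
    moreover have "?H 0 j" using 0 by blast
    ultimately show ?case by (auto simp: max_def)
  next
    case (Suc i)
    then have a: "?V i j" "?H i (Suc j)" "?H i j" "?H (Suc i) j" by blast+
    have "?V (Suc i) j" using a(1,3) by (auto simp: max_def)
    moreover from this have "?H (Suc i) (Suc j)" using a(4) unfolding LP.simps by (auto simp: max_def)
    ultimately show ?case by blast
  qed
  have H: "\<forall>i. ?H i j" for j
  proof (induction j)
    case 0 show ?case using A by simp
  next
    case (Suc j) then show ?case using step by blast
  qed
  show "?H i j" using H by blast
  show "?V i j" using H step by blast
qed

lemma LP_mono_bdry: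
  assumes "mono A" "mono B" "A 0 = B 0"
  shows "LP A B w i j \<le> LP A B w (Suc i) j" "LP A B w i j \<le> LP A B w i (Suc j)"
proof -
  show "LP A B w i j \<le> LP A B w (Suc i) j"
    using assms by (cases j) (auto simp: mono_def)
  show "LP A B w i j \<le> LP A B w i (Suc j)"
    using assms by (cases i) (auto simp: mono_def LP_0)
qed

section \<open>Increment lists and their prefix sums\<close>

abbreviation ps :: "nat list \<Rightarrow> nat \<Rightarrow> nat" where "ps xs i \<equiv> sum_list (take i xs)"

abbreviation zeros :: "nat \<Rightarrow> nat list" where "zeros n \<equiv> replicate n 0"

definition rectangular :: "nat \<Rightarrow> nat \<Rightarrow> nat list list \<Rightarrow> bool" where
  "rectangular h m wss \<longleftrightarrow> length wss = h \<and> (\<forall>ws\<in>set wss. length ws = m)"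

lemma rectangular_Suc_iff: "rectangular (Suc h) m wss \<longleftrightarrow> (\<exists>ws wss'. wss = ws # wss' \<and> length ws = m \<and> rectangular h m wss')"
  by (cases wss) (auto simp: rectangular_def)

lemma rectangular_0 [simp]: "rectangular 0 m wss \<longleftrightarrow> wss = []"
  by (auto simp: rectangular_def)

lemma length_dep [simp]: "length (dep J xs ws) = min (length xs) (length ws)"
  by (induction J xs ws rule: dep.induct) auto

lemma length_dual [simp]: "length (dual J xs ws) = min (length xs) (length ws)"
  by (induction J xs ws rule: dual.induct) auto

lemma length_tops: "length xs = m \<Longrightarrow> rectangular h m wss \<Longrightarrow> length Js = h \<Longrightarrow> length (tops xs Js wss) = m"
  by (induction h arbitrary: xs Js wss) (auto simp: rectangular_Suc_iff length_Suc_conv)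

lemma length_rights: "rectangular h m wss \<Longrightarrow> length Js = h \<Longrightarrow> length (rights xs Js wss) = h"
  by (induction h arbitrary: xs Js wss) (auto simp: rectangular_Suc_iff length_Suc_conv)

text \<open>The value carried by \<open>dep\<close> is the increment across the current vertical
  edge, which is all that the next cell has to know about the past; \<open>t\<close> is the value at
  the left end of the bottom row.\<close>

lemma LP_row:
  assumes "\<And>i. i \<le> length xs \<Longrightarrow> A i = t + ps xs i" "B 1 = t + J" "\<And>i. i < length xs \<Longrightarrow> w i 0 = ws ! i"
    "length ws = length xs" "i \<le> length xs"
  shows "LP A B w i 1 = t + J + ps (dep J xs ws) i"
  using assms
proof (induction xs arbitrary: A B t J w ws i)
  case (Cons x xs)
  obtain w0 ws' where ws: "ws = w0 # ws'" using Cons.prems(4) by (cases ws) auto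
  have w0: "w 0 0 = w0" using Cons.prems(3)[of 0] by (simp add: ws)
  have A1: "A (Suc 0) = t + x" using Cons.prems(1)[of 1] by simp
  show ?case
  proof (cases i)
    case (Suc i')
    have "LP A B w (1 + i') (0 + 1)
        = LP (\<lambda>i. LP A B w (1 + i) 0) (\<lambda>j. LP A B w 1 (0 + j)) (\<lambda>i j. w (1 + i) (0 + j)) i' 1"
      by (rule LP_rebase)
    also have "\<dots> = (t + x) + (w0 + (J - x)) + ps (dep (w0 + (J - x)) xs ws') i'"
    proof (rule Cons.IH)
      fix k assume "k \<le> length xs"
      then show "LP A B w (1 + k) 0 = t + x + ps xs k"
        using Cons.prems(1)[of "Suc k"] by simp
    next
      show "LP A B w 1 (0 + 1) = t + x + (w0 + (J - x))"
        using Cons.prems(2) A1 w0 by (auto simp: max_def)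
    next
      fix k assume "k < length xs"
      then show "w (1 + k) (0 + 0) = ws' ! k" using Cons.prems(3)[of "Suc k"] ws by simp
    qed (use Cons.prems ws Suc in auto)
    also have "\<dots> = t + J + ps (dep J (x # xs) ws) i"
      by (simp add: ws Suc)
    finally show ?thesis by (simp add: Suc)
  qed (use Cons.prems in simp)
qed simp

lemma LP_tops:
  assumes "length xs = m" "rectangular h m wss" "length Js = h" "i \<le> m"
    "\<And>i. i \<le> m \<Longrightarrow> A i = ps xs i" "\<And>j. j \<le> h \<Longrightarrow> B j = ps Js j" "\<And>i j. i < m \<Longrightarrow> j < h \<Longrightarrow> w i j = wss ! j ! i"
  shows "LP A B w i h = sum_list Js + ps (tops xs Js wss) i"
  using assms
proof (induction h arbitrary: xs Js wss A B w i)
  case (Suc h)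
  obtain J Js' where J: "Js = J # Js'" "length Js' = h" using Suc.prems by (cases Js) auto
  obtain ws wss' where W: "wss = ws # wss'" "length ws = m" "rectangular h m wss'" using Suc.prems by (auto simp: rectangular_Suc_iff)
  have row: "LP A B w i 1 = J + ps (dep J xs ws) i" if "i \<le> m" for i
    using LP_row[of xs A 0 B J w ws i] Suc.prems(1,5) Suc.prems(6)[of 1] Suc.prems(7)[of _ 0] that
    by (simp add: J W)
  have "LP A B w (0 + i) (1 + h) = LP (\<lambda>i. LP A B w (0 + i) 1) (\<lambda>j. LP A B w 0 (1 + j)) (\<lambda>i j. w (0 + i) (1 + j)) i h"
    by (rule LP_rebase)
  also have "\<dots> = LP (\<lambda>i. J + ps (dep J xs ws) i) (\<lambda>j. J + ps Js' j) (\<lambda>i j. w i (1 + j)) i h"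
    using Suc.prems(4,6) by (intro LP_cong) (auto simp: row[unfolded One_nat_def] J)
  also have "\<dots> = J + LP (ps (dep J xs ws)) (ps Js') (\<lambda>i j. w i (1 + j)) i h"
    by (rule LP_shift)
  also have "LP (ps (dep J xs ws)) (ps Js') (\<lambda>i j. w i (1 + j)) i h = sum_list Js' + ps (tops (dep J xs ws) Js' wss') i"
    using Suc.prems(1,4,7) W J by (intro Suc.IH) auto
  finally show ?case by (simp add: J W)
qed simp

text \<open>The passage time to the far corner (\<open>sysval_LP\<close>), read along the left side
  and then the top. In this form the left increments enter as a plain sum, which the change of
  measure in \<open>mgf_identity\<close> cancels.\<close>

definition sysval :: "nat list \<Rightarrow> nat list \<Rightarrow> nat list list \<Rightarrow> nat" where
  "sysval xs Js wss = sum_list Js + sum_list (tops xs Js wss)"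

abbreviation wt :: "nat list list \<Rightarrow> nat \<Rightarrow> nat \<Rightarrow> nat" where "wt wss i j \<equiv> wss ! j ! i"

lemma sysval_LP:
  assumes "length xs = m" "rectangular h m wss" "length Js = h"
  shows "sysval xs Js wss = LP (ps xs) (ps Js) (wt wss) m h"
  using LP_tops[OF assms order_refl] assms length_tops[OF assms] by (simp add: sysval_def)

lemma ps_zeros [simp]: "ps (zeros n) i = 0"
  by (simp add: take_replicate sum_list_replicate)

lemma sum_list_zeros [simp]: "sum_list (zeros n) = 0"
  by (simp add: sum_list_replicate)

lemma LP_split: "LP A B w i j = max (LP A (\<lambda>_. 0) w i j) (LP (\<lambda>_. 0) B w i j)"
  using LP_max[of A "\<lambda>_. 0" "\<lambda>_. 0" B w i j] by simp

lemma sysval_split: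
  assumes "length xs = m" "rectangular h m wss" "length Js = h"
  shows "sysval xs Js wss = max (sysval xs (zeros h) wss) (sysval (zeros m) Js wss)"
  using assms LP_split[of "ps xs" "ps Js"] by (simp add: sysval_LP)

lemma ps_Suc: "i < length xs \<Longrightarrow> ps xs (Suc i) = ps xs i + xs ! i"
  by (simp add: take_Suc_conv_app_nth)

lemma mono_ps: "mono (ps xs)"
proof (rule incseq_SucI)
  fix n show "ps xs n \<le> ps xs (Suc n)"
    by (cases "n < length xs") (simp_all add: ps_Suc)
qed

lemma ps_incr: "ps xs i \<le> ps xs (Suc i)"
  using mono_ps[of xs] by (simp add: mono_def)

lemma dep_take: "dep J (take c xs) (take c ws) = take c (dep J xs ws)"
proof (induction J xs ws arbitrary: c rule: dep.induct)
  case (1 J x xs w ws) then show ?case by (cases c) auto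
qed auto

lemma tops_take: "tops (take c xs) Js (map (take c) wss) = take c (tops xs Js wss)"
  by (induction xs Js wss rule: tops.induct) (auto simp: dep_take)

lemma tops_zero_bounds:
  assumes xs: "length xs = m" and W: "rectangular h m wss" and Js: "length Js = h" and i: "i < m"
  shows "tops (zeros m) (zeros h) wss ! i \<le> tops xs (zeros h) wss ! i"
    and "tops (zeros m) Js wss ! i \<le> tops (zeros m) (zeros h) wss ! i"
    and "tops (zeros m) Js wss ! i \<le> tops xs (zeros h) wss ! i"
proof -
  have L: "LP (ps xs') (ps Js') (wt wss) k h = sum_list Js' + ps (tops xs' Js' wss) k"
    if "length xs' = m" "length Js' = h" "k \<le> m" for xs' Js' k
    using LP_tops[OF that(1) W that(2,3)] by simp
  have *: "tops xs1 Js1 wss ! i \<le> tops xs2 Js2 wss ! i"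
    if "length xs1 = m" "length Js1 = h" "length xs2 = m" "length Js2 = h"
      "\<And>i. ps xs1 (Suc i) + ps xs2 i \<le> ps xs2 (Suc i) + ps xs1 i"
      "\<And>j. ps Js2 (Suc j) + ps Js1 j \<le> ps Js1 (Suc j) + ps Js2 j" for xs1 xs2 Js1 Js2
    using LP_incr(1)[of "ps xs1" "ps xs2" "ps Js2" "ps Js1" "wt wss" i h, OF that(5,6)] i
    by (simp add: L that ps_Suc length_tops[OF that(1) W that(2)] length_tops[OF that(3) W that(4)])
  show "tops (zeros m) (zeros h) wss ! i \<le> tops xs (zeros h) wss ! i"
    by (rule *) (auto simp: xs ps_incr)
  show "tops (zeros m) Js wss ! i \<le> tops (zeros m) (zeros h) wss ! i"
    by (rule *) (auto simp: Js ps_incr)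
  show "tops (zeros m) Js wss ! i \<le> tops xs (zeros h) wss ! i"
    by (rule *) (auto simp: Js xs ps_incr)
qed

text \<open>Along the top row, the value \<open>H\<close> of paths leaving by the bottom minus the
  value \<open>V\<close> of paths leaving by the left is nondecreasing, by
  \<open>tops_zero_bounds\<close>. So its sign at column \<open>c\<close> decides which of them is
  the maximum \<open>G\<close> on a whole side of \<open>c\<close>, and there the increments of
  \<open>G\<close> are those of \<open>H\<close> or of \<open>V\<close>, between which the bulk
  increments lie.\<close>

lemma tops_dominate:
  assumes xs: "length xs = m" and W: "rectangular h m wss" and Js: "length Js = h" and i: "i < m" and c: "c \<le> m"
  shows "sum_list Js + ps (tops (zeros m) Js wss) c \<le> ps (tops xs (zeros h) wss) c \<Longrightarrow> c \<le> i \<Longrightarrow>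
     tops (zeros m) (zeros h) wss ! i \<le> tops xs Js wss ! i"
    and "ps (tops xs (zeros h) wss) c \<le> sum_list Js + ps (tops (zeros m) Js wss) c \<Longrightarrow> i < c \<Longrightarrow>
     tops xs Js wss ! i \<le> tops (zeros m) (zeros h) wss ! i"
proof -
  define H where "H k = ps (tops xs (zeros h) wss) k" for k
  define V where "V k = sum_list Js + ps (tops (zeros m) Js wss) k" for k
  define G where "G k = sum_list Js + ps (tops xs Js wss) k" for k
  have L: "LP (ps xs') (ps Js') (wt wss) k h = sum_list Js' + ps (tops xs' Js' wss) k"
    if "length xs' = m" "length Js' = h" "k \<le> m" for xs' Js' k
    using LP_tops[OF that(1) W that(2,3)] by simp
  have G: "G k = max (H k) (V k)" if "k \<le> m" for k
    using LP_split[of "ps xs" "ps Js" "wt wss" k h] L[of xs Js k] L[of xs "zeros h" k] L[of "zeros m" Js k]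
      xs Js that by (simp add: G_def H_def V_def)
  have len: "length (tops xs' Js' wss) = m" if "length xs' = m" "length Js' = h" for xs' Js'
    using length_tops[OF that(1) W that(2)] .
  have HS: "H (Suc k) = H k + tops xs (zeros h) wss ! k" if "k < m" for k
    using that xs by (simp add: H_def ps_Suc len)
  have VS: "V (Suc k) = V k + tops (zeros m) Js wss ! k" if "k < m" for k
    using that Js by (simp add: V_def ps_Suc len)
  have GS: "G (Suc k) = G k + tops xs Js wss ! k" if "k < m" for k
    using that Js xs by (simp add: G_def ps_Suc len)
  note le = tops_zero_bounds[OF xs W Js]
  have mon: "H k + V k' \<le> H k' + V k" if "k \<le> k'" "k' \<le> m" for k k'
    using that
  proof (induction k' rule: dec_induct)
    case (step n)
    then show ?case using HS[of n] VS[of n] le(3)[of n] by simp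
  qed simp
  show "tops (zeros m) (zeros h) wss ! i \<le> tops xs Js wss ! i"
    if "sum_list Js + ps (tops (zeros m) Js wss) c \<le> ps (tops xs (zeros h) wss) c" "c \<le> i"
  proof -
    have "V k \<le> H k" if "c \<le> k" "k \<le> m" for k
      using mon[OF that] \<open>sum_list Js + _ \<le> _\<close> by (simp add: H_def V_def)
    then have "G i = H i" "G (Suc i) = H (Suc i)"
      using G i that by auto
    then show ?thesis using HS[OF i] GS[OF i] le(1)[OF i] by simp
  qed
  show "tops xs Js wss ! i \<le> tops (zeros m) (zeros h) wss ! i"
    if "ps (tops xs (zeros h) wss) c \<le> sum_list Js + ps (tops (zeros m) Js wss) c" "i < c"
  proof -
    have "H k \<le> V k" if "k \<le> c" for k
      using mon[OF that c] \<open>ps _ _ \<le> _\<close> by (simp add: H_def V_def)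
    then have "G i = V i" "G (Suc i) = V (Suc i)"
      using G i that by auto
    then show ?thesis using VS[OF i] GS[OF i] le(2)[OF i] by simp
  qed
qed

section \<open>Exponential moments and exit bounds\<close>

text \<open>\<open>Js\<close> are the increments of the left side, \<open>xs\<close> those of the bottom side. Setting one of the two lists
  to zero restricts the passage time to paths that leave the boundary through the other side.\<close>

definition SE :: "nat \<Rightarrow> nat \<Rightarrow> real \<Rightarrow> real \<Rightarrow> real \<Rightarrow> (nat list \<Rightarrow> nat list \<Rightarrow> nat list list \<Rightarrow> ennreal) \<Rightarrow> ennreal" where
  "SE h m b a q f = EE (iid h b) (\<lambda>Js. EE (iid m a) (\<lambda>xs. EE (iidm h m q) (\<lambda>wss. f xs Js wss)))"

abbreviation hor_exit :: "nat \<Rightarrow> nat \<Rightarrow> real \<Rightarrow> real \<Rightarrow> real \<Rightarrow> ennreal" where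
  "hor_exit h m b a q \<equiv> SE h m b a q (\<lambda>xs Js wss. of_bool (sysval (zeros m) Js wss \<le> sysval xs (zeros h) wss))"

abbreviation ver_exit :: "nat \<Rightarrow> nat \<Rightarrow> real \<Rightarrow> real \<Rightarrow> real \<Rightarrow> ennreal" where
  "ver_exit h m b a q \<equiv> SE h m b a q (\<lambda>xs Js wss. of_bool (sysval xs (zeros h) wss \<le> sysval (zeros m) Js wss))"

lemma set_iidm: "wss \<in> set_pmf (iidm h m q) \<Longrightarrow> rectangular h m wss"
  by (auto simp: set_replicate_pmf rectangular_def in_lists_conv_set)

lemma set_iid: "xs \<in> set_pmf (iid m q) \<Longrightarrow> length xs = m"
  by (auto simp: set_replicate_pmf)

lemma SE_mono:
  assumes "\<And>xs Js wss. length xs = m \<Longrightarrow> length Js = h \<Longrightarrow> rectangular h m wss \<Longrightarrow> f xs Js wss \<le> g xs Js wss"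
  shows "SE h m b a q f \<le> SE h m b a q g"
  unfolding SE_def using assms by (intro EE_mono) (auto dest: set_iid set_iidm)

lemma SE_add: "SE h m b a q (\<lambda>xs Js wss. f xs Js wss + g xs Js wss) = SE h m b a q f + SE h m b a q g"
  by (simp add: SE_def EE_add)

lemma SE_multc: "SE h m b a q (\<lambda>xs Js wss. f xs Js wss * c) = SE h m b a q f * c"
  by (simp add: SE_def EE_multc)

lemma SE_drop_x: "SE h m b a q (\<lambda>xs Js wss. f Js wss) = SE h m b a' q (\<lambda>xs Js wss. f Js wss)"
  by (simp add: SE_def)

lemma SE_drop_J: "SE h m b a q (\<lambda>xs Js wss. f xs wss) = SE h m b' a q (\<lambda>xs Js wss. f xs wss)"
  by (simp add: SE_def)

text \<open>This is f(b') / f(b) for f(x) = (1 - x)^h / (1 - q/x)^m, whence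
  \<open>Fr_cocycle\<close> and \<open>Fr_inverse\<close>. The first factor normalises the change of
  measure on the left side, the second is the generating function of the top side.\<close>

definition Fr :: "nat \<Rightarrow> nat \<Rightarrow> real \<Rightarrow> real \<Rightarrow> real \<Rightarrow> real" where
  "Fr h m q b' b = ((1 - b') / (1 - b)) ^ h * ((1 - q / b) / (1 - q / b')) ^ m"

lemma Fr_pos: "0 < q \<Longrightarrow> q < b \<Longrightarrow> b < 1 \<Longrightarrow> q < b' \<Longrightarrow> b' < 1 \<Longrightarrow> 0 < Fr h m q b' b"
  by (auto simp: Fr_def)

lemma Fr_cocycle:
  assumes "0 < q" "q < b" "b < 1" "q < b'" "b' < 1" "q < b''" "b'' < 1"
  shows "Fr h m q b'' b = Fr h m q b'' b' / Fr h m q b b'"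
proof -
  have gen: "(z / x) ^ h * (X / Z) ^ m = ((z / y) ^ h * (Y / Z) ^ m) / ((x / y) ^ h * (Y / X) ^ m)"
    if "x \<noteq> 0" "y \<noteq> 0" "z \<noteq> 0" "X \<noteq> 0" "Y \<noteq> 0" "Z \<noteq> 0" for x y z X Y Z :: real
    using that by (simp add: power_divide field_simps)
  have "1 - q / b \<noteq> 0" "1 - q / b' \<noteq> 0" "1 - q / b'' \<noteq> 0"
    using assms by auto
  then show ?thesis
    unfolding Fr_def by (intro gen) (use assms in auto)
qed

lemma Fr_inverse: "Fr h m q b b' = inverse (Fr h m q b' b)"
  by (simp add: Fr_def power_divide)

text \<open>The passage time is the sum of the left side and of the top side. Changing the left parameter
  from \<open>b\<close> to \<open>b'\<close> cancels the contribution of the left side, and the top side is i.i.d. by Burke.\<close>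

lemma mgf_identity:
  assumes "0 < q" "q < b" "b < 1" "q < b'" "b' < 1"
  shows "SE h m b' (q / b) q (\<lambda>xs Js wss. ennreal ((b / b') ^ sysval xs Js wss)) = ennreal (Fr h m q b' b)"
proof -
  have pos: "0 < b" "0 < b'" "0 < q / b" "q / b < 1" "0 \<le> b / b'" using assms by auto
  have eq: "q / b * b = q" "q / b * (b / b') = q / b'" using pos by auto
  have lt: "q / b * (b / b') < 1" using assms by (simp add: eq)
  define C where "C = ((1 - b') / (1 - b)) ^ h"
  have C: "0 \<le> C" using assms by (auto simp: C_def)
  have "SE h m b' (q / b) q (\<lambda>xs Js wss. ennreal ((b / b') ^ sysval xs Js wss))
     = EE (iid h b) (\<lambda>Js. ennreal (C * (b' / b) ^ sum_list Js) *
         EE (iid m (q / b)) (\<lambda>xs. EE (iidm h m q) (\<lambda>wss. ennreal ((b / b') ^ sysval xs Js wss))))"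
    unfolding SE_def C_def by (rule EE_iid_change) (use assms pos in auto)
  also have "\<dots> = EE (iid h b) (\<lambda>Js. EE (iid m (q / b)) (\<lambda>xs. EE (iidm h m q) (\<lambda>wss.
        ennreal (C * (b' / b) ^ sum_list Js) * ennreal ((b / b') ^ sysval xs Js wss))))"
    by (simp add: EE_cmult)
  also have "\<dots> = EE (iid h b) (\<lambda>Js. EE (iid m (q / b)) (\<lambda>xs. EE (iidm h m q) (\<lambda>wss.
        ennreal C * ennreal ((b / b') ^ sum_list (tops xs Js wss)))))"
  proof -
    have "(C * (b' / b) ^ k) * ((b / b') ^ (k + l)) = C * (b / b') ^ l" for k l
      using pos by (simp add: power_add power_divide)
    then have "ennreal (C * (b' / b) ^ k) * ennreal ((b / b') ^ (k + l)) = ennreal C * ennreal ((b / b') ^ l)" for k l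
      using pos C by (simp add: ennreal_mult[symmetric])
    then show ?thesis by (simp add: sysval_def)
  qed
  also have "\<dots> = ennreal C * EE (iid h b) (\<lambda>Js. EE (iid m (q / b)) (\<lambda>xs. EE (iidm h m q) (\<lambda>wss.
        ennreal ((b / b') ^ sum_list (tops xs Js wss)))))"
    by (simp add: EE_cmult)
  also have "EE (iid h b) (\<lambda>Js. EE (iid m (q / b)) (\<lambda>xs. EE (iidm h m q) (\<lambda>wss.
        ennreal ((b / b') ^ sum_list (tops xs Js wss)))))
     = EE (iid h b) (\<lambda>Js. EE (iid m (q / b)) (\<lambda>xs. EE (iidm h m q) (\<lambda>wss. ennreal ((b / b') ^ sum_list xs))))"
    using burke_block[of "q / b" b h m "\<lambda>xs _ _. ennreal ((b / b') ^ sum_list xs)"] pos assms by (simp add: eq)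
  also have "\<dots> = ennreal (((1 - q / b) / (1 - q / b')) ^ m)"
    using EE_iid_power[of "q / b" "b / b'" m] pos lt by (simp add: eq)
  finally show ?thesis
    using C assms by (simp add: ennreal_mult[symmetric] Fr_def C_def)
qed

lemma sysval_ge_hor:
  assumes "length xs = m" "rectangular h m wss" "length Js = h"
  shows "sysval xs (zeros h) wss \<le> sysval xs Js wss" "sysval (zeros m) Js wss \<le> sysval xs Js wss"
  using sysval_split[OF assms] by auto

section \<open>Chernoff bounds and balanced thresholds\<close>

lemma chernoff_pointwise_up:
  assumes "1 \<le> u" "k \<le> n"
  shows "of_bool (x \<le> real k) \<le> ennreal (u ^ n) * ennreal (u powr (- x))"
proof (cases "x \<le> real k")
  case True
  have "1 \<le> u powr (real n - x)"
    using assms True by (intro ge_one_powr_ge_zero) auto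
  also have "\<dots> = u ^ n * u powr (- x)"
    using assms by (simp add: powr_diff powr_minus divide_inverse powr_realpow)
  finally show ?thesis using True assms by (simp add: ennreal_mult[symmetric])
qed auto

lemma chernoff_pointwise_low:
  assumes "0 < u" "u \<le> 1"
  shows "of_bool (real n \<le> x) \<le> ennreal (u ^ n) * ennreal (u powr (- x))"
proof (cases "real n \<le> x")
  case True
  have "1 = u powr 0" using assms by simp
  also have "\<dots> \<le> u powr (real n - x)"
    using assms True by (intro powr_mono') auto
  also have "\<dots> = u ^ n * u powr (- x)"
    using assms by (simp add: powr_diff powr_minus divide_inverse powr_realpow)
  finally show ?thesis using True assms by (simp add: ennreal_mult[symmetric])
qed auto

text \<open>The event sees only the bottom side and the bulk, so the left parameter
  \<open>b''\<close> may be replaced by the \<open>b'\<close> for which the exponential moment is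
  exact, and the bottom-only value is at most the full one. \<open>chernoff_ver\<close> moves the
  bottom parameter in the same way; \<open>chernoff_low\<close> concerns the full passage time and
  uses the moment directly.\<close>

lemma chernoff_hor:
  assumes "0 < q" "q < b'" "b' < b" "b < 1"
  shows "SE h m b'' (q / b) q (\<lambda>xs Js wss. of_bool (x \<le> real (sysval xs (zeros h) wss)))
     \<le> ennreal (Fr h m q b' b * (b / b') powr (- x))"
proof -
  have "SE h m b'' (q / b) q (\<lambda>xs Js wss. of_bool (x \<le> real (sysval xs (zeros h) wss)))
     = SE h m b' (q / b) q (\<lambda>xs Js wss. of_bool (x \<le> real (sysval xs (zeros h) wss)))"
    by (rule SE_drop_J)
  also have "\<dots> \<le> SE h m b' (q / b) q (\<lambda>xs Js wss. ennreal ((b / b') ^ sysval xs Js wss) * ennreal ((b / b') powr (- x)))"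
    using assms by (intro SE_mono chernoff_pointwise_up sysval_ge_hor) auto
  also have "\<dots> = ennreal (Fr h m q b' b * (b / b') powr (- x))"
    using assms Fr_pos[of q b b' h m] by (simp add: SE_multc mgf_identity ennreal_mult)
  finally show ?thesis .
qed

lemma chernoff_ver:
  assumes "0 < q" "q < b'" "b' < b" "b < 1"
  shows "SE h m b' a q (\<lambda>xs Js wss. of_bool (x \<le> real (sysval (zeros m) Js wss)))
     \<le> ennreal (Fr h m q b' b * (b / b') powr (- x))"
proof -
  have "SE h m b' a q (\<lambda>xs Js wss. of_bool (x \<le> real (sysval (zeros m) Js wss)))
     = SE h m b' (q / b) q (\<lambda>xs Js wss. of_bool (x \<le> real (sysval (zeros m) Js wss)))"
    by (rule SE_drop_x)
  also have "\<dots> \<le> SE h m b' (q / b) q (\<lambda>xs Js wss. ennreal ((b / b') ^ sysval xs Js wss) * ennreal ((b / b') powr (- x)))"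
    using assms by (intro SE_mono chernoff_pointwise_up sysval_ge_hor) auto
  also have "\<dots> = ennreal (Fr h m q b' b * (b / b') powr (- x))"
    using assms Fr_pos[of q b b' h m] by (simp add: SE_multc mgf_identity ennreal_mult)
  finally show ?thesis .
qed

lemma chernoff_low:
  assumes "0 < q" "q < b" "b < b'" "b' < 1"
  shows "SE h m b' (q / b) q (\<lambda>xs Js wss. of_bool (real (sysval xs Js wss) \<le> x))
     \<le> ennreal (Fr h m q b' b * (b / b') powr (- x))"
proof -
  have "SE h m b' (q / b) q (\<lambda>xs Js wss. of_bool (real (sysval xs Js wss) \<le> x))
    \<le> SE h m b' (q / b) q (\<lambda>xs Js wss. ennreal ((b / b') ^ sysval xs Js wss) * ennreal ((b / b') powr (- x)))"
    using assms by (intro SE_mono chernoff_pointwise_low) auto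
  also have "\<dots> = ennreal (Fr h m q b' b * (b / b') powr (- x))"
    using assms Fr_pos[of q b b' h m] by (simp add: SE_multc mgf_identity ennreal_mult)
  finally show ?thesis .
qed

text \<open>This balance is what costs the cube root in the exit bounds: with y^3 = \<alpha>\<beta>,
  one threshold makes the first two terms equal to y and the third equal to y^2.\<close>

lemma optimise_three_terms:
  fixes \<alpha> \<beta> \<rho> :: real
  assumes "0 < \<alpha>" "0 < \<beta>" "1 < \<rho>" "\<alpha> * \<beta> \<le> 1"
  obtains x where "\<beta> / \<alpha> * (\<rho> * \<rho>) powr (- x) + \<alpha> * inverse \<rho> powr (- x) + \<beta> * \<rho> powr (- x) \<le> 3 * (\<alpha> * \<beta>) powr (1/3)"
proof
  define R where "R = \<alpha> * \<beta>"
  have R: "0 < R" "R \<le> 1" using assms by (auto simp: R_def)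
  define y where "y = R powr (1/3)"
  have y: "0 < y" "y \<le> 1" using R by (auto simp: y_def powr_le1)
  have y3: "y ^ 3 = R" using R by (simp add: y_def powr_realpow[symmetric] powr_powr)
  define x where "x = log \<rho> (y / \<alpha>)"
  have e: "\<rho> powr x = y / \<alpha>" using assms y by (simp add: x_def)
  have e2: "\<rho> powr (- x) = \<alpha> / y" using e by (simp add: powr_minus)
  have e3: "inverse \<rho> powr (- x) = y / \<alpha>" using assms e by (simp add: powr_minus inverse_powr)
  have e4: "(\<rho> * \<rho>) powr (- x) = (\<alpha> / y)^2" using assms by (simp add: powr_mult e2 power2_eq_square)
  have t1: "\<beta> / \<alpha> * (\<rho> * \<rho>) powr (- x) = y"
  proof -
    have "\<beta> / \<alpha> * (\<alpha> / y)^2 = R / y^2" using assms by (simp add: R_def power2_eq_square field_simps)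
    also have "\<dots> = y" using y by (simp add: y3[symmetric] power2_eq_square power3_eq_cube)
    finally show ?thesis by (simp add: e4)
  qed
  have t2: "\<alpha> * inverse \<rho> powr (- x) = y" using assms by (simp add: e3)
  have t3: "\<beta> * \<rho> powr (- x) \<le> y"
  proof -
    have "\<beta> * \<rho> powr (- x) = R / y" by (simp add: e2 R_def)
    also have "\<dots> = y * y" using y by (simp add: y3[symmetric] power3_eq_cube)
    also have "\<dots> \<le> y" using y by (simp add: mult_left_le)
    finally show ?thesis .
  qed
  show "\<beta> / \<alpha> * (\<rho> * \<rho>) powr (- x) + \<alpha> * inverse \<rho> powr (- x) + \<beta> * \<rho> powr (- x) \<le> 3 * (\<alpha> * \<beta>) powr (1/3)"
    using t1 t2 t3 by (simp add: y_def R_def)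
qed

text \<open>A horizontal exit puts the bottom value above a level x or the left value below it. The
  left value does not see the bottom parameter, so the latter is raised from q/b0 to q/b1; then a
  left value below x forces the full value below x or the bottom value above x. The geometric
  progression turns the bases of the three Chernoff terms into powers of one ratio. With f as for
  \<open>Fr\<close>, \<open>R\<close> is f(b0) f(b2) / f(b1)^2, a second difference of log
  f.\<close>

lemma exit_hor_bound:
  assumes q: "0 < q" "q < b2" "b2 < b1" "b1 < b0" "b0 < 1" and geom: "b0 * b2 = b1 * b1"
    and R: "R = Fr h m q b0 b1 * Fr h m q b2 b1" "R \<le> 1"
  shows "hor_exit h m b0 (q / b0) q
     \<le> ennreal (3 * R powr (1/3))"
proof -
  define \<alpha> \<beta> \<rho> where "\<alpha> = Fr h m q b0 b1" "\<beta> = Fr h m q b2 b1" "\<rho> = b0 / b1"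
  note d = \<alpha>_\<beta>_\<rho>_def
  have pos: "0 < \<alpha>" "0 < \<beta>" "1 < \<rho>" "\<alpha> * \<beta> \<le> 1" using q R by (auto simp: d Fr_pos)
  have \<rho>: "b1 / b2 = \<rho>" "b0 / b2 = \<rho> * \<rho>" "b1 / b0 = inverse \<rho>" "Fr h m q b2 b0 = \<beta> / \<alpha>"
    using q geom Fr_cocycle[of q b0 b1 b2 h m] by (auto simp: d field_simps)
  obtain x where x: "\<beta> / \<alpha> * (\<rho> * \<rho>) powr (- x) + \<alpha> * inverse \<rho> powr (- x) + \<beta> * \<rho> powr (- x) \<le> 3 * (\<alpha> * \<beta>) powr (1/3)"
    using optimise_three_terms[OF pos] .
  have "SE h m b0 (q / b1) q (\<lambda>xs Js wss. of_bool (real (sysval (zeros m) Js wss) \<le> x))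
     \<le> SE h m b0 (q / b1) q (\<lambda>xs Js wss. of_bool (real (sysval xs Js wss) \<le> x) + of_bool (x \<le> real (sysval xs (zeros h) wss)))"
  proof (rule SE_mono)
    fix xs Js :: "nat list" and wss assume "length xs = m" "length Js = h" "rectangular h m wss"
    then have "sysval xs Js wss = max (sysval xs (zeros h) wss) (sysval (zeros m) Js wss)"
      by (intro sysval_split)
    then show "of_bool (real (sysval (zeros m) Js wss) \<le> x) \<le> of_bool (real (sysval xs Js wss) \<le> x) + (of_bool (x \<le> real (sysval xs (zeros h) wss)) :: ennreal)"
      by (auto simp: of_bool_def)
  qed
  also have "\<dots> \<le> ennreal (Fr h m q b0 b1 * (b1 / b0) powr (- x)) + ennreal (Fr h m q b2 b1 * (b1 / b2) powr (- x))"
    unfolding SE_add using q by (intro add_mono chernoff_low chernoff_hor) auto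
  finally have low: "SE h m b0 (q / b1) q (\<lambda>xs Js wss. of_bool (real (sysval (zeros m) Js wss) \<le> x))
     \<le> ennreal (Fr h m q b0 b1 * (b1 / b0) powr (- x)) + ennreal (Fr h m q b2 b1 * (b1 / b2) powr (- x))" .
  have "hor_exit h m b0 (q / b0) q
    \<le> SE h m b0 (q / b0) q (\<lambda>xs Js wss. of_bool (x \<le> real (sysval xs (zeros h) wss)) + of_bool (real (sysval (zeros m) Js wss) \<le> x))"
    by (rule SE_mono) (auto simp: of_bool_def)
  also have "\<dots> = SE h m b0 (q / b0) q (\<lambda>xs Js wss. of_bool (x \<le> real (sysval xs (zeros h) wss)))
      + SE h m b0 (q / b1) q (\<lambda>xs Js wss. of_bool (real (sysval (zeros m) Js wss) \<le> x))"
    unfolding SE_add by (subst SE_drop_x[where a = "q / b0" and a' = "q / b1"]) simp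
  also have "\<dots> \<le> ennreal (Fr h m q b2 b0 * (b0 / b2) powr (- x)) +
       (ennreal (Fr h m q b0 b1 * (b1 / b0) powr (- x)) + ennreal (Fr h m q b2 b1 * (b1 / b2) powr (- x)))"
    using chernoff_hor[of q b2 b0 h m b0 x] q low by (intro add_mono) auto
  also have "\<dots> = ennreal (\<beta> / \<alpha> * (\<rho> * \<rho>) powr (- x) + \<alpha> * inverse \<rho> powr (- x) + \<beta> * \<rho> powr (- x))"
    using pos by (simp add: \<rho> d[symmetric] ennreal_plus[symmetric] add.assoc del: ennreal_plus)
  also have "\<dots> \<le> ennreal (3 * R powr (1/3))"
    using x by (intro ennreal_leI) (simp add: R d)
  finally show ?thesis .
qed

text \<open>Mirror image of \<open>exit_hor_bound\<close>: the bottom value is now the insensitive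
  one, the left parameter is raised from b0 to b1, and \<open>R\<close> is f(b1)^2 / (f(b0)
  f(b2)).\<close>

lemma exit_ver_bound:
  assumes q: "0 < q" "q < b0" "b0 < b1" "b1 < b2" "b2 < 1" and geom: "b0 * b2 = b1 * b1"
    and R: "R = Fr h m q b1 b0 * Fr h m q b1 b2" "R \<le> 1"
  shows "ver_exit h m b0 (q / b0) q
     \<le> ennreal (3 * R powr (1/3))"
proof -
  define \<alpha> \<beta> \<rho> where "\<alpha> = Fr h m q b1 b0" "\<beta> = Fr h m q b1 b2" "\<rho> = b1 / b0"
  note d = \<alpha>_\<beta>_\<rho>_def
  have pos: "0 < \<alpha>" "0 < \<beta>" "1 < \<rho>" "\<alpha> * \<beta> \<le> 1" using q R by (auto simp: d Fr_pos)
  have "Fr h m q b0 b2 = Fr h m q b0 b1 / Fr h m q b2 b1"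
    using Fr_cocycle[of q b2 b1 b0 h m] q by simp
  also have "\<dots> = \<beta> / \<alpha>"
    by (simp add: d Fr_inverse[of h m q b0 b1] Fr_inverse[of h m q b2 b1] divide_inverse)
  finally have F: "Fr h m q b0 b2 = \<beta> / \<alpha>" .
  have \<rho>: "b2 / b1 = \<rho>" "b2 / b0 = \<rho> * \<rho>" "b0 / b1 = inverse \<rho>"
    using q geom by (auto simp: d field_simps)
  obtain x where x: "\<beta> / \<alpha> * (\<rho> * \<rho>) powr (- x) + \<alpha> * inverse \<rho> powr (- x) + \<beta> * \<rho> powr (- x) \<le> 3 * (\<alpha> * \<beta>) powr (1/3)"
    using optimise_three_terms[OF pos] .
  have "SE h m b1 (q / b0) q (\<lambda>xs Js wss. of_bool (real (sysval xs (zeros h) wss) \<le> x))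
     \<le> SE h m b1 (q / b0) q (\<lambda>xs Js wss. of_bool (real (sysval xs Js wss) \<le> x) + of_bool (x \<le> real (sysval (zeros m) Js wss)))"
  proof (rule SE_mono)
    fix xs Js :: "nat list" and wss assume "length xs = m" "length Js = h" "rectangular h m wss"
    then have "sysval xs Js wss = max (sysval xs (zeros h) wss) (sysval (zeros m) Js wss)"
      by (intro sysval_split)
    then show "of_bool (real (sysval xs (zeros h) wss) \<le> x) \<le> of_bool (real (sysval xs Js wss) \<le> x) + (of_bool (x \<le> real (sysval (zeros m) Js wss)) :: ennreal)"
      by (auto simp: of_bool_def)
  qed
  also have "\<dots> \<le> ennreal (Fr h m q b1 b0 * (b0 / b1) powr (- x)) + ennreal (Fr h m q b1 b2 * (b2 / b1) powr (- x))"
    unfolding SE_add using q by (intro add_mono chernoff_low chernoff_ver) auto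
  finally have low: "SE h m b1 (q / b0) q (\<lambda>xs Js wss. of_bool (real (sysval xs (zeros h) wss) \<le> x))
     \<le> ennreal (Fr h m q b1 b0 * (b0 / b1) powr (- x)) + ennreal (Fr h m q b1 b2 * (b2 / b1) powr (- x))" .
  have "ver_exit h m b0 (q / b0) q
    \<le> SE h m b0 (q / b0) q (\<lambda>xs Js wss. of_bool (x \<le> real (sysval (zeros m) Js wss)) + of_bool (real (sysval xs (zeros h) wss) \<le> x))"
    by (rule SE_mono) (auto simp: of_bool_def)
  also have "\<dots> = SE h m b0 (q / b0) q (\<lambda>xs Js wss. of_bool (x \<le> real (sysval (zeros m) Js wss)))
      + SE h m b1 (q / b0) q (\<lambda>xs Js wss. of_bool (real (sysval xs (zeros h) wss) \<le> x))"
    unfolding SE_add by (subst SE_drop_J[where b = b0 and b' = b1]) simp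
  also have "\<dots> \<le> ennreal (Fr h m q b0 b2 * (b2 / b0) powr (- x)) +
       (ennreal (Fr h m q b1 b0 * (b0 / b1) powr (- x)) + ennreal (Fr h m q b1 b2 * (b2 / b1) powr (- x)))"
    using chernoff_ver[of q b0 b2 h m "q / b0" x] q low by (intro add_mono) auto
  also have "\<dots> = ennreal (\<beta> / \<alpha> * (\<rho> * \<rho>) powr (- x) + \<alpha> * inverse \<rho> powr (- x) + \<beta> * \<rho> powr (- x))"
    using pos by (simp add: \<rho> F d[symmetric] ennreal_plus[symmetric] add.assoc del: ennreal_plus)
  also have "\<dots> \<le> ennreal (3 * R powr (1/3))"
    using x by (intro ennreal_leI) (simp add: R d)
  finally show ?thesis .
qed

section \<open>Quantitative exit tails\<close>

text \<open>The variance of \<open>geo x\<close>, and the second derivative of -log (1 - x) with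
  respect to log x.\<close>

definition gg :: "real \<Rightarrow> real" where "gg x = x / (1 - x)^2"

text \<open>2 cosh \<delta> - 2, the square of 2 sinh (\<delta>/2). Keeping it unexpanded makes
  \<open>second_diff\<close> an identity.\<close>

definition eta :: "real \<Rightarrow> real" where "eta \<delta> = exp \<delta> + exp (- \<delta>) - 2"

lemma second_diff: "b \<noteq> 1 \<Longrightarrow> (1 - b * exp \<delta>) * (1 - b * exp (- \<delta>)) / (1 - b)^2 = 1 - eta \<delta> * gg b"
proof -
  assume "b \<noteq> 1"
  have "(1 - b * exp \<delta>) * (1 - b * exp (- \<delta>)) = 1 - b * exp \<delta> - b * exp (- \<delta>) + b * b * (exp \<delta> * exp (- \<delta>))"
    by (simp add: algebra_simps)
  also have "\<dots> = (1 - b)^2 - b * eta \<delta>"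
    by (simp add: exp_minus eta_def power2_eq_square algebra_simps)
  finally show ?thesis
    using \<open>b \<noteq> 1\<close> by (simp add: gg_def diff_divide_distrib)
qed

text \<open>At b1 = sqrt q the two variances \<open>gg b1\<close> and \<open>gg (q / b1)\<close>
  agree; for b1 tilted by \<delta> they differ by order \<delta>. With the factor \<open>eta\<close>
  of order \<delta>^2 this produces the exponent \<delta>^3 when h and m are nearly equal.\<close>

lemma Fr_second_diff:
  assumes "b1 \<noteq> 1" "q / b1 \<noteq> 1" "0 < b1"
  shows "Fr h m q (b1 * exp \<delta>) b1 * Fr h m q (b1 * exp (- \<delta>)) b1
    = (1 - eta \<delta> * gg b1) ^ h / (1 - eta \<delta> * gg (q / b1)) ^ m"
proof -
  define a where "a = q / b1"
  have e: "q / (b1 * exp \<delta>) = a * exp (- \<delta>)" "q / (b1 * exp (- \<delta>)) = a * exp \<delta>"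
    by (simp_all add: a_def exp_minus field_simps)
  have "Fr h m q (b1 * exp \<delta>) b1 * Fr h m q (b1 * exp (- \<delta>)) b1
     = ((1 - b1 * exp \<delta>) * (1 - b1 * exp (- \<delta>)) / (1 - b1)^2) ^ h / ((1 - a * exp \<delta>) * (1 - a * exp (- \<delta>)) / (1 - a)^2) ^ m"
    unfolding Fr_def e a_def[symmetric] by (simp add: power_divide power_mult_distrib power2_eq_square power_mult[symmetric] mult_ac)
  then show ?thesis
    using second_diff[of b1 \<delta>] second_diff[of a \<delta>] assms by (simp add: a_def)
qed

lemma Fr_second_diff':
  assumes "b1 \<noteq> 1" "q / b1 \<noteq> 1" "0 < b1"
  shows "Fr h m q b1 (b1 * exp \<delta>) * Fr h m q b1 (b1 * exp (- \<delta>))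
    = (1 - eta \<delta> * gg (q / b1)) ^ m / (1 - eta \<delta> * gg b1) ^ h"
proof -
  have "Fr h m q b1 (b1 * exp \<delta>) * Fr h m q b1 (b1 * exp (- \<delta>))
     = inverse (Fr h m q (b1 * exp \<delta>) b1 * Fr h m q (b1 * exp (- \<delta>)) b1)"
    by (subst (1 2) Fr_inverse) simp
  then show ?thesis
    using Fr_second_diff[OF assms] by simp
qed

lemma eta_bounds:
  assumes "0 \<le> \<delta>" "\<delta> \<le> 1"
  shows "\<delta>^2 / 4 \<le> eta \<delta>" "eta \<delta> \<le> 2 * \<delta>^2"
proof -
  define x where "x = exp (\<delta> / 2) - exp (- (\<delta> / 2))"
  have e: "eta \<delta> = x^2"
    by (simp add: x_def eta_def power2_eq_square algebra_simps exp_add[symmetric])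
  have lo: "\<delta> / 2 \<le> x"
  proof -
    have "1 + \<delta> / 2 \<le> exp (\<delta> / 2)" "exp (- (\<delta> / 2)) \<le> 1" using assms exp_ge_add_one_self[of "\<delta> / 2"] by auto
    then show ?thesis unfolding x_def by linarith
  qed
  have hi: "x \<le> 5 / 4 * \<delta>"
  proof -
    have "exp (\<delta> / 2) \<le> 1 + \<delta> / 2 + (\<delta> / 2)^2" using assms by (intro exp_bound) auto
    moreover have "1 + - (\<delta> / 2) \<le> exp (- (\<delta> / 2))" by (rule exp_ge_add_one_self)
    moreover have "(\<delta> / 2)^2 \<le> \<delta> / 4" using assms by (auto simp: power2_eq_square mult_left_le)
    ultimately show ?thesis by (simp add: x_def)
  qed
  have "(\<delta> / 2)^2 \<le> x^2" using lo assms by (intro power_mono) auto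
  then show "\<delta>^2 / 4 \<le> eta \<delta>" by (simp add: e power_divide)
  have "x^2 \<le> (5 / 4 * \<delta>)^2" using lo hi assms by (intro power_mono) auto
  also have "\<dots> \<le> 2 * \<delta>^2" by (simp add: power_mult_distrib power_divide)
  finally show "eta \<delta> \<le> 2 * \<delta>^2" by (simp add: e)
qed

section \<open>Comparison of the two variances under a tilt\<close>

lemma gg_lower: "0 \<le> x \<Longrightarrow> x < 1 \<Longrightarrow> x \<le> gg x"
  by (simp add: gg_def field_simps power_le_one mult_left_le)

lemma gg_nonneg: "0 \<le> x \<Longrightarrow> 0 \<le> gg x"
  by (simp add: gg_def)

lemma gg_diff_lower:
  assumes "0 \<le> x" "x \<le> y" "y < 1"
  shows "y - x \<le> gg y - gg x"
proof -
  have "y - x \<le> (y - x) / (1 - x)^2"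
  proof -
    have "(1 - x)^2 \<le> 1" "0 < (1 - x)^2" using assms by (auto simp: power_le_one)
    then show ?thesis using assms by (simp add: pos_le_divide_eq mult_left_le)
  qed
  also have "\<dots> = y / (1 - x)^2 - gg x" by (simp add: gg_def diff_divide_distrib)
  also have "\<dots> \<le> gg y - gg x"
    using assms by (auto simp: gg_def intro!: divide_left_mono power_mono)
  finally show ?thesis .
qed

lemma gg_mono: "0 \<le> x \<Longrightarrow> x \<le> y \<Longrightarrow> y < 1 \<Longrightarrow> gg x \<le> gg y"
  using gg_diff_lower[of x y] by simp

lemma gg_diff_upper:
  assumes "0 \<le> x" "x \<le> y" "y \<le> t" "t < 1"
  shows "gg y - gg x \<le> (y - x) / (1 - t)^4"
proof -
  have "gg y - gg x = (y - x) * (1 - x * y) / ((1 - x)^2 * (1 - y)^2)"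
    using assms by (simp add: gg_def divide_simps) algebra
  also have "\<dots> \<le> (y - x) * 1 / ((1 - t)^2 * (1 - t)^2)"
    using assms by (intro frac_le mult_mono power_mono) (auto intro!: mult_pos_pos mult_le_one)
  finally show ?thesis by (simp flip: power_add)
qed

text \<open>Uses 1 - x \<le> exp (-x) on the left and 1 - y \<ge> exp (-y - 2 y^2) on the right; the
  quadratic term in the last hypothesis is the price for linearising both powers.\<close>

lemma power_compare:
  fixes x y D :: real
  assumes "x \<le> 1" "0 \<le> y" "y \<le> 1/2" "D + real m * (y + 2 * y^2) \<le> real h * x"
  shows "(1 - x) ^ h \<le> exp (- D) * (1 - y) ^ m"
proof -
  have "(1 - x) ^ h \<le> exp (- x) ^ h"
    using assms exp_ge_add_one_self[of "- x"] by (intro power_mono) auto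
  also have "\<dots> = exp (- (real h * x))" by (simp flip: exp_of_nat_mult)
  also have "\<dots> \<le> exp (- D + real m * (- y - 2 * y^2))"
    using assms by (simp add: algebra_simps)
  also have "\<dots> = exp (- D) * exp (- y - 2 * y^2) ^ m" by (simp only: exp_add exp_of_nat_mult)
  also have "\<dots> \<le> exp (- D) * (1 - y) ^ m"
  proof (intro mult_left_mono power_mono)
    have "- y - 2 * y^2 \<le> ln (1 - y)"
      using assms by (intro ln_one_minus_pos_lower_bound) auto
    then show "exp (- y - 2 * y^2) \<le> 1 - y" using assms by (simp add: ln_ge_iff)
  qed auto
  finally show ?thesis .
qed

text \<open>The variance gap B - A is at least s\<delta>. The tolerated excess of \<open>m\<close>
  over \<open>h\<close> and the quadratic correction of \<open>power_compare\<close> each use up at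
  most a quarter of it; part of the surplus, times \<open>eta\<close>, is the \<delta>^3
  rate.\<close>

lemma gg_ratio_near:
  fixes s :: real
  assumes s: "0 < s" "s < 1"
  obtains c \<kappa> \<delta>0 where "0 < c" "0 < \<kappa>" "0 < \<delta>0" "\<delta>0 \<le> 1" "s * exp (4 * \<delta>0) < 1"
    "\<And>\<delta> h m. 0 < \<delta> \<Longrightarrow> \<delta> \<le> \<delta>0 \<Longrightarrow> real m \<le> real h * (1 + \<kappa> * \<delta>) \<Longrightarrow>
       0 < 1 - eta \<delta> * gg (s * exp (- \<delta>)) \<and> 0 < 1 - eta \<delta> * gg (s * exp \<delta>) \<and>
       (1 - eta \<delta> * gg (s * exp \<delta>)) ^ h \<le> exp (- (c * \<delta>^3 * h)) * (1 - eta \<delta> * gg (s * exp (- \<delta>))) ^ m"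
proof -
  define t where "t = (1 + s) / 2"
  have t: "s < t" "t < 1" "0 < t" using s by (auto simp: t_def)
  define \<Gamma> where "\<Gamma> = gg t"
  have \<Gamma>: "0 < \<Gamma>" using t by (simp add: \<Gamma>_def gg_def)
  \<comment> \<open>The entries keep, in turn, \<delta> at most 1, all tilted parameters at most
    \<open>t\<close> < 1, \<open>eta\<close> times a variance at most 1/4, and the quadratic
    correction at most s\<delta>/4.\<close>
  define \<delta>0 where "\<delta>0 = Min {1, ln (t / s) / 4, 1 / (8 * \<Gamma>), s / (16 * \<Gamma>^2)}"
  have \<delta>0: "0 < \<delta>0" "\<delta>0 \<le> 1" "\<delta>0 \<le> ln (t / s) / 4" "\<delta>0 \<le> 1 / (8 * \<Gamma>)" "\<delta>0 \<le> s / (16 * \<Gamma>^2)"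
    using s t \<Gamma> unfolding \<delta>0_def by auto
  have et: "s * exp (4 * \<delta>0) \<le> t"
  proof -
    have "exp (4 * \<delta>0) \<le> exp (ln (t / s))" using \<delta>0 by simp
    also have "\<dots> = t / s" using s t by simp
    finally show ?thesis using s by (simp add: field_simps)
  qed
  show ?thesis
  \<comment> \<open>s/16 is a surplus s/4 times the factor 1/4 of \<open>eta_bounds\<close>; with
    the second constant s/(8\<Gamma>), the excess of \<open>m\<close> costs at most
    s\<delta>/4.\<close>
  proof (rule that[of "s / 16" "s / (8 * \<Gamma>)" \<delta>0])
    fix \<delta> :: real and h m :: nat
    assume \<delta>: "0 < \<delta>" "\<delta> \<le> \<delta>0" and m: "real m \<le> real h * (1 + s / (8 * \<Gamma>) * \<delta>)"
    define \<kappa> where "\<kappa> = s / (8 * \<Gamma>)"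
    define A where "A = gg (s * exp (- \<delta>))"
    define B where "B = gg (s * exp \<delta>)"
    define e where "e = eta \<delta>"
    have \<delta>1: "\<delta> \<le> 1" using \<delta> \<delta>0 by simp
    have e: "\<delta>^2 / 4 \<le> e" "e \<le> 2 * \<delta>^2" "0 < e" using eta_bounds[of \<delta>] \<delta> \<delta>1 by (auto simp: e_def intro: less_le_trans[of 0 "\<delta>^2/4"])
    have ub: "s * exp \<delta> \<le> t" using et \<delta> s by (smt (verit) exp_le_cancel_iff mult_left_mono)
    have lb: "s * exp (- \<delta>) \<le> t"
    proof -
      have "s * exp (- \<delta>) \<le> s * 1" using s \<delta> by (intro mult_left_mono) auto
      then show ?thesis using t by linarith
    qed
    have A: "0 \<le> A" "A \<le> \<Gamma>" using s lb t unfolding A_def \<Gamma>_def by (auto intro!: gg_nonneg gg_mono)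
    have B: "0 \<le> B" "B \<le> \<Gamma>" using s ub t unfolding B_def \<Gamma>_def by (auto intro!: gg_nonneg gg_mono)
    have AB: "s * \<delta> \<le> B - A"
    proof -
      have "s * \<delta> \<le> s * (exp \<delta> - exp (- \<delta>))"
      proof (intro mult_left_mono)
        have "exp (- \<delta>) \<le> 1" using \<delta> by simp
        then show "\<delta> \<le> exp \<delta> - exp (- \<delta>)" using exp_ge_add_one_self[of \<delta>] by linarith
      qed (use s in simp)
      also have "\<dots> \<le> B - A" unfolding A_def B_def
        using gg_diff_lower[of "s * exp (- \<delta>)" "s * exp \<delta>"] s \<delta> ub t by (simp add: algebra_simps)
      finally show ?thesis .
    qed
    have \<delta>\<Gamma>: "8 * \<delta> * \<Gamma> \<le> 1" using order_trans[OF \<delta>(2) \<delta>0(4)] \<Gamma> by (simp add: pos_le_divide_eq mult_ac)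
    have \<delta>\<Gamma>2: "16 * \<delta> * \<Gamma>^2 \<le> s" using order_trans[OF \<delta>(2) \<delta>0(5)] \<Gamma> by (simp add: pos_le_divide_eq mult_ac)
    have e4: "e * \<Gamma> \<le> 2 * \<delta>^2 * \<Gamma>" using e \<Gamma> by simp
    have d2: "2 * \<delta>^2 * \<Gamma> \<le> 1/4"
    proof -
      have "2 * \<delta>^2 * \<Gamma> = \<delta> * (8 * \<delta> * \<Gamma>) / 4" by (simp add: power2_eq_square)
      also have "\<dots> \<le> 1 * 1 / 4" using \<delta> \<delta>1 \<delta>\<Gamma> \<Gamma> by (intro divide_right_mono mult_mono) auto
      finally show ?thesis by simp
    qed
    have e\<Gamma>: "e * X \<le> 1/4" if "X \<le> \<Gamma>" for X
      using mult_left_mono[OF that less_imp_le[OF e(3)]] e4 d2 by linarith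
    have eA: "e * A \<le> 1/4" "e * B \<le> 1/4" "0 \<le> e * A"
      using e\<Gamma>[OF A(2)] e\<Gamma>[OF B(2)] mult_nonneg_nonneg[of e A] mult_nonneg_nonneg[of e B] A(1) B(1) e(3) by linarith+
    have key: "s / 4 * \<delta> + (1 + \<kappa> * \<delta>) * (A * (1 + 2 * (e * A))) \<le> B"
    proof -
      have "2 * (e * A) \<le> 4 * \<delta>^2 * \<Gamma>" using mult_left_mono[OF A(2) less_imp_le[OF e(3)]] e4 by linarith
      then have "(1 + \<kappa> * \<delta>) * (A * (1 + 2 * (e * A))) \<le> (1 + \<kappa> * \<delta>) * (A * (1 + 4 * \<delta>^2 * \<Gamma>))"
        using A \<delta> s \<Gamma> by (intro mult_left_mono add_left_mono) (auto simp: \<kappa>_def)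
      also have "\<dots> = A + A * (\<kappa> * \<delta> + 4 * \<delta>^2 * \<Gamma> + \<kappa> * \<delta> * (4 * \<delta>^2 * \<Gamma>))" by (simp add: algebra_simps)
      also have "\<dots> \<le> A + A * (\<kappa> * \<delta> + 4 * \<delta>^2 * \<Gamma> + \<kappa> * \<delta> * 1)"
        using A \<delta> s \<Gamma> d2 by (intro add_left_mono mult_left_mono) (auto simp: \<kappa>_def)
      also have "\<dots> \<le> A + \<Gamma> * (\<kappa> * \<delta> + 4 * \<delta>^2 * \<Gamma> + \<kappa> * \<delta> * 1)"
        using A \<delta> s \<Gamma> by (intro add_left_mono mult_right_mono) (auto simp: \<kappa>_def)
      also have "\<dots> = A + s / 4 * \<delta> + \<delta> * (16 * \<delta> * \<Gamma>^2) / 4"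
        using \<Gamma> by (simp add: \<kappa>_def field_simps power2_eq_square)
      also have "\<dots> \<le> A + s / 4 * \<delta> + \<delta> * s / 4"
        using \<delta> \<delta>\<Gamma>2 by (intro add_left_mono divide_right_mono mult_left_mono) auto
      finally have "(1 + \<kappa> * \<delta>) * (A * (1 + 2 * (e * A))) \<le> A + s * \<delta> / 4 + s * \<delta> / 4"
        by (simp only: times_divide_eq_left mult.commute[of \<delta> s])
      moreover have "s / 4 * \<delta> = s * \<delta> / 4" by simp
      ultimately show ?thesis using AB mult_pos_pos[OF s(1) \<delta>(1)] by linarith
    qed
    have "s / 16 * \<delta>^3 * h + real m * (e * A + 2 * (e * A)^2) \<le> real h * (e * B)"
    proof -
      have "real m * (e * A + 2 * (e * A)^2) \<le> real h * (1 + \<kappa> * \<delta>) * (e * A + 2 * (e * A)^2)"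
        using m eA by (intro mult_right_mono) (auto simp: \<kappa>_def)
      moreover have "s / 16 * \<delta>^3 * h \<le> real h * e * (s / 4 * \<delta>)"
      proof -
        have "s / 16 * \<delta>^3 * h = real h * (\<delta>^2 / 4) * (s / 4 * \<delta>)" by (simp add: power2_eq_square power3_eq_cube)
        also have "\<dots> \<le> real h * e * (s / 4 * \<delta>)" using e s \<delta> by (intro mult_right_mono mult_left_mono) auto
        finally show ?thesis .
      qed
      moreover have "real h * e * (s / 4 * \<delta> + (1 + \<kappa> * \<delta>) * (A * (1 + 2 * (e * A)))) \<le> real h * e * B"
        using key e by (intro mult_left_mono) auto
      ultimately show ?thesis by (simp add: algebra_simps power2_eq_square)
    qed
    then have "(1 - e * B) ^ h \<le> exp (- (s / 16 * \<delta>^3 * h)) * (1 - e * A) ^ m"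
      using eA by (intro power_compare) auto
    then show "0 < 1 - eta \<delta> * gg (s * exp (- \<delta>)) \<and> 0 < 1 - eta \<delta> * gg (s * exp \<delta>) \<and>
       (1 - eta \<delta> * gg (s * exp \<delta>)) ^ h \<le> exp (- (s / 16 * \<delta>^3 * h)) * (1 - eta \<delta> * gg (s * exp (- \<delta>))) ^ m"
      using eA unfolding A_def B_def e_def by auto
  qed (use s \<Gamma> \<delta>0 et t in auto)
qed

text \<open>Now the tilt is adverse: the variance B attached to \<open>h\<close> exceeds the
  variance A attached to \<open>m\<close> by order \<delta>. Making \<open>h\<close> smaller than
  \<open>m\<close> by the fraction K\<delta> gains K\<delta>A, which wins once \<open>K\<close> is
  large.\<close>

lemma gg_ratio_far:
  fixes s :: real
  assumes s: "0 < s" "s < 1"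
  obtains K \<delta>0 where "0 < K" "0 < \<delta>0" "\<delta>0 \<le> 1" "s * exp (4 * \<delta>0) < 1"
    "\<And>\<delta> h m. 0 < \<delta> \<Longrightarrow> \<delta> \<le> \<delta>0 \<Longrightarrow> real h + K * \<delta> * real m \<le> real m \<Longrightarrow>
       0 < 1 - eta \<delta> * gg (s * exp (- (3 * \<delta>))) \<and> 0 < 1 - eta \<delta> * gg (s * exp (3 * \<delta>)) \<and>
       (1 - eta \<delta> * gg (s * exp (- (3 * \<delta>)))) ^ m \<le> exp (- (\<delta>^3 * m)) * (1 - eta \<delta> * gg (s * exp (3 * \<delta>))) ^ h"
proof -
  define t where "t = (1 + s) / 2"
  have t: "s < t" "t < 1" "0 < t" using s by (auto simp: t_def)
  define \<Gamma> where "\<Gamma> = gg t"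
  have \<Gamma>: "0 < \<Gamma>" using t by (simp add: \<Gamma>_def gg_def)
  \<comment> \<open>\<open>M\<close> bounds the adverse terms per unit of \<delta>: 9/(1 - t)^4 for
    the variance gap and 4\<Gamma>^2 for the quadratic correction. As A is at least s exp (-3),
    \<open>K\<close> makes the gain at least (M + 4)\<delta>; the 4 left over offsets the 1/4 in
    \<open>eta_bounds\<close>.\<close>
  define M where "M = 9 / (1 - t)^4 + 4 * \<Gamma>^2"
  define K where "K = (M + 4) / (s * exp (- 3))"
  have M: "0 < M" using t \<Gamma> by (auto simp: M_def intro!: add_pos_pos)
  have K: "0 < K" "K * (s * exp (- 3)) = M + 4" using M s by (auto simp: K_def)
  define \<delta>0 where "\<delta>0 = Min {1/3, ln (t / s) / 4, 1 / (8 * \<Gamma>), 1 / K}"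
  have \<delta>0: "0 < \<delta>0" "\<delta>0 \<le> 1/3" "\<delta>0 \<le> ln (t / s) / 4" "\<delta>0 \<le> 1 / (8 * \<Gamma>)" "\<delta>0 \<le> 1 / K"
    using s t \<Gamma> K unfolding \<delta>0_def by auto
  have et: "s * exp (4 * \<delta>0) \<le> t"
  proof -
    have "exp (4 * \<delta>0) \<le> exp (ln (t / s))" using \<delta>0 by simp
    also have "\<dots> = t / s" using s t by simp
    finally show ?thesis using s by (simp add: field_simps)
  qed
  show ?thesis
  proof (rule that[of K \<delta>0])
    fix \<delta> :: real and h m :: nat
    assume \<delta>: "0 < \<delta>" "\<delta> \<le> \<delta>0" and hm: "real h + K * \<delta> * real m \<le> real m"
    define A where "A = gg (s * exp (- (3 * \<delta>)))"
    define B where "B = gg (s * exp (3 * \<delta>))"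
    define e where "e = eta \<delta>"
    have \<delta>1: "\<delta> \<le> 1" "3 * \<delta> \<le> 1" using \<delta> \<delta>0 by auto
    have e: "\<delta>^2 / 4 \<le> e" "e \<le> 2 * \<delta>^2" "0 < e" using eta_bounds[of \<delta>] \<delta> \<delta>1 by (auto simp: e_def intro: less_le_trans[of 0 "\<delta>^2/4"])
    have ub: "s * exp (3 * \<delta>) \<le> t" using et \<delta> s by (smt (verit) exp_le_cancel_iff mult_left_mono)
    have lb: "s * exp (- (3 * \<delta>)) \<le> t"
    proof -
      have "s * exp (- (3 * \<delta>)) \<le> s * 1" using s \<delta> by (intro mult_left_mono) auto
      then show ?thesis using t by linarith
    qed
    have A: "0 \<le> A" "A \<le> \<Gamma>" using s lb t unfolding A_def \<Gamma>_def by (auto intro!: gg_nonneg gg_mono)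
    have B: "0 \<le> B" "B \<le> \<Gamma>" using s ub t unfolding B_def \<Gamma>_def by (auto intro!: gg_nonneg gg_mono)
    have Alow: "s * exp (- 3) \<le> A"
    proof -
      have "s * exp (- 3) \<le> s * exp (- (3 * \<delta>))" using s \<delta>1 by simp
      also have "\<dots> \<le> A" unfolding A_def using s lb t by (intro gg_lower) auto
      finally show ?thesis .
    qed
    have AB: "B \<le> A + 9 / (1 - t)^4 * \<delta>"
    proof -
      have "exp (3 * \<delta>) \<le> 1 + 3 * \<delta> + (3 * \<delta>)^2" using \<delta> \<delta>1 by (intro exp_bound) auto
      moreover have "(3 * \<delta>)^2 \<le> 3 * \<delta>" using \<delta> \<delta>1 by (auto simp: power2_eq_square mult_left_le)
      moreover have "1 + - (3 * \<delta>) \<le> exp (- (3 * \<delta>))" by (rule exp_ge_add_one_self)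
      ultimately have *: "exp (3 * \<delta>) - exp (- (3 * \<delta>)) \<le> 9 * \<delta>" by simp
      have "s * (exp (3 * \<delta>) - exp (- (3 * \<delta>))) \<le> 1 * (9 * \<delta>)"
        using s \<delta> * by (intro mult_mono) auto
      then have "s * exp (3 * \<delta>) - s * exp (- (3 * \<delta>)) \<le> 9 * \<delta>" by (simp add: algebra_simps)
      moreover have "B - A \<le> (s * exp (3 * \<delta>) - s * exp (- (3 * \<delta>))) / (1 - t)^4"
        unfolding A_def B_def using s \<delta> ub t by (intro gg_diff_upper) auto
      ultimately have "B - A \<le> 9 * \<delta> / (1 - t)^4"
        using t by (smt (verit) divide_right_mono zero_le_power)
      then show ?thesis by simp
    qed
    have \<delta>\<Gamma>: "8 * \<delta> * \<Gamma> \<le> 1" using order_trans[OF \<delta>(2) \<delta>0(4)] \<Gamma> by (simp add: pos_le_divide_eq mult_ac)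
    have K\<delta>: "K * \<delta> \<le> 1" using order_trans[OF \<delta>(2) \<delta>0(5)] K by (simp add: pos_le_divide_eq mult_ac)
    have e4: "e * \<Gamma> \<le> 2 * \<delta>^2 * \<Gamma>" using e \<Gamma> by simp
    have d2: "2 * \<delta>^2 * \<Gamma> \<le> 1/4"
    proof -
      have "2 * \<delta>^2 * \<Gamma> = \<delta> * (8 * \<delta> * \<Gamma>) / 4" by (simp add: power2_eq_square)
      also have "\<dots> \<le> 1 * 1 / 4" using \<delta> \<delta>1 \<delta>\<Gamma> \<Gamma> by (intro divide_right_mono mult_mono) auto
      finally show ?thesis by simp
    qed
    have e\<Gamma>: "e * X \<le> 1/4" if "X \<le> \<Gamma>" for X
      using mult_left_mono[OF that less_imp_le[OF e(3)]] e4 d2 by linarith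
    have eA: "e * A \<le> 1/4" "e * B \<le> 1/4" "0 \<le> e * A" "0 \<le> e * B"
      using e\<Gamma>[OF A(2)] e\<Gamma>[OF B(2)] mult_nonneg_nonneg[of e A] mult_nonneg_nonneg[of e B] A(1) B(1) e(3) by linarith+
    have key: "4 * \<delta> + (1 - K * \<delta>) * (B * (1 + 2 * (e * B))) \<le> A"
    proof -
      have "2 * (e * B) \<le> 4 * \<delta>^2 * \<Gamma>" using mult_left_mono[OF B(2) less_imp_le[OF e(3)]] e4 by linarith
      then have "B * (2 * (e * B)) \<le> \<Gamma> * (4 * \<delta>^2 * \<Gamma>)" using B eA \<Gamma> by (intro mult_mono[of B \<Gamma>]) auto
      also have "\<dots> = 4 * \<Gamma>^2 * \<delta> * \<delta>" by (simp add: power2_eq_square)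
      also have "\<dots> \<le> 4 * \<Gamma>^2 * \<delta> * 1" using \<delta> \<delta>1 by (intro mult_left_mono) auto
      finally have "B * (1 + 2 * (e * B)) \<le> A + M * \<delta>" using AB by (simp add: M_def algebra_simps)
      then have "(1 - K * \<delta>) * (B * (1 + 2 * (e * B))) \<le> (1 - K * \<delta>) * (A + M * \<delta>)"
        using K\<delta> by (intro mult_left_mono) auto
      also have "\<dots> \<le> A + M * \<delta> - K * \<delta> * A" using M \<delta> K by (simp add: algebra_simps)
      finally have "(1 - K * \<delta>) * (B * (1 + 2 * (e * B))) \<le> A + M * \<delta> - K * \<delta> * A" .
      moreover have "K * \<delta> * A \<ge> (M + 4) * \<delta>"
      proof -
        have "(M + 4) * \<delta> = K * (s * exp (- 3)) * \<delta>" using K(2) by simp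
        also have "\<dots> = K * \<delta> * (s * exp (- 3))" by (simp only: mult_ac)
        also have "\<dots> \<le> K * \<delta> * A" using Alow K \<delta> by (intro mult_left_mono) auto
        finally show ?thesis .
      qed
      ultimately show ?thesis by (simp add: algebra_simps)
    qed
    have "\<delta>^3 * m + real h * (e * B + 2 * (e * B)^2) \<le> real m * (e * A)"
    proof -
      have "real h \<le> real m * (1 - K * \<delta>)" using hm by (simp add: algebra_simps)
      then have "real h * (e * B + 2 * (e * B)^2) \<le> real m * (1 - K * \<delta>) * (e * B + 2 * (e * B)^2)"
        using eA by (intro mult_right_mono) auto
      moreover have "\<delta>^3 * m \<le> real m * e * (4 * \<delta>)"
      proof -
        have "\<delta>^3 * m = real m * (\<delta>^2 / 4) * (4 * \<delta>)" by (simp add: power2_eq_square power3_eq_cube)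
        also have "\<dots> \<le> real m * e * (4 * \<delta>)" using e s \<delta> by (intro mult_right_mono mult_left_mono) auto
        finally show ?thesis .
      qed
      moreover have "real m * e * (4 * \<delta> + (1 - K * \<delta>) * (B * (1 + 2 * (e * B)))) \<le> real m * e * A"
        using key e by (intro mult_left_mono) auto
      ultimately show ?thesis by (simp add: algebra_simps power2_eq_square)
    qed
    then have "(1 - e * A) ^ m \<le> exp (- (\<delta>^3 * m)) * (1 - e * B) ^ h"
      using eA by (intro power_compare) auto
    then show "0 < 1 - eta \<delta> * gg (s * exp (- (3 * \<delta>))) \<and> 0 < 1 - eta \<delta> * gg (s * exp (3 * \<delta>)) \<and>
       (1 - eta \<delta> * gg (s * exp (- (3 * \<delta>)))) ^ m \<le> exp (- (\<delta>^3 * m)) * (1 - eta \<delta> * gg (s * exp (3 * \<delta>))) ^ h"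
      using eA unfolding A_def B_def e_def by auto
  qed (use s K \<delta>0 et t in auto)
qed

lemma powr_third_le:
  fixes R D :: real
  assumes "0 \<le> R" "R \<le> exp (- D)"
  shows "3 * R powr (1/3) \<le> 3 * exp (- (D / 3))"
proof -
  have "R powr (1/3) \<le> exp (- D) powr (1/3)" using assms by (intro powr_mono2) auto
  also have "\<dots> = exp (- (D / 3))" by (simp add: powr_def)
  finally show ?thesis by simp
qed

text \<open>In a square the parameter s is neutral. Left weights with ratio s exp (2\<delta>) and
  bottom weights with s exp (-2\<delta>) pull the optimum to the left side, so a horizontal exit is
  a deviation; the progression given to \<open>exit_hor_bound\<close> is s, s exp \<delta>, s exp
  (2\<delta>). The second bound exchanges the two sides. The slack \<kappa>\<delta> lets the
  rectangle be slightly elongated the wrong way.\<close>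

lemma exit_tail_near:
  fixes s :: real
  assumes s: "0 < s" "s < 1"
  obtains c \<kappa> \<delta>0 where "0 < c" "0 < \<kappa>" "0 < \<delta>0" "\<delta>0 \<le> 1" "s * exp (4 * \<delta>0) < 1"
    "\<And>\<delta> h m. 0 < \<delta> \<Longrightarrow> \<delta> \<le> \<delta>0 \<Longrightarrow> real m \<le> real h * (1 + \<kappa> * \<delta>) \<Longrightarrow>
       hor_exit h m (s * exp (2 * \<delta>)) (s * exp (- (2 * \<delta>))) (s * s)
       \<le> ennreal (3 * exp (- (c * \<delta>^3 * h)))"
    "\<And>\<delta> h m. 0 < \<delta> \<Longrightarrow> \<delta> \<le> \<delta>0 \<Longrightarrow> real h \<le> real m * (1 + \<kappa> * \<delta>) \<Longrightarrow>
       ver_exit h m (s * exp (- (2 * \<delta>))) (s * exp (2 * \<delta>)) (s * s)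
       \<le> ennreal (3 * exp (- (c * \<delta>^3 * m)))"
proof -
  obtain c \<kappa> \<delta>0 where c: "0 < c" "0 < \<kappa>" "0 < \<delta>0" "\<delta>0 \<le> 1" "s * exp (4 * \<delta>0) < 1"
    and N: "\<And>\<delta> h m. 0 < \<delta> \<Longrightarrow> \<delta> \<le> \<delta>0 \<Longrightarrow> real m \<le> real h * (1 + \<kappa> * \<delta>) \<Longrightarrow>
       0 < 1 - eta \<delta> * gg (s * exp (- \<delta>)) \<and> 0 < 1 - eta \<delta> * gg (s * exp \<delta>) \<and>
       (1 - eta \<delta> * gg (s * exp \<delta>)) ^ h \<le> exp (- (c * \<delta>^3 * h)) * (1 - eta \<delta> * gg (s * exp (- \<delta>))) ^ m"
    using gg_ratio_near[OF s] by metis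
  show ?thesis
  proof (rule that[of "c / 3" \<kappa> \<delta>0])
    fix \<delta> :: real and h m :: nat
    assume \<delta>: "0 < \<delta>" "\<delta> \<le> \<delta>0"
    have lt1: "s * exp (2 * \<delta>) < 1"
    proof -
      have "s * exp (2 * \<delta>) \<le> s * exp (4 * \<delta>0)" using s \<delta> by simp
      then show ?thesis using c by linarith
    qed
    have e1: "s * exp \<delta> < s * exp (2 * \<delta>)" "s < s * exp \<delta>" "s * exp (- \<delta>) < s" "s * exp (- (2 * \<delta>)) < s * exp (- \<delta>)"
      using s \<delta> by auto
    have lo: "s * s < s * exp (- (2 * \<delta>))"
    proof -
      have "s * exp (2 * \<delta>) * exp (- (2 * \<delta>)) < 1 * exp (- (2 * \<delta>))"
        using lt1 by (intro mult_strict_right_mono) auto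
      moreover have "s * exp (2 * \<delta>) * exp (- (2 * \<delta>)) = s" by (simp add: mult.assoc flip: exp_add)
      ultimately show ?thesis using s by simp
    qed
    have ss: "s * s < s" and s2: "0 < s * s" using s by simp_all
    have dv: "s * s / (s * exp x) = s * exp (- x)" for x using s by (simp add: exp_minus field_simps)
    have dv': "s * s / (s * exp (- x)) = s * exp x" for x using s by (simp add: exp_minus field_simps)
    {
      assume m: "real m \<le> real h * (1 + \<kappa> * \<delta>)"
      note n = N[OF \<delta> m]
      define b1 where "b1 = s * exp \<delta>"
      define R where "R = Fr h m (s * s) (s * exp (2 * \<delta>)) b1 * Fr h m (s * s) s b1"
      have b: "b1 * exp \<delta> = s * exp (2 * \<delta>)" "b1 * exp (- \<delta>) = s"
        by (auto simp: b1_def mult.assoc simp flip: exp_add)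
      have ne: "b1 \<noteq> 1" "s * s / b1 \<noteq> 1" "0 < b1"
        using e1 lt1 s unfolding b1_def dv by (linarith, linarith, simp)
      have g2: "s * exp (2 * \<delta>) * s = b1 * b1"
        by (simp add: b1_def algebra_simps flip: exp_add)
      have "R = (1 - eta \<delta> * gg b1) ^ h / (1 - eta \<delta> * gg (s * s / b1)) ^ m"
        unfolding R_def using Fr_second_diff[OF ne, of h m \<delta>] by (simp only: b)
      then have R: "R = (1 - eta \<delta> * gg (s * exp \<delta>)) ^ h / (1 - eta \<delta> * gg (s * exp (- \<delta>))) ^ m"
        by (simp only: b1_def dv)
      have R0: "0 \<le> R" "R \<le> exp (- (c * \<delta>^3 * h))"
        using n by (auto simp: R divide_le_eq mult.commute)
      moreover have "exp (- (c * \<delta>^3 * h)) \<le> 1" using c \<delta> by simp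
      ultimately have "R \<le> 1" by linarith
      then have "hor_exit h m (s * exp (2 * \<delta>)) (s * s / (s * exp (2 * \<delta>))) (s * s)
         \<le> ennreal (3 * R powr (1/3))"
        using e1(1,2)[folded b1_def] s2 ss lt1 g2 R_def by (intro exit_hor_bound[of "s * s" s b1 "s * exp (2 * \<delta>)"])
      also have "\<dots> \<le> ennreal (3 * exp (- (c / 3 * \<delta>^3 * h)))"
        using powr_third_le[OF R0] by (intro ennreal_leI) simp
      finally show "hor_exit h m (s * exp (2 * \<delta>)) (s * exp (- (2 * \<delta>))) (s * s)
       \<le> ennreal (3 * exp (- (c / 3 * \<delta>^3 * h)))" by (simp only: dv)
    }
    {
      assume m: "real h \<le> real m * (1 + \<kappa> * \<delta>)"
      note n = N[OF \<delta> m]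
      define b1 where "b1 = s * exp (- \<delta>)"
      define R where "R = Fr h m (s * s) b1 (s * exp (- (2 * \<delta>))) * Fr h m (s * s) b1 s"
      have b: "b1 * exp (- \<delta>) = s * exp (- (2 * \<delta>))" "b1 * exp \<delta> = s"
        by (auto simp: b1_def mult.assoc simp flip: exp_add)
      have ne: "b1 \<noteq> 1" "s * s / b1 \<noteq> 1" "0 < b1"
        using e1 lt1 s unfolding b1_def dv' by (linarith, linarith, simp)
      have g2: "s * exp (- (2 * \<delta>)) * s = b1 * b1"
        by (simp add: b1_def algebra_simps flip: exp_add)
      have "R = (1 - eta \<delta> * gg (s * s / b1)) ^ m / (1 - eta \<delta> * gg b1) ^ h"
        unfolding R_def using Fr_second_diff'[OF ne, of h m \<delta>] by (simp only: b mult.commute)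
      then have R: "R = (1 - eta \<delta> * gg (s * exp \<delta>)) ^ m / (1 - eta \<delta> * gg (s * exp (- \<delta>))) ^ h"
        by (simp only: b1_def dv')
      have R0: "0 \<le> R" "R \<le> exp (- (c * \<delta>^3 * m))"
        using n by (auto simp: R divide_le_eq mult.commute)
      moreover have "exp (- (c * \<delta>^3 * m)) \<le> 1" using c \<delta> by simp
      ultimately have "R \<le> 1" by linarith
      then have "SE h m (s * exp (- (2 * \<delta>))) (s * s / (s * exp (- (2 * \<delta>)))) (s * s)
         (\<lambda>xs Js wss. of_bool (sysval xs (zeros h) wss \<le> sysval (zeros m) Js wss))
         \<le> ennreal (3 * R powr (1/3))"
        using e1(3,4)[folded b1_def] s2 s(2) lo g2 R_def by (intro exit_ver_bound[of "s * s" "s * exp (- (2 * \<delta>))" b1 s])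
      also have "\<dots> \<le> ennreal (3 * exp (- (c / 3 * \<delta>^3 * m)))"
        using powr_third_le[OF R0] by (intro ennreal_leI) simp
      finally show "ver_exit h m (s * exp (- (2 * \<delta>))) (s * exp (2 * \<delta>)) (s * s)
       \<le> ennreal (3 * exp (- (c / 3 * \<delta>^3 * m)))" by (simp only: dv')
    }
  qed (use c in auto)
qed

text \<open>The boundary is tilted as in the first bound of \<open>exit_tail_near\<close>, but in a
  rectangle wider than tall by a fraction K\<delta> the bottom side wins nevertheless. One and the
  same boundary thus prefers opposite exits at two scales, which \<open>transversal_bound\<close>
  exploits. The progression is s exp (2\<delta>), s exp (3\<delta>), s exp (4\<delta>).\<close>

lemma exit_tail_far:
  fixes s :: real
  assumes s: "0 < s" "s < 1"
  obtains K \<delta>0 where "0 < K" "0 < \<delta>0" "\<delta>0 \<le> 1" "s * exp (4 * \<delta>0) < 1"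
    "\<And>\<delta> h m. 0 < \<delta> \<Longrightarrow> \<delta> \<le> \<delta>0 \<Longrightarrow> real h + K * \<delta> * real m \<le> real m \<Longrightarrow>
       ver_exit h m (s * exp (2 * \<delta>)) (s * exp (- (2 * \<delta>))) (s * s)
       \<le> ennreal (3 * exp (- (\<delta>^3 * m / 3)))"
proof -
  obtain K \<delta>0 where c: "0 < K" "0 < \<delta>0" "\<delta>0 \<le> 1" "s * exp (4 * \<delta>0) < 1"
    and N: "\<And>\<delta> h m. 0 < \<delta> \<Longrightarrow> \<delta> \<le> \<delta>0 \<Longrightarrow> real h + K * \<delta> * real m \<le> real m \<Longrightarrow>
       0 < 1 - eta \<delta> * gg (s * exp (- (3 * \<delta>))) \<and> 0 < 1 - eta \<delta> * gg (s * exp (3 * \<delta>)) \<and>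
       (1 - eta \<delta> * gg (s * exp (- (3 * \<delta>)))) ^ m \<le> exp (- (\<delta>^3 * m)) * (1 - eta \<delta> * gg (s * exp (3 * \<delta>))) ^ h"
    using gg_ratio_far[OF s] by metis
  show ?thesis
  proof (rule that[of K \<delta>0])
    fix \<delta> :: real and h m :: nat
    assume \<delta>: "0 < \<delta>" "\<delta> \<le> \<delta>0" and m: "real h + K * \<delta> * real m \<le> real m"
    note n = N[OF \<delta> m]
    have lt1: "s * exp (4 * \<delta>) < 1"
    proof -
      have "s * exp (4 * \<delta>) \<le> s * exp (4 * \<delta>0)" using s \<delta> by simp
      then show ?thesis using c by linarith
    qed
    have e1: "s < s * exp (2 * \<delta>)" "s * exp (2 * \<delta>) < s * exp (3 * \<delta>)" "s * exp (3 * \<delta>) < s * exp (4 * \<delta>)"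
      using s \<delta> by auto
    have ss: "s * s < s" and s2: "0 < s * s" using s by simp_all
    have dv: "s * s / (s * exp x) = s * exp (- x)" for x using s by (simp add: exp_minus field_simps)
    have ne: "s * exp (- (3 * \<delta>)) < 1"
    proof -
      have "s * exp (- (3 * \<delta>)) \<le> s * 1" using s \<delta> by (intro mult_left_mono) auto
      then show ?thesis using s by linarith
    qed
    define b1 where "b1 = s * exp (3 * \<delta>)"
    define R where "R = Fr h m (s * s) b1 (s * exp (2 * \<delta>)) * Fr h m (s * s) b1 (s * exp (4 * \<delta>))"
    have b: "b1 * exp (- \<delta>) = s * exp (2 * \<delta>)" "b1 * exp \<delta> = s * exp (4 * \<delta>)"
      by (auto simp: b1_def mult.assoc simp flip: exp_add)
    have ne: "b1 \<noteq> 1" "s * s / b1 \<noteq> 1" "0 < b1"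
      using e1 lt1 s ne unfolding b1_def dv by (linarith, linarith, simp)
    have g2: "s * exp (2 * \<delta>) * (s * exp (4 * \<delta>)) = b1 * b1"
      by (simp add: b1_def algebra_simps flip: exp_add)
    have "R = (1 - eta \<delta> * gg (s * s / b1)) ^ m / (1 - eta \<delta> * gg b1) ^ h"
      unfolding R_def using Fr_second_diff'[OF ne, of h m \<delta>] by (simp only: b mult.commute)
    then have R: "R = (1 - eta \<delta> * gg (s * exp (- (3 * \<delta>)))) ^ m / (1 - eta \<delta> * gg (s * exp (3 * \<delta>))) ^ h"
      by (simp only: b1_def dv)
    have R0: "0 \<le> R" "R \<le> exp (- (\<delta>^3 * m))"
      using n by (auto simp: R divide_le_eq mult.commute)
    moreover have "exp (- (\<delta>^3 * m)) \<le> 1" using \<delta> by simp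
    ultimately have "R \<le> 1" by linarith
    then have "ver_exit h m (s * exp (2 * \<delta>)) (s * s / (s * exp (2 * \<delta>))) (s * s)
       \<le> ennreal (3 * R powr (1/3))"
      using order_less_trans[OF ss e1(1)] e1(2,3)[folded b1_def] s2 lt1 g2 R_def by (intro exit_ver_bound[of "s * s" "s * exp (2 * \<delta>)" b1 "s * exp (4 * \<delta>)"])
    also have "\<dots> \<le> ennreal (3 * exp (- (\<delta>^3 * m / 3)))"
      using powr_third_le[OF R0] by (intro ennreal_leI) simp
    finally show "ver_exit h m (s * exp (2 * \<delta>)) (s * exp (- (2 * \<delta>))) (s * s)
       \<le> ennreal (3 * exp (- (\<delta>^3 * m / 3)))" by (simp only: dv)
  qed (use c in auto)
qed

section \<open>Joint domination of increments\<close>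

text \<open>Interchange for two queues in tandem, at one cell. The last two identities say that the
  assumed relations between the carriers hold again for the carriers passed on, which makes
  \<open>row_exchange\<close> an induction. Deciding jm \<le> t1 and s \<le> jm settles all
  three.\<close>

lemma cell_exchange:
  fixes a s w jm t0 t1 :: nat
  assumes "j1 = min jm t1" "j0 = t0 + (t1 - jm)"
  shows "w + ((s + (a - j0)) - j1) = (w + (s - jm)) + ((min s jm + (a - t0)) - t1)"
    and "w + (j1 - (s + (a - j0))) = min (w + (jm - s)) ((w + (s - jm)) + (t1 - (min s jm + (a - t0))))"
    and "s + (j0 - a) = (min s jm + (t0 - a)) + (((w + (s - jm)) + (t1 - (min s jm + (a - t0)))) - (w + (jm - s)))"
proof -
  show "w + ((s + (a - j0)) - j1) = (w + (s - jm)) + ((min s jm + (a - t0)) - t1)"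
    unfolding assms min_def by (cases "jm \<le> t1"; cases "s \<le> jm"; auto)
  show "w + (j1 - (s + (a - j0))) = min (w + (jm - s)) ((w + (s - jm)) + (t1 - (min s jm + (a - t0))))"
    unfolding assms min_def by (cases "jm \<le> t1"; cases "s \<le> jm"; auto)
  show "s + (j0 - a) = (min s jm + (t0 - a)) + (((w + (s - jm)) + (t1 - (min s jm + (a - t0)))) - (w + (jm - s)))"
    unfolding assms min_def by (cases "jm \<le> t1"; cases "s \<le> jm"; auto)
qed

text \<open>Letting \<open>A\<close> pass the rows \<open>S\<close> and \<open>W\<close> is the same as letting it pass the dual row and the
  departure row of \<open>(S, W)\<close>; the carriers \<open>j0\<close>, \<open>j1\<close> are determined by \<open>t0\<close>, \<open>t1\<close>, \<open>jm\<close>.\<close>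

lemma row_exchange:
  assumes "j1 = min jm t1" "j0 = t0 + (t1 - jm)" "length S = length A" "length W = length A"
  shows "dep j1 (dep j0 A S) W = dep t1 (dep t0 A (dual jm S W)) (dep jm S W)"
  using assms
proof (induction A arbitrary: j1 jm t1 j0 t0 S W)
  case (Cons a A)
  obtain s S' w W' where [simp]: "S = s # S'" "W = w # W'" "length S' = length A" "length W' = length A"
    using Cons.prems by (auto simp: length_Suc_conv)
  note ex = cell_exchange[OF Cons.prems(1,2), where w = w and s = s and a = a]
  have "dep (w + (j1 - (s + (a - j0)))) (dep (s + (j0 - a)) A S') W'
     = dep (w + (s - jm) + (t1 - (min s jm + (a - t0)))) (dep (min s jm + (t0 - a)) A (dual (w + (jm - s)) S' W')) (dep (w + (jm - s)) S' W')"
    by (rule Cons.IH[OF ex(2) ex(3)]) simp_all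
  then show ?case using ex(1) by simp
qed simp

text \<open>The carriers that make repeated use of \<open>row_exchange\<close> consistent. The
  relation at each row involves the carrier \<open>K'\<close> that belongs to the rows above, so the
  list is solved from the top row downwards. Each step is the cell map of \<open>burke_cell\<close>
  on \<open>K'\<close>, \<open>j\<close>, \<open>t\<close>, with the middle output dropped.\<close>

fun sweep :: "nat list \<Rightarrow> nat list \<Rightarrow> nat \<Rightarrow> nat \<times> nat list" where
  "sweep (j # js) (t # ts) K = (case sweep js ts K of (K', Ps) \<Rightarrow> (t + (K' - j), min K' j # Ps))"
| "sweep _ _ K = (K, [])"

lemma length_sweep: "length ts = length js \<Longrightarrow> length (snd (sweep js ts K)) = length js"
  by (induction js ts K rule: sweep.induct) (auto split: prod.splits)

text \<open>Iterating \<open>row_exchange\<close> carries the row \<open>S\<close> from below the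
  block to above it, where it has become \<open>tops S Js wss\<close>, while the rows of the block
  turn into their duals.\<close>

lemma block_exchange:
  assumes "length A = m" "length S = m" "rectangular h m wss" "length Js = h" "length ts = h"
  shows "tops (dep (fst (sweep Js ts K)) A S) (snd (sweep Js ts K)) wss
       = dep K (tops A ts (duals S Js wss)) (tops S Js wss)"
  using assms
proof (induction h arbitrary: A S wss Js ts)
  case (Suc h)
  obtain j js t ts' where [simp]: "Js = j # js" "ts = t # ts'" and len: "length js = h" "length ts' = h"
    using Suc.prems by (auto simp: length_Suc_conv)
  obtain W wss' where [simp]: "wss = W # wss'" and W: "length W = m" "rectangular h m wss'"
    using Suc.prems by (auto simp: rectangular_Suc_iff)
  obtain K' Ps where sw: "sweep js ts' K = (K', Ps)" by (cases "sweep js ts' K")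
  have "dep K (tops (dep t A (dual j S W)) ts' (duals (dep j S W) js wss')) (tops (dep j S W) js wss')
     = tops (dep K' (dep t A (dual j S W)) (dep j S W)) Ps wss'"
    using Suc.IH[of "dep t A (dual j S W)" "dep j S W" wss' js ts'] Suc.prems W len sw by simp
  also have "dep K' (dep t A (dual j S W)) (dep j S W) = dep (min j K') (dep (t + (K' - j)) A S) W"
    using row_exchange[of "min j K'" j K' "t + (K' - j)" t S A W] Suc.prems W by simp
  finally show ?case by (simp add: sw min.commute)
qed simp

text \<open>Each step of the sweep is a cell map, so Burke's property makes the returned carriers
  independent, with the laws of a stationary boundary.\<close>

lemma EE_sweep:
  assumes "0 < \<kappa>" "\<kappa> < 1" "0 < bm" "bm < 1"
  shows "EE (iid h bm) (\<lambda>Js. EE (iid h (\<kappa> * bm)) (\<lambda>ts. EE (geo \<kappa>) (\<lambda>K. f (fst (sweep Js ts K)) (snd (sweep Js ts K)))))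
    = EE (geo \<kappa>) (\<lambda>K. EE (iid h (\<kappa> * bm)) (\<lambda>Ps. f K Ps))"
proof (induction h arbitrary: f)
  case 0 then show ?case by simp
next
  case (Suc h)
  have "EE (iid (Suc h) bm) (\<lambda>Js. EE (iid (Suc h) (\<kappa> * bm)) (\<lambda>ts. EE (geo \<kappa>) (\<lambda>K. f (fst (sweep Js ts K)) (snd (sweep Js ts K)))))
    = EE (geo bm) (\<lambda>j. EE (iid h bm) (\<lambda>Js. EE (geo (\<kappa> * bm)) (\<lambda>t. EE (iid h (\<kappa> * bm)) (\<lambda>ts. EE (geo \<kappa>) (\<lambda>K.
        f (t + (fst (sweep Js ts K) - j)) (min (fst (sweep Js ts K)) j # snd (sweep Js ts K)))))))"
    by (simp add: case_prod_unfold)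
  also have "\<dots> = EE (geo bm) (\<lambda>j. EE (geo (\<kappa> * bm)) (\<lambda>t. EE (iid h bm) (\<lambda>Js. EE (iid h (\<kappa> * bm)) (\<lambda>ts. EE (geo \<kappa>) (\<lambda>K.
        f (t + (fst (sweep Js ts K) - j)) (min (fst (sweep Js ts K)) j # snd (sweep Js ts K)))))))"
    by (subst EE_swap[of "iid h bm" "geo (\<kappa> * bm)"]) simp
  also have "\<dots> = EE (geo bm) (\<lambda>j. EE (geo (\<kappa> * bm)) (\<lambda>t. EE (geo \<kappa>) (\<lambda>K. EE (iid h (\<kappa> * bm)) (\<lambda>Ps.
        f (t + (K - j)) (min K j # Ps)))))"
    by (subst Suc[of "\<lambda>K Ps. f (_ + (K - _)) (min K _ # Ps)"]) simp
  also have "\<dots> = EE (geo bm) (\<lambda>j. EE (geo \<kappa>) (\<lambda>K. EE (geo (\<kappa> * bm)) (\<lambda>t. EE (iid h (\<kappa> * bm)) (\<lambda>Ps.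
        f (t + (K - j)) (min K j # Ps)))))"
    by (subst EE_swap[of "geo (\<kappa> * bm)" "geo \<kappa>"]) simp
  also have "\<dots> = EE (geo \<kappa>) (\<lambda>K. EE (geo bm) (\<lambda>j. EE (geo (\<kappa> * bm)) (\<lambda>t. EE (iid h (\<kappa> * bm)) (\<lambda>Ps.
        f (t + (K - j)) (min K j # Ps)))))"
    by (rule EE_swap)
  also have "\<dots> = EE (geo \<kappa>) (\<lambda>K. EE (geo bm) (\<lambda>j. EE (geo (\<kappa> * bm)) (\<lambda>t. EE (iid h (\<kappa> * bm)) (\<lambda>Ps.
        f K (t # Ps)))))"
    using burke_cell[OF assms, of "\<lambda>K j t. EE (iid h (\<kappa> * bm)) (\<lambda>Ps. f K (t # Ps))"] by simp
  finally show ?case by simp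
qed

section \<open>Coupling of the two stationary comparison systems\<close>

lemma EE_iid_take: "EE (replicate_pmf (k + n) P) (\<lambda>xs. f (take k xs)) = EE (replicate_pmf k P) f"
proof -
  have "EE (replicate_pmf (k + n) P) (\<lambda>xs. f (take k xs))
    = EE (replicate_pmf k P) (\<lambda>xs. EE (replicate_pmf n P) (\<lambda>ys. f (take k (xs @ ys))))"
    by (rule EE_iid_append)
  also have "\<dots> = EE (replicate_pmf k P) (\<lambda>xs. EE (replicate_pmf n P) (\<lambda>ys. f xs))"
    by (rule EE_iid_length) simp
  finally show ?thesis by simp
qed

lemma EE_iidm_take: "EE (iidm h (k + n) q) (\<lambda>wss. f (map (take k) wss)) = EE (iidm h k q) f"
proof (induction h arbitrary: f)
  case (Suc h)
  have "EE (iidm (Suc h) (k + n) q) (\<lambda>wss. f (map (take k) wss))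
     = EE (iid (k + n) q) (\<lambda>ws. EE (iidm h k q) (\<lambda>wss. f (take k ws # wss)))"
    by (simp add: Suc[of "\<lambda>wss. f (_ # wss)"])
  also have "\<dots> = EE (iid k q) (\<lambda>ws. EE (iidm h k q) (\<lambda>wss. f (ws # wss)))"
    by (rule EE_iid_take)
  finally show ?case by simp
qed simp

lemma tops_sysval_take:
  assumes "length xs = m" "rectangular h m wss" "length Js = h" "k \<le> m"
  shows "sysval (take k xs) Js (map (take k) wss) = sum_list Js + ps (tops xs Js wss) k"
  by (simp add: sysval_def tops_take)

text \<open>The directions are those of the comparison: the bulk increments are bounded above in the
  left window and below in the right window.\<close>

definition mono_pair :: "(nat list \<Rightarrow> nat list \<Rightarrow> bool) \<Rightarrow> bool" where
  "mono_pair P \<longleftrightarrow> (\<forall>L L' R R'. list_all2 (\<le>) L L' \<longrightarrow> list_all2 (\<le>) R' R \<longrightarrow> P L R \<longrightarrow> P L' R')"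

text \<open>Moving the row \<open>S\<close> to the top makes the upper comparison increments in the left window a function
  of variables that are independent of the lower comparison increments in the right window.\<close>

lemma dominate:
  fixes \<kappa> ap bm q :: real
  assumes \<kappa>: "0 < \<kappa>" "\<kappa> < 1" and ap: "0 < ap" "ap < 1" and bm: "0 < bm" "bm < 1"
    and q: "q = ap * (\<kappa> * bm)" and P: "mono_pair P"
  shows "EE (iidm h (k + l + l) q) (\<lambda>wss. of_bool (
       P (take l (drop k (tops (zeros (k + l + l)) (zeros h) wss))) (drop (k + l) (tops (zeros (k + l + l)) (zeros h) wss))))
    \<le> EE (iid l ap) (\<lambda>L. EE (iid l (\<kappa> * ap)) (\<lambda>R. of_bool (P L R)))
      + hor_exit h (k + l + l) bm (\<kappa> * ap) q
      + ver_exit h k (\<kappa> * bm) ap q"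
proof -
  define m where "m = k + l + l"
  define am where "am = \<kappa> * ap"
  define bp where "bp = \<kappa> * bm"
  have am: "0 < am" "am < 1" using \<kappa> ap mult_less_le_imp_less[of \<kappa> 1 ap 1] by (auto simp: am_def)
  have bp: "0 < bp" "bp < 1" using \<kappa> bm mult_less_le_imp_less[of \<kappa> 1 bm 1] by (auto simp: bp_def)
  have q1: "q = am * bm" and q2: "q = ap * bp" using q by (auto simp: am_def bp_def)
  define T1 where "T1 A ts K S Js wss = (of_bool (P (take l (drop k (dep K (tops A ts (duals S Js wss)) (tops S Js wss))))
      (drop (k + l) (tops S Js wss))) :: ennreal)" for A ts K S Js wss
  define T2 where "T2 S Js wss = (of_bool (sysval (zeros m) Js wss \<le> sysval S (zeros h) wss) :: ennreal)" for S Js wss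
  define T3 where "T3 I Ps wss = (of_bool (sysval (take k I) (zeros h) (map (take k) wss) \<le> sysval (zeros k) Ps (map (take k) wss)) :: ennreal)" for I Ps wss
  \<comment> \<open>If neither comparison system exits on its unlikely side,
    \<open>tops_dominate\<close> brackets the bulk row: over the full width \<open>m\<close> by the
    system of \<open>S\<close> and \<open>Js\<close>, from column \<open>k\<close> on by the one
    built from the sweep. Monotonicity of \<open>P\<close> does the rest.\<close>
  have pt: "of_bool (P (take l (drop k (tops (zeros m) (zeros h) wss))) (drop (k + l) (tops (zeros m) (zeros h) wss)))
      \<le> T1 A ts K S Js wss + T2 S Js wss + T3 (dep (fst (sweep Js ts K)) A S) (snd (sweep Js ts K)) wss"
    if len: "length A = m" "length S = m" "length Js = h" "length ts = h" "rectangular h m wss" for A ts K S Js wss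
  proof -
    define X where "X = tops (zeros m) (zeros h) wss"
    define I where "I = dep (fst (sweep Js ts K)) A S"
    define Ps where "Ps = snd (sweep Js ts K)"
    have I: "length I = m" "length Ps = h" using len by (auto simp: I_def Ps_def length_sweep)
    define Xm where "Xm = tops S Js wss"
    define Xp where "Xp = tops I Ps wss"
    have lX: "length X = m" "length Xm = m" "length Xp = m"
      using len I by (auto simp: X_def Xm_def Xp_def intro!: length_tops)
    have Xp: "Xp = dep K (tops A ts (duals S Js wss)) Xm"
      using block_exchange[OF len(1,2,5,3,4), of K] by (simp add: Xp_def I_def Ps_def Xm_def)
    show ?thesis
    proof (cases "P (take l (drop k X)) (drop (k + l) X)")
      case True
      consider "T2 S Js wss = 1" | "T3 I Ps wss = 1" | "sysval S (zeros h) wss \<le> sysval (zeros m) Js wss"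
          "sysval (zeros k) Ps (map (take k) wss) \<le> sysval (take k I) (zeros h) (map (take k) wss)"
        unfolding T2_def T3_def by fastforce
      then show ?thesis
      proof cases
        case 3
        have km: "k \<le> m" by (simp add: m_def)
        have r: "X ! i \<ge> Xm ! i" if "i < m" for i
          unfolding X_def Xm_def
          using tops_dominate(2)[OF len(2,5,3) that order_refl] 3(1) that len
            length_tops[of S m h wss "zeros h"] length_tops[of "zeros m" m h wss Js]
          by (simp add: sysval_def)
        have "sum_list Ps + ps (tops (zeros m) Ps wss) k \<le> ps (tops I (zeros h) wss) k"
          using 3(2) tops_sysval_take[of "zeros m" m h wss Ps k] tops_sysval_take[OF I(1) len(5) _ km, of "zeros h"] I len km
          by (simp add: take_replicate min_def)
        then have p: "X ! i \<le> Xp ! i" if "i < m" "k \<le> i" for i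
          unfolding X_def Xp_def using tops_dominate(1)[OF I(1) len(5) I(2) that(1) km] that by simp
        have "list_all2 (\<le>) (take l (drop k X)) (take l (drop k Xp))"
          using lX by (auto simp: list_all2_conv_all_nth m_def intro!: p)
        moreover have "list_all2 (\<le>) (drop (k + l) Xm) (drop (k + l) X)"
          using lX by (auto simp: list_all2_conv_all_nth m_def intro!: r)
        ultimately have "P (take l (drop k Xp)) (drop (k + l) Xm)"
          using P True unfolding mono_pair_def by blast
        then have "T1 A ts K S Js wss = 1" by (simp add: T1_def Xp Xm_def)
        then show ?thesis by (simp add: X_def add.assoc)
      qed (use True in \<open>auto simp: I_def[symmetric] Ps_def[symmetric] X_def[symmetric] add.assoc\<close>)
    qed (simp add: X_def[symmetric])
  qed
  \<comment> \<open>All sources are drawn independently at once: \<open>S\<close>, \<open>Js\<close>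
    and the bulk drive the lower system, while \<open>A\<close>, \<open>ts\<close>, \<open>K\<close>
    are the extra randomness from which the upper one is built.\<close>
  define BIG where "BIG f = EE (iid m ap) (\<lambda>A. EE (iid h bp) (\<lambda>ts. EE (geo \<kappa>) (\<lambda>K. SE h m bm am q (\<lambda>S Js wss. f A ts K S Js wss))))"
    for f :: "nat list \<Rightarrow> nat list \<Rightarrow> nat \<Rightarrow> nat list \<Rightarrow> nat list \<Rightarrow> nat list list \<Rightarrow> ennreal"
  have BIG_mono: "BIG f \<le> BIG g"
    if "\<And>A ts K S Js wss. length A = m \<Longrightarrow> length S = m \<Longrightarrow> length Js = h \<Longrightarrow> length ts = h \<Longrightarrow> rectangular h m wss \<Longrightarrow> f A ts K S Js wss \<le> g A ts K S Js wss" for f g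
    unfolding BIG_def by (intro EE_mono SE_mono that) (simp_all add: set_iid)
  have BIG_add: "BIG (\<lambda>A ts K S Js wss. f A ts K S Js wss + g A ts K S Js wss) = BIG f + BIG g" for f g
    by (simp add: BIG_def SE_add EE_add)
  have "EE (iidm h m q) (\<lambda>wss. of_bool (
       P (take l (drop k (tops (zeros m) (zeros h) wss))) (drop (k + l) (tops (zeros m) (zeros h) wss))))
    = BIG (\<lambda>A ts K S Js wss. of_bool (
       P (take l (drop k (tops (zeros m) (zeros h) wss))) (drop (k + l) (tops (zeros m) (zeros h) wss))))"
    by (simp add: BIG_def SE_def)
  also have "\<dots> \<le> BIG (\<lambda>A ts K S Js wss. T1 A ts K S Js wss + T2 S Js wss + T3 (dep (fst (sweep Js ts K)) A S) (snd (sweep Js ts K)) wss)"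
    by (rule BIG_mono) (rule pt)
  also have "\<dots> = BIG T1 + BIG (\<lambda>A ts K S Js wss. T2 S Js wss) + BIG (\<lambda>A ts K S Js wss. T3 (dep (fst (sweep Js ts K)) A S) (snd (sweep Js ts K)) wss)"
    by (simp add: BIG_add)
  also have "BIG (\<lambda>A ts K S Js wss. T2 S Js wss) = SE h m bm am q T2"
    by (simp add: BIG_def)
  also have "BIG T1 = EE (iid l ap) (\<lambda>L. EE (iid l am) (\<lambda>R. of_bool (P L R)))"
  proof -
    define F where "F Q K S = (of_bool (P (take l (drop k (dep K Q S))) (drop (k + l) S)) :: ennreal)" for Q K S
    \<comment> \<open>By Burke's property with duals, the tops and duals of the lower system can be
      replaced by fresh \<open>S\<close> and \<open>wss\<close>. From here on the two rows entering
      \<open>dep K\<close> are independent.\<close>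
    have "BIG T1 = EE (iid m ap) (\<lambda>A. EE (iid h bp) (\<lambda>ts. EE (geo \<kappa>) (\<lambda>K. EE (iid h bm) (\<lambda>Js. EE (iid m am) (\<lambda>S. EE (iidm h m q) (\<lambda>wss.
        F (tops A ts wss) K S))))))"
      unfolding BIG_def SE_def T1_def F_def[symmetric] q1
      by (subst burke_block[OF am bm, of _ _ "\<lambda>S Js wss. F (tops _ _ wss) _ S"]) simp
    also have "\<dots> = EE (iid m ap) (\<lambda>A. EE (iid h bp) (\<lambda>ts. EE (geo \<kappa>) (\<lambda>K. EE (iid m am) (\<lambda>S. EE (iidm h m q) (\<lambda>wss.
        F (tops A ts wss) K S)))))"
      by simp
    also have "\<dots> = EE (geo \<kappa>) (\<lambda>K. EE (iid m am) (\<lambda>S. EE (iid h bp) (\<lambda>ts. EE (iid m ap) (\<lambda>A. EE (iidm h m q) (\<lambda>wss.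
        F (tops A ts wss) K S)))))"
      by (subst EE_swap[of "iid h bp" "geo \<kappa>"], subst EE_swap[of "iid m ap" "geo \<kappa>"],
          subst EE_swap[of "iid h bp" "iid m am"], subst EE_swap[of "iid m ap" "iid m am"], subst EE_swap[of "iid m ap" "iid h bp"]) simp
    also have "\<dots> = EE (geo \<kappa>) (\<lambda>K. EE (iid m am) (\<lambda>S. EE (iid h bp) (\<lambda>ts. EE (iid m ap) (\<lambda>A. EE (iidm h m q) (\<lambda>wss. F A K S)))))"
      unfolding q2 by (subst burke_block[OF ap bp, of _ _ "\<lambda>A _ _. F A _ _"]) simp
    also have "\<dots> = EE (geo \<kappa>) (\<lambda>K. EE (iid m ap) (\<lambda>A. EE (iid m am) (\<lambda>S. F A K S)))"
      by (simp, subst EE_swap[of "iid m am" "iid m ap"]) simp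
    also have "\<dots> = EE (geo \<kappa>) (\<lambda>K. EE (iid (k + l) ap) (\<lambda>A1. EE (iid l ap) (\<lambda>A2. EE (iid (k + l) am) (\<lambda>S1. EE (iid l am) (\<lambda>S2. F (A1 @ A2) K (S1 @ S2))))))"
      by (simp add: m_def EE_iid_append)
    also have "\<dots> = EE (geo \<kappa>) (\<lambda>K. EE (iid (k + l) ap) (\<lambda>A1. EE (iid l ap) (\<lambda>A2. EE (iid (k + l) am) (\<lambda>S1. EE (iid l am) (\<lambda>S2.
        of_bool (P (drop k (dep K A1 S1)) S2))))))"
    \<comment> \<open>A row is processed from left to right, so the left window sees only the first
      k + l entries of \<open>S\<close> and the right window only the others: this is the
      independence of the two sides.\<close>
    proof (intro EE_cong)
      fix K A1 A2 S1 S2 assume "A1 \<in> set_pmf (iid (k + l) ap)" "S1 \<in> set_pmf (iid (k + l) am)"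
      then have l: "length A1 = k + l" "length S1 = k + l" by (auto dest: set_iid)
      have "take (k + l) (dep K (A1 @ A2) (S1 @ S2)) = dep K A1 S1"
        using dep_take[of K "k + l" "A1 @ A2" "S1 @ S2"] l by simp
      then have "take l (drop k (dep K (A1 @ A2) (S1 @ S2))) = drop k (dep K A1 S1)"
        by (metis add.commute take_drop)
      then show "F (A1 @ A2) K (S1 @ S2) = of_bool (P (drop k (dep K A1 S1)) S2)"
        using l by (simp add: F_def)
    qed
    also have "\<dots> = EE (geo \<kappa>) (\<lambda>K. EE (iid (k + l) ap) (\<lambda>A1. EE (iid (k + l) am) (\<lambda>S1. EE (iid l am) (\<lambda>S2.
        of_bool (P (drop k (dep K A1 S1)) S2)))))"
      by simp
    also have "\<dots> = EE (geo \<kappa>) (\<lambda>K. EE (iid (k + l) ap) (\<lambda>A1. EE (iid (k + l) am) (\<lambda>S1. EE (iid l am) (\<lambda>S2.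
        of_bool (P (drop k A1) S2)))))"
      using burke_row[OF ap \<kappa>, of "k + l" "\<lambda>A K S. EE (iid l am) (\<lambda>S2. of_bool (P (drop k A) S2))"]
      by (simp add: am_def mult.commute)
    also have "\<dots> = EE (iid (k + l) ap) (\<lambda>A1. EE (iid l am) (\<lambda>S2. of_bool (P (drop k A1) S2)))"
      by simp
    also have "\<dots> = EE (iid k ap) (\<lambda>B. EE (iid l ap) (\<lambda>A1. EE (iid l am) (\<lambda>S2. of_bool (P (drop k (B @ A1)) S2))))"
      by (rule EE_iid_append)
    also have "\<dots> = EE (iid k ap) (\<lambda>B. EE (iid l ap) (\<lambda>A1. EE (iid l am) (\<lambda>S2. of_bool (P A1 S2))))"
      by (rule EE_iid_length) simp
    finally show ?thesis by simp
  qed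
  also have "BIG (\<lambda>A ts K S Js wss. T3 (dep (fst (sweep Js ts K)) A S) (snd (sweep Js ts K)) wss)
      = ver_exit h k bp ap q"
  proof -
    have "BIG (\<lambda>A ts K S Js wss. T3 (dep (fst (sweep Js ts K)) A S) (snd (sweep Js ts K)) wss)
      = EE (iidm h m q) (\<lambda>wss. EE (iid m ap) (\<lambda>A. EE (iid m am) (\<lambda>S. EE (iid h bm) (\<lambda>Js. EE (iid h bp) (\<lambda>ts. EE (geo \<kappa>) (\<lambda>K.
          T3 (dep (fst (sweep Js ts K)) A S) (snd (sweep Js ts K)) wss))))))"
      unfolding BIG_def SE_def
      by (subst EE_swap[of "iid m am" "iidm h m q"], subst EE_swap[of "iid h bm" "iidm h m q"],
          subst EE_swap[of "geo \<kappa>" "iidm h m q"], subst EE_swap[of "iid h bp" "iidm h m q"], subst EE_swap[of "iid m ap" "iidm h m q"],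
          subst EE_swap[of "iid h bm" "iid m am"], subst EE_swap[of "geo \<kappa>" "iid m am"], subst EE_swap[of "iid h bp" "iid m am"],
          subst EE_swap[of "geo \<kappa>" "iid h bm"], subst EE_swap[of "iid h bp" "iid h bm"]) simp
    \<comment> \<open>\<open>EE_sweep\<close> makes the carriers stationary, after which
      \<open>burke_row\<close> makes \<open>dep K A S\<close> i.i.d. with ratio \<open>ap\<close>.
      So the upper system is stationary too, although it was built from the variables of the lower
      one.\<close>
    also have "\<dots> = EE (iidm h m q) (\<lambda>wss. EE (iid m ap) (\<lambda>A. EE (iid m am) (\<lambda>S. EE (geo \<kappa>) (\<lambda>K. EE (iid h bp) (\<lambda>Ps.
          T3 (dep K A S) Ps wss)))))"
      unfolding bp_def by (subst EE_sweep[OF \<kappa> bm, of _ "\<lambda>K Ps. T3 (dep K _ _) Ps _"]) simp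
    also have "\<dots> = EE (iidm h m q) (\<lambda>wss. EE (geo \<kappa>) (\<lambda>K. EE (iid m ap) (\<lambda>A. EE (iid m am) (\<lambda>S. EE (iid h bp) (\<lambda>Ps.
          T3 (dep K A S) Ps wss)))))"
      by (subst EE_swap[of "iid m am" "geo \<kappa>"], subst EE_swap[of "iid m ap" "geo \<kappa>"]) simp
    also have "\<dots> = EE (iidm h m q) (\<lambda>wss. EE (geo \<kappa>) (\<lambda>K. EE (iid m ap) (\<lambda>A. EE (iid m am) (\<lambda>S. EE (iid h bp) (\<lambda>Ps.
          T3 A Ps wss)))))"
      using burke_row[OF ap \<kappa>, of m "\<lambda>A K S. EE (iid h bp) (\<lambda>Ps. T3 A Ps _)"]
      by (simp add: am_def mult.commute)
    also have "\<dots> = EE (iidm h m q) (\<lambda>wss. EE (iid m ap) (\<lambda>A. EE (iid h bp) (\<lambda>Ps. T3 A Ps wss)))"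
      by simp
    also have "\<dots> = EE (iid h bp) (\<lambda>Ps. EE (iid m ap) (\<lambda>A. EE (iidm h m q) (\<lambda>wss. T3 A Ps wss)))"
      by (subst EE_swap[of "iidm h m q" "iid m ap"], subst EE_swap[of "iidm h m q" "iid h bp"], subst EE_swap[of "iid m ap" "iid h bp"]) simp
    also have "\<dots> = EE (iid h bp) (\<lambda>Ps. EE (iid k ap) (\<lambda>I. EE (iidm h k q) (\<lambda>wss. of_bool (sysval I (zeros h) wss \<le> sysval (zeros k) Ps wss))))"
    proof -
      have "EE (iidm h m q) (\<lambda>wss. T3 A Ps wss) = EE (iidm h k q) (\<lambda>wss. of_bool (sysval (take k A) (zeros h) wss \<le> sysval (zeros k) Ps wss))" for A Ps
        using EE_iidm_take[of h k "l + l" q "\<lambda>wss. of_bool (sysval (take k A) (zeros h) wss \<le> sysval (zeros k) Ps wss)"]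
        by (simp add: T3_def m_def add.assoc)
      moreover have "EE (iid m ap) (\<lambda>A. EE (iidm h k q) (\<lambda>wss. of_bool (sysval (take k A) (zeros h) wss \<le> sysval (zeros k) Ps wss)))
        = EE (iid k ap) (\<lambda>I. EE (iidm h k q) (\<lambda>wss. of_bool (sysval I (zeros h) wss \<le> sysval (zeros k) Ps wss)))" for Ps
        using EE_iid_take[of k "l + l" "geo ap" "\<lambda>I. EE (iidm h k q) (\<lambda>wss. of_bool (sysval I (zeros h) wss \<le> sysval (zeros k) Ps wss))"]
        by (simp add: m_def add.assoc)
      ultimately show ?thesis by simp
    qed
    finally show ?thesis by (simp add: SE_def)
  qed
  finally show ?thesis
    by (simp add: m_def am_def bp_def T2_def)
qed

section \<open>Persistence of geometric random walks\<close>

lemma EE_geo_Suc: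
  assumes "0 < a" "a < 1"
  shows "EE (geo a) f = ennreal (1 - a) * f 0 + ennreal a * EE (geo a) (\<lambda>k. f (Suc k))"
proof -
  have "EE (geo a) f = EE (do {b \<leftarrow> bernoulli_pmf (1 - a); if b then return_pmf 0 else map_pmf Suc (geo a)}) f"
    unfolding geo_def by (subst geometric_bind_pmf_unfold) (use assms in auto)
  also have "\<dots> = EE (bernoulli_pmf (1 - a)) (\<lambda>b. EE (if b then return_pmf 0 else map_pmf Suc (geo a)) f)"
    by simp
  also have "\<dots> = ennreal (1 - a) * f 0 + ennreal a * EE (geo a) (\<lambda>k. f (Suc k))"
    using assms by (simp add: EE_def[of "bernoulli_pmf _"]) (simp add: EE_def mult.commute)
  finally show ?thesis .
qed

text \<open>Given x > N, the overshoot x - N - 1 has law \<open>geo a\<close> again, and the factor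
  (1 - az)/((1 - a)z) is what gives z^(x - N) conditional mean 1. Writing 1 on that event therefore
  leaves the total moment unchanged.\<close>

lemma EE_geo_overshoot:
  assumes a: "0 < a" "a < 1" and z: "1 < z" "a * z < 1"
  shows "EE (geo a) (\<lambda>x. ennreal (if x \<le> N then z ^ x / z ^ N * ((1 - a * z) / ((1 - a) * z)) else 1)) = ennreal (1 / z ^ Suc N)"
proof (induction N)
  case 0
  have "EE (geo a) (\<lambda>x. ennreal (if x \<le> 0 then z ^ x / z ^ 0 * ((1 - a * z) / ((1 - a) * z)) else 1))
     = ennreal (1 - a) * ennreal ((1 - a * z) / ((1 - a) * z)) + ennreal a"
    using a by (simp add: EE_geo_Suc)
  also have "\<dots> = ennreal ((1 - a) * ((1 - a * z) / ((1 - a) * z)) + a)"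
    using a z by (simp add: ennreal_mult[symmetric])
  also have "(1 - a) * ((1 - a * z) / ((1 - a) * z)) + a = 1 / z"
    using a z by (simp add: field_simps)
  finally show ?case by simp
next
  case (Suc N)
  have "EE (geo a) (\<lambda>x. ennreal (if x \<le> Suc N then z ^ x / z ^ Suc N * ((1 - a * z) / ((1 - a) * z)) else 1))
     = ennreal (1 - a) * ennreal (1 / z ^ Suc N * ((1 - a * z) / ((1 - a) * z)))
       + ennreal a * EE (geo a) (\<lambda>x. ennreal (if x \<le> N then z ^ x / z ^ N * ((1 - a * z) / ((1 - a) * z)) else 1))"
    using a z by (subst EE_geo_Suc) (simp_all cong: if_cong)
  also have "\<dots> = ennreal ((1 - a) * (1 / z ^ Suc N * ((1 - a * z) / ((1 - a) * z))) + a * (1 / z ^ Suc N))"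
    using a z unfolding Suc by (simp add: ennreal_mult[symmetric] ennreal_plus[symmetric] del: ennreal_plus)
  also have "(1 - a) * (1 / z ^ Suc N * ((1 - a * z) / ((1 - a) * z))) + a * (1 / z ^ Suc N) = 1 / z ^ Suc (Suc N)"
    using a z by (simp add: field_simps)
  finally show ?case .
qed

fun stay :: "nat \<Rightarrow> nat list \<Rightarrow> nat list \<Rightarrow> bool" where
  "stay d (x # xs) (y # ys) \<longleftrightarrow> x \<le> d + y \<and> stay (d + y - x) xs ys"
| "stay d _ _ \<longleftrightarrow> True"

fun exit_time :: "nat \<Rightarrow> nat list \<Rightarrow> nat list \<Rightarrow> nat" where
  "exit_time d (x # xs) (y # ys) = Suc (if x \<le> d + y then exit_time (d + y - x) xs ys else 0)"
| "exit_time d _ _ = 0"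

lemma stay_iff:
  assumes "length xs = length ys"
  shows "stay d xs ys \<longleftrightarrow> (\<forall>k \<le> length xs. ps xs k \<le> d + ps ys k)"
  using assms
proof (induction xs ys arbitrary: d rule: list_induct2)
  case (Cons x xs y ys)
  have "(\<forall>k \<le> length (x # xs). ps (x # xs) k \<le> d + ps (y # ys) k)
      \<longleftrightarrow> (\<forall>k \<le> length xs. x + ps xs k \<le> d + (y + ps ys k))"
  proof -
    have "(\<forall>k\<le>Suc n. Q k) \<longleftrightarrow> Q 0 \<and> (\<forall>k\<le>n. Q (Suc k))" for n and Q :: "nat \<Rightarrow> bool"
      by (metis Suc_le_mono le0 not0_implies_Suc)
    then show ?thesis by simp
  qed
  also have "\<dots> \<longleftrightarrow> x \<le> d + y \<and> (\<forall>k \<le> length xs. ps xs k \<le> (d + y - x) + ps ys k)"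
    by (rule iffI; force)
  finally show ?case using Cons by simp
qed simp

text \<open>On \<open>stay\<close> the exit time is the full length and the two terms add up to 1.
  This turns a lower bound for the mean of r^exit into an upper bound for the persistence
  probability.\<close>

lemma exit_time_stay:
  fixes r :: real
  assumes "0 \<le> r" "r \<le> 1" "length xs = length ys"
  shows "r ^ exit_time d xs ys + (1 - r ^ length xs) * of_bool (stay d xs ys) \<le> 1"
proof -
  have "stay d xs ys \<Longrightarrow> exit_time d xs ys = length xs"
    using assms(3) by (induction xs ys arbitrary: d rule: list_induct2) auto
  then show ?thesis using assms by (auto simp: power_le_one)
qed

text \<open>Overshoots are memoryless, so \<open>z\<close> to the power of the walk can be stopped exactly.\<close>

lemma walk_mgf:
  assumes a: "0 < a" "a < 1" and b: "0 < b" "b < 1" and z: "1 < z" "a * z < 1"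
    and r: "r = ((1 - a * z) * (1 - b / z)) / ((1 - a) * (1 - b))"
  shows "ennreal (1 / z ^ d * ((1 - a * z) / ((1 - a) * z)))
    \<le> EE (iid l a) (\<lambda>xs. EE (iid l b) (\<lambda>ys. ennreal (r ^ exit_time d xs ys)))"
proof (induction l arbitrary: d)
  case 0
  have "1 / z ^ d * ((1 - a * z) / ((1 - a) * z)) \<le> 1 * 1"
  proof (intro mult_mono)
    show "(1 - a * z) / ((1 - a) * z) \<le> 1" using a z by (simp add: algebra_simps)
  qed (use a z in auto)
  then show ?case by simp
next
  case (Suc l)
  \<comment> \<open>\<open>r\<close> is the reciprocal of the mean of z^(x - y), so r^time
    z^(-position) is a martingale; \<open>g\<close> is the overshoot factor of
    \<open>EE_geo_overshoot\<close>.\<close>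
  define g where "g = (1 - a * z) / ((1 - a) * z)"
  have g: "0 \<le> g" using a z by (simp add: g_def)
  have bz: "0 < 1 - b / z" "b / z < 1" using b z by (auto simp: field_simps)
  have r0: "0 \<le> r" using a b z bz by (auto simp: r)
  have "ennreal (1 / z ^ d * g) = ennreal r * (ennreal (1 / z ^ Suc d) * EE (geo b) (\<lambda>y. ennreal ((1 / z) ^ y)))"
  proof -
    have "1 / z ^ d * g = r * (1 / z ^ Suc d * ((1 - b) / (1 - b * (1 / z))))"
      using a b z bz by (simp add: r g_def)
    then show ?thesis
      using a b z bz r0 EE_geo_power[of b "1 / z"] by (simp add: ennreal_mult[symmetric])
  qed
  also have "\<dots> = ennreal r * EE (geo b) (\<lambda>y. ennreal (1 / z ^ Suc (d + y)))"
    using z by (simp add: EE_cmult[symmetric] ennreal_mult[symmetric] power_add power_divide mult_ac)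
  also have "\<dots> = ennreal r * EE (geo b) (\<lambda>y. EE (geo a) (\<lambda>x. ennreal (if x \<le> d + y then z ^ x / z ^ (d + y) * g else 1)))"
    unfolding g_def EE_geo_overshoot[OF a z] ..
  also have "\<dots> = EE (geo b) (\<lambda>y. EE (geo a) (\<lambda>x. ennreal r * ennreal (if x \<le> d + y then 1 / z ^ (d + y - x) * g else 1)))"
  proof -
    have "z ^ x / z ^ n = 1 / z ^ (n - x)" if "x \<le> n" for x n
      using that z by (simp add: power_diff)
    then show ?thesis by (simp add: EE_cmult cong: if_cong)
  qed
  also have "\<dots> \<le> EE (geo b) (\<lambda>y. EE (geo a) (\<lambda>x. ennreal r * (if x \<le> d + y then EE (iid l a) (\<lambda>xs. EE (iid l b) (\<lambda>ys. ennreal (r ^ exit_time (d + y - x) xs ys))) else 1)))"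
    using Suc by (intro EE_mono mult_left_mono) (auto simp: g_def)
  also have "\<dots> = EE (geo b) (\<lambda>y. EE (geo a) (\<lambda>x. EE (iid l a) (\<lambda>xs. EE (iid l b) (\<lambda>ys. ennreal r * ennreal (if x \<le> d + y then r ^ exit_time (d + y - x) xs ys else 1)))))"
    by (intro EE_cong) (auto simp: EE_cmult)
  also have "\<dots> = EE (geo b) (\<lambda>y. EE (geo a) (\<lambda>x. EE (iid l a) (\<lambda>xs. EE (iid l b) (\<lambda>ys. ennreal (r ^ exit_time d (x # xs) (y # ys))))))"
    using r0 by (intro EE_cong) (auto simp: ennreal_mult)
  also have "\<dots> = EE (geo a) (\<lambda>x. EE (iid l a) (\<lambda>xs. EE (geo b) (\<lambda>y. EE (iid l b) (\<lambda>ys. ennreal (r ^ exit_time d (x # xs) (y # ys))))))"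
    by (subst EE_swap[of "geo b" "geo a"], subst EE_swap[of "geo b" "iid l a"]) simp
  finally show ?case by (simp add: g_def)
qed

text \<open>From d = 0 the mean of r^exit is at least 1 - \<zeta>/(1 - a) by
  \<open>walk_mgf\<close>, and \<open>exit_time_stay\<close> concludes since r^l \<le> 1/2. The
  drift hypothesis keeps the mean of z^(x - y) above 1 although y is allowed the larger parameter;
  the hypothesis on \<open>l\<close> makes 1/r at least 1 + 1/l, so that Bernoulli's inequality
  gives the factor 2.\<close>

lemma walk_bound:
  assumes a: "0 < a" "a < 1" and b: "a \<le> b" "b < 1" and \<zeta>: "0 < \<zeta>" "\<zeta> \<le> 1" "a * (1 + \<zeta>) < 1"
    and drift: "2 * (b - a) \<le> a * \<zeta>" and l: "4 \<le> a * \<zeta>^2 * real l"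
  shows "EE (iid l a) (\<lambda>xs. EE (iid l b) (\<lambda>ys. of_bool (\<forall>k\<le>l. ps xs k \<le> ps ys k))) \<le> ennreal (2 * \<zeta> / (1 - a))"
proof -
  define z where "z = 1 + \<zeta>"
  have z: "1 < z" "a * z < 1" "z \<le> 2" using \<zeta> by (auto simp: z_def)
  define r where "r = ((1 - a * z) * (1 - b / z)) / ((1 - a) * (1 - b))"
  define g where "g = (1 - a * z) / ((1 - a) * z)"
  have b0: "0 < b" using a b by simp
  have bz: "0 < 1 - b / z" using b b0 z by (auto simp: field_simps)
  have l0: "0 < real l" using l by (cases "l = 0") auto
  have r0: "0 < r" using a b z bz by (auto simp: r_def)
  have inv: "1 + 1 / real l \<le> 1 / r"
  proof -
    have den: "0 < (1 - a * z) * (z - b)" "(1 - a * z) * (z - b) \<le> 2"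
    proof -
      show "0 < (1 - a * z) * (z - b)" using z b by simp
      have "(1 - a * z) * (z - b) \<le> 1 * 2" using z b a b0 by (intro mult_mono) auto
      then show "(1 - a * z) * (z - b) \<le> 2" by simp
    qed
    have "1 / r = (1 - a) * (1 - b) * z / ((1 - a * z) * (z - b))"
      using z b by (simp add: r_def field_simps)
    also have "\<dots> = 1 + (a * z - b) * (z - 1) / ((1 - a * z) * (z - b))"
      using den by (simp add: field_simps)
    finally have e: "1 / r = 1 + (a * z - b) * \<zeta> / ((1 - a * z) * (z - b))" by (simp add: z_def)
    have "1 / real l \<le> a * \<zeta>^2 / 4" using l l0 by (simp add: field_simps)
    also have "\<dots> = (a * \<zeta> / 2) * \<zeta> / 2" by (simp add: power2_eq_square)
    also have "\<dots> \<le> (a * z - b) * \<zeta> / ((1 - a * z) * (z - b))"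
    proof (rule frac_le)
      have "a * z - b = a * \<zeta> / 2 + (a * \<zeta> - 2 * (b - a)) / 2" by (simp add: z_def field_simps)
      then have azb1: "a * \<zeta> / 2 \<le> a * z - b" using drift by simp
      then have azb: "a * \<zeta> / 2 \<le> a * z - b" "0 \<le> a * z - b"
        using mult_pos_pos[OF a(1) \<zeta>(1)] by auto
      show "(a * \<zeta> / 2) * \<zeta> \<le> (a * z - b) * \<zeta>" using azb \<zeta> by (intro mult_right_mono) auto
      show "0 \<le> (a * z - b) * \<zeta>" using azb \<zeta> by simp
    qed (use den in auto)
    finally show ?thesis using e by simp
  qed
  have rl: "r ^ l \<le> 1/2"
  proof -
    have "2 \<le> 1 + real l * (1 / real l)" using l0 by simp
    also have "\<dots> \<le> (1 + 1 / real l) ^ l" by (rule Bernoulli_inequality) (use l0 in \<open>simp add: order_trans[of "-1" 0]\<close>)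
    also have "\<dots> \<le> (1 / r) ^ l" using inv l0 by (intro power_mono) auto
    finally show ?thesis using r0 by (simp add: power_divide field_simps)
  qed
  have r1: "r \<le> 1" using inv l0 r0 by (smt (verit) divide_pos_pos le_divide_eq_1_pos)
  define U where "U = EE (iid l a) (\<lambda>xs. EE (iid l b) (\<lambda>ys. of_bool (stay 0 xs ys)))"
  have U: "EE (iid l a) (\<lambda>xs. EE (iid l b) (\<lambda>ys. of_bool (\<forall>k\<le>l. ps xs k \<le> ps ys k))) = U"
    unfolding U_def by (intro EE_cong) (auto dest!: set_iid simp: stay_iff)
  have "ennreal g + ennreal (1 - r ^ l) * U
     \<le> EE (iid l a) (\<lambda>xs. EE (iid l b) (\<lambda>ys. ennreal (r ^ exit_time 0 xs ys))) + ennreal (1 - r ^ l) * U"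
    using walk_mgf[OF a b0 b(2) z(1,2) r_def, of 0 l] by (intro add_mono) (auto simp: g_def)
  also have "\<dots> = EE (iid l a) (\<lambda>xs. EE (iid l b) (\<lambda>ys. ennreal (r ^ exit_time 0 xs ys) + ennreal (1 - r ^ l) * of_bool (stay 0 xs ys)))"
    by (simp add: U_def EE_cmult EE_add)
  also have "\<dots> \<le> EE (iid l a) (\<lambda>xs. EE (iid l b) (\<lambda>ys. 1))"
  proof (intro EE_mono)
    fix xs ys assume "xs \<in> set_pmf (iid l a)" "ys \<in> set_pmf (iid l b)"
    then have len: "length xs = l" "length ys = l" by (auto dest: set_iid)
    have "ennreal (r ^ exit_time 0 xs ys) + ennreal (1 - r ^ l) * of_bool (stay 0 xs ys)
      = ennreal (r ^ exit_time 0 xs ys + (1 - r ^ l) * of_bool (stay 0 xs ys))"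
      using r0 rl by (cases "stay 0 xs ys") (auto simp: ennreal_plus[symmetric] simp del: ennreal_plus)
    also have "\<dots> \<le> ennreal 1"
      using exit_time_stay[of r xs ys 0] r0 r1 len by (intro ennreal_leI) auto
    finally show "ennreal (r ^ exit_time 0 xs ys) + ennreal (1 - r ^ l) * of_bool (stay 0 xs ys) \<le> 1" by simp
  qed
  finally have fin: "ennreal g + ennreal (1 - r ^ l) * U \<le> 1" by simp
  have U1: "U \<le> 1"
  proof -
    have "U \<le> EE (iid l a) (\<lambda>xs. EE (iid l b) (\<lambda>ys. 1))"
      unfolding U_def by (intro EE_mono) (auto simp: of_bool_def)
    then show ?thesis by simp
  qed
  then obtain u where u: "U = ennreal u" "0 \<le> u"
    by (cases U) (auto simp: top_unique)
  have g: "0 \<le> g" using a z by (simp add: g_def)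
  have "g + (1 - r ^ l) * u \<le> 1"
    using fin u g rl by (simp add: ennreal_mult[symmetric] ennreal_plus[symmetric] del: ennreal_plus)
  moreover have "(1/2) * u \<le> (1 - r ^ l) * u" using rl u by (intro mult_right_mono) auto
  moreover have "1 - g \<le> \<zeta> / (1 - a)"
  proof -
    have "1 - g = \<zeta> / ((1 - a) * z)" using a z by (simp add: g_def z_def field_simps)
    also have "\<dots> \<le> \<zeta> / ((1 - a) * 1)" using a z \<zeta> by (intro divide_left_mono mult_left_mono) auto
    finally show ?thesis by simp
  qed
  ultimately have "u \<le> 2 * (\<zeta> / (1 - a))" by linarith
  then have "u \<le> 2 * \<zeta> / (1 - a)" by simp
  then show ?thesis unfolding U u by (rule ennreal_leI)
qed

section \<open>Finite marginals of the environment\<close>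

lemma EE_replicate_atom:
  "EE (replicate_pmf n P) (\<lambda>xs. of_bool (xs = ks))
    = (if length ks = n then (\<Prod>i<n. ennreal (pmf P (ks ! i))) else 0)"
proof (induction n arbitrary: ks)
  case 0 then show ?case by auto
next
  case (Suc n)
  show ?case
  proof (cases ks)
    case (Cons k ks')
    have "EE (replicate_pmf (Suc n) P) (\<lambda>xs. of_bool (xs = ks))
       = EE P (\<lambda>x. of_bool (x = k) * EE (replicate_pmf n P) (\<lambda>xs. of_bool (xs = ks')))"
      by (simp add: Cons EE_cmult[symmetric] of_bool_conj)
    also have "\<dots> = EE P (\<lambda>x. of_bool (x = k)) * EE (replicate_pmf n P) (\<lambda>xs. of_bool (xs = ks'))"
      by (rule EE_multc)
    also have "EE P (\<lambda>x. of_bool (x = k)) = ennreal (pmf P k)"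
    proof -
      have "(\<lambda>x. of_bool (x = k) :: ennreal) = indicator {k}" by (auto simp: fun_eq_iff indicator_def)
      then show ?thesis by (simp add: EE_def emeasure_pmf_single)
    qed
    finally show ?thesis by (simp add: Suc Cons prod.lessThan_Suc_shift del: prod.lessThan_Suc replicate_pmf.simps)
  qed simp
qed

lemma env_atom:
  assumes "0 < p" "p < 1" "distinct L"
  shows "{\<omega> \<in> space (env p). map \<omega> L = ks} \<in> sets (env p)"
    and "emeasure (env p) {\<omega> \<in> space (env p). map \<omega> L = ks}
      = (if length ks = length L then (\<Prod>i<length L. ennreal (pmf (geo (1 - p)) (ks ! i))) else 0)"
proof -
  interpret product_prob_space "\<lambda>_. measure_pmf (geometric_pmf p)" UNIV
    by standard
  have geo: "geometric_pmf p = geo (1 - p)" by (simp add: geo_def)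
  show "{\<omega> \<in> space (env p). map \<omega> L = ks} \<in> sets (env p)"
       "emeasure (env p) {\<omega> \<in> space (env p). map \<omega> L = ks}
      = (if length ks = length L then (\<Prod>i<length L. ennreal (pmf (geo (1 - p)) (ks ! i))) else 0)"
  proof -
    show "emeasure (env p) {\<omega> \<in> space (env p). map \<omega> L = ks}
      = (if length ks = length L then (\<Prod>i<length L. ennreal (pmf (geo (1 - p)) (ks ! i))) else 0)"
    proof (cases "length ks = length L")
      case True
      define X where "X x = {the (map_of (zip L ks) x)}" for x
      have Xn: "X (L ! i) = {ks ! i}" if "i < length L" for i
        using that True assms(3) by (simp add: X_def map_of_zip_nth)
      have "{\<omega> \<in> space (env p). map \<omega> L = ks} = {\<omega> \<in> space (PiM UNIV (\<lambda>_. measure_pmf (geometric_pmf p))). \<forall>x\<in>set L. \<omega> x \<in> X x}"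
        using True by (auto simp: env_def list_eq_iff_nth_eq all_set_conv_all_nth Xn)
      then have "emeasure (env p) {\<omega> \<in> space (env p). map \<omega> L = ks} = (\<Prod>x\<in>set L. emeasure (measure_pmf (geometric_pmf p)) (X x))"
        unfolding env_def by (simp add: emeasure_PiM_Collect)
      also have "\<dots> = (\<Prod>i<length L. emeasure (measure_pmf (geometric_pmf p)) (X (L ! i)))"
        using bij_betw_nth[OF assms(3) refl refl] by (intro prod.reindex_bij_betw[symmetric])
      also have "\<dots> = (\<Prod>i<length L. ennreal (pmf (geo (1 - p)) (ks ! i)))"
        by (intro prod.cong) (auto simp: Xn emeasure_pmf_single geo)
      finally show ?thesis using True by simp
    next
      case False
      then have "emeasure (env p) {\<omega> \<in> space (env p). map \<omega> L = ks} = emeasure (env p) {}"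
        by (intro arg_cong[where f = "emeasure (env p)"]) auto
      with False show ?thesis by (simp only: emeasure_empty if_False)
    qed
    have comp: "{\<omega> \<in> space (env p). \<omega> x = k} \<in> sets (env p)" for x k
    proof -
      have "(\<lambda>\<omega>. \<omega> x) \<in> measurable (env p) (measure_pmf (geometric_pmf p))"
        unfolding env_def by (rule measurable_component_singleton) simp
      from measurable_sets[OF this, of "{k}"] show ?thesis
        by (simp add: vimage_def Int_def conj_commute)
    qed
    show "{\<omega> \<in> space (env p). map \<omega> L = ks} \<in> sets (env p)"
    proof (cases "length ks = length L")
      case True
      then have "{\<omega> \<in> space (env p). map \<omega> L = ks} = {\<omega> \<in> space (env p). \<forall>i\<in>{..<length L}. \<omega> (L ! i) = ks ! i}"
        unfolding list_eq_iff_nth_eq by (simp add: Ball_def)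
      also have "\<dots> \<in> sets (env p)"
        by (intro sets.sets_Collect_finite_All comp) auto
      finally show ?thesis .
    next
      case False
      then have "{\<omega> \<in> space (env p). map \<omega> L = ks} = {}"
        by auto
      then show ?thesis by (simp only: sets.empty_sets)
    qed
  qed
qed

lemma env_map_measurable:
  assumes "0 < p" "p < 1" "distinct L"
  shows "(\<lambda>\<omega>. map \<omega> L) \<in> measurable (env p) (count_space UNIV)"
  unfolding measurable_count_space_eq2_countable
  using env_atom(1)[OF assms] by (auto simp: vimage_def Int_def conj_commute)

lemma env_distr:
  assumes "0 < p" "p < 1" "distinct L"
  shows "distr (env p) (count_space UNIV) (\<lambda>\<omega>. map \<omega> L) = measure_pmf (iid (length L) (1 - p))"
proof (rule measure_eqI_countable[where A = UNIV])
  fix ks :: "nat list"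
  have "emeasure (distr (env p) (count_space UNIV) (\<lambda>\<omega>. map \<omega> L)) {ks} = emeasure (env p) {\<omega> \<in> space (env p). map \<omega> L = ks}"
    using env_map_measurable[OF assms] by (subst emeasure_distr) (auto simp: vimage_def Int_def conj_commute)
  also have "\<dots> = EE (iid (length L) (1 - p)) (\<lambda>xs. of_bool (xs = ks))"
    by (simp add: env_atom(2)[OF assms] EE_replicate_atom)
  also have "\<dots> = emeasure (measure_pmf (iid (length L) (1 - p))) {ks}"
  proof -
    have "(\<lambda>x. of_bool (x = ks) :: ennreal) = indicator {ks}" by (auto simp: fun_eq_iff indicator_def)
    then show ?thesis by (simp add: EE_def)
  qed
  finally show "emeasure (distr (env p) (count_space UNIV) (\<lambda>\<omega>. map \<omega> L)) {ks} = emeasure (measure_pmf (iid (length L) (1 - p))) {ks}" .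
qed auto

text \<open>\<open>Q\<close> is enclosed in an event decided by the finitely many sites in
  \<open>L\<close>. A measurable superset is enough for an upper bound, so measurability of the
  geodesic events is never at issue.\<close>

lemma env_prob_le:
  assumes "0 < p" "p < 1" "distinct L" "\<And>\<omega>. Q \<omega> \<Longrightarrow> R (map \<omega> L)"
  shows "\<exists>S\<in>sets (env p). {\<omega> \<in> space (env p). Q \<omega>} \<subseteq> S \<and>
    emeasure (env p) S = EE (iid (length L) (1 - p)) (\<lambda>ks. of_bool (R ks))"
proof (intro bexI conjI)
  note meas = env_map_measurable[OF assms(1-3)]
  show "{\<omega> \<in> space (env p). R (map \<omega> L)} \<in> sets (env p)"
    using measurable_sets_Collect[OF meas, of R] by auto
  show "{\<omega> \<in> space (env p). Q \<omega>} \<subseteq> {\<omega> \<in> space (env p). R (map \<omega> L)}"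
    using assms(4) by auto
  have "emeasure (env p) {\<omega> \<in> space (env p). R (map \<omega> L)} = emeasure (distr (env p) (count_space UNIV) (\<lambda>\<omega>. map \<omega> L)) {ks. R ks}"
    using meas by (subst emeasure_distr) (auto simp: vimage_def Int_def conj_commute)
  also have "\<dots> = EE (iid (length L) (1 - p)) (\<lambda>ks. of_bool (R ks))"
  proof -
    have "(\<lambda>x. of_bool (R x) :: ennreal) = indicator {ks. R ks}" by (auto simp: fun_eq_iff indicator_def)
    then show ?thesis by (simp add: EE_def env_distr[OF assms(1-3)])
  qed
  finally show "emeasure (env p) {\<omega> \<in> space (env p). R (map \<omega> L)} = EE (iid (length L) (1 - p)) (\<lambda>ks. of_bool (R ks))" .
qed

section \<open>Independent weight matrices on disjoint sites\<close>

primrec chunk :: "nat \<Rightarrow> nat \<Rightarrow> 'a list \<Rightarrow> 'a list list" where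
  "chunk 0 m ks = []"
| "chunk (Suc h) m ks = take m ks # chunk h m (drop m ks)"

lemma EE_chunk: "EE (iid (h * m) q) (\<lambda>ks. f (chunk h m ks)) = EE (iidm h m q) f"
proof (induction h arbitrary: f)
  case (Suc h)
  have "EE (iid (Suc h * m) q) (\<lambda>ks. f (chunk (Suc h) m ks))
     = EE (iid m q) (\<lambda>ws. EE (iid (h * m) q) (\<lambda>ks. f (chunk (Suc h) m (ws @ ks))))"
    by (simp add: EE_iid_append)
  also have "\<dots> = EE (iid m q) (\<lambda>ws. EE (iid (h * m) q) (\<lambda>ks. f (ws # chunk h m ks)))"
    by (rule EE_iid_length) simp
  also have "\<dots> = EE (iid m q) (\<lambda>ws. EE (iidm h m q) (\<lambda>wss. f (ws # wss)))"
    by (simp add: Suc[of "\<lambda>wss. f (_ # wss)"])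
  finally show ?case by simp
qed simp

lemma chunk_concat: "length ss = h \<Longrightarrow> (\<And>s. s \<in> set ss \<Longrightarrow> length s = m) \<Longrightarrow> chunk h m (concat ss @ ts) = ss"
  by (induction ss arbitrary: h) auto

lemma length_concat_const: "(\<And>s. s \<in> set ss \<Longrightarrow> length s = m) \<Longrightarrow> length (concat ss) = length ss * m"
  by (induction ss) auto

lemma env_prob_matrices:
  fixes ss ss' :: "site list list"
  assumes p: "0 < p" "p < 1" and "distinct (concat ss @ concat ss')"
    and ss: "length ss = h" "\<And>s. s \<in> set ss \<Longrightarrow> length s = m"
    and ss': "length ss' = h'" "\<And>s. s \<in> set ss' \<Longrightarrow> length s = m'"
    and R: "\<And>\<omega>. Q \<omega> \<Longrightarrow> R (map (map \<omega>) ss) (map (map \<omega>) ss')"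
  shows "\<exists>S\<in>sets (env p). {\<omega> \<in> space (env p). Q \<omega>} \<subseteq> S \<and>
    emeasure (env p) S = EE (iidm h m (1 - p)) (\<lambda>A. EE (iidm h' m' (1 - p)) (\<lambda>B. of_bool (R A B)))"
proof -
  have len: "length (concat ss) = h * m" "length (concat ss') = h' * m'"
    using length_concat_const[of ss m] length_concat_const[of ss' m'] ss ss' by auto
  have "\<exists>S\<in>sets (env p). {\<omega> \<in> space (env p). Q \<omega>} \<subseteq> S \<and> emeasure (env p) S
     = EE (iid (length (concat ss @ concat ss')) (1 - p)) (\<lambda>ks. of_bool (R (chunk h m ks) (chunk h' m' (drop (h * m) ks))))"
  proof (rule env_prob_le[OF p assms(3)])
    fix \<omega> assume "Q \<omega>"
    have c: "map \<omega> (concat ss @ concat ss') = concat (map (map \<omega>) ss) @ concat (map (map \<omega>) ss')"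
      by (simp add: map_concat)
    have "chunk h m (concat (map (map \<omega>) ss) @ concat (map (map \<omega>) ss')) = map (map \<omega>) ss"
      using ss by (intro chunk_concat) auto
    moreover have "drop (h * m) (concat (map (map \<omega>) ss) @ concat (map (map \<omega>) ss')) = concat (map (map \<omega>) ss')"
      using len by (simp flip: map_concat)
    moreover have "chunk h' m' (concat (map (map \<omega>) ss')) = map (map \<omega>) ss'"
      using chunk_concat[of "map (map \<omega>) ss'" h' m' "[]"] ss' by (force simp: image_iff)
    ultimately show "R (chunk h m (map \<omega> (concat ss @ concat ss'))) (chunk h' m' (drop (h * m) (map \<omega> (concat ss @ concat ss'))))"
      using R[OF \<open>Q \<omega>\<close>] unfolding c by simp
  qed
  then obtain S where S: "S \<in> sets (env p)" "{\<omega> \<in> space (env p). Q \<omega>} \<subseteq> S" and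
    "emeasure (env p) S = EE (iid (length (concat ss @ concat ss')) (1 - p)) (\<lambda>ks. of_bool (R (chunk h m ks) (chunk h' m' (drop (h * m) ks))))"
    by blast
  note this(3)
  also have "\<dots> = EE (iid (h * m) (1 - p)) (\<lambda>ks. EE (iid (h' * m') (1 - p)) (\<lambda>ks'. of_bool (R (chunk h m (ks @ ks')) (chunk h' m' (drop (h * m) (ks @ ks'))))))"
    by (simp add: len EE_iid_append)
  also have "\<dots> = EE (iid (h * m) (1 - p)) (\<lambda>ks. EE (iid (h' * m') (1 - p)) (\<lambda>ks'. of_bool (R (chunk h m ks) (chunk h' m' ks'))))"
  proof (rule EE_iid_length)
    fix ks :: "nat list" assume l: "length ks = h * m"
    have "chunk h m (ks @ ks') = chunk h m ks" for ks'
      using l by (induction h arbitrary: ks) auto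
    then show "EE (iid (h' * m') (1 - p)) (\<lambda>ks'. of_bool (R (chunk h m (ks @ ks')) (chunk h' m' (drop (h * m) (ks @ ks')))))
      = EE (iid (h' * m') (1 - p)) (\<lambda>ks'. of_bool (R (chunk h m ks) (chunk h' m' ks')))"
      using l by simp
  qed
  also have "\<dots> = EE (iidm h m (1 - p)) (\<lambda>A. EE (iidm h' m' (1 - p)) (\<lambda>B. of_bool (R A B)))"
    by (simp add: EE_chunk[of h' m' _ "\<lambda>B. of_bool (R _ B)"] EE_chunk[of h m _ "\<lambda>A. EE _ (\<lambda>B. of_bool (R A B))"])
  finally show ?thesis using S by blast
qed

section \<open>Directed paths\<close>

definition step :: "site \<Rightarrow> site \<Rightarrow> bool" where
  "step x y \<longleftrightarrow> y = (fst x + 1, snd x) \<or> y = (fst x, snd x + 1)"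

lemma dpath_successively: "dpath u v \<gamma> \<longleftrightarrow> \<gamma> \<noteq> [] \<and> hd \<gamma> = u \<and> last \<gamma> = v \<and> successively step \<gamma>"
  by (auto simp: dpath_def successively_conv_nth step_def)

lemma pweight_append: "pweight \<omega> (xs @ ys) = pweight \<omega> xs + pweight \<omega> ys"
  by (simp add: pweight_def)

lemma pweight_Cons: "pweight \<omega> (x # xs) = \<omega> x + pweight \<omega> xs"
  by (simp add: pweight_def)

lemma pweight_Nil [simp]: "pweight \<omega> [] = 0"
  by (simp add: pweight_def)

lemma dpath_append:
  assumes "dpath u v \<gamma>" "dpath x y \<gamma>'" "step v x"
  shows "dpath u y (\<gamma> @ \<gamma>')"
  using assms by (auto simp: dpath_successively successively_append_iff)

abbreviation LP0 :: "(nat \<Rightarrow> nat \<Rightarrow> nat) \<Rightarrow> nat \<Rightarrow> nat \<Rightarrow> nat" where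
  "LP0 \<equiv> LP (\<lambda>_. 0) (\<lambda>_. 0)"

lemma LP0_0 [simp]: "LP0 w 0 j = 0"
  by (rule LP_0) simp

definition fwd :: "(site \<Rightarrow> nat) \<Rightarrow> nat \<Rightarrow> nat \<Rightarrow> nat" where
  "fwd \<omega> i j = \<omega> (int i, int j)"

text \<open>The environment reflected so that (n, n) becomes the origin; passage times into (n, n)
  then obey the forward recursion.\<close>

definition bwd :: "nat \<Rightarrow> (site \<Rightarrow> nat) \<Rightarrow> nat \<Rightarrow> nat \<Rightarrow> nat" where
  "bwd n \<omega> i j = \<omega> (int n - int i, int n - int j)"

text \<open>The zero boundary occupies index 0, so the site (k, l) sits at index (Suc k, Suc l).
  This shift recurs in all later index arithmetic.\<close>

lemma path_le_LP0:
  assumes "\<gamma> \<noteq> []" "hd \<gamma> = (0, 0)" "successively step \<gamma>"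
  shows "\<exists>k l. last \<gamma> = (int k, int l) \<and> pweight \<omega> \<gamma> \<le> LP0 (fwd \<omega>) (Suc k) (Suc l)"
  using assms
proof (induction \<gamma> rule: rev_induct)
  case (snoc x \<gamma>)
  show ?case
  proof (cases "\<gamma> = []")
    case True
    then show ?thesis using snoc.prems by (intro exI[of _ 0]) (auto simp: pweight_def fwd_def)
  next
    case False
    then obtain k l where kl: "last \<gamma> = (int k, int l)" "pweight \<omega> \<gamma> \<le> LP0 (fwd \<omega>) (Suc k) (Suc l)"
      using snoc by (auto simp: successively_append_iff)
    have "step (int k, int l) x" using snoc.prems False kl by (auto simp: successively_append_iff)
    then consider "x = (int (Suc k), int l)" | "x = (int k, int (Suc l))"
      by (auto simp: step_def)
    then show ?thesis
    proof cases
      case 1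
      then show ?thesis using kl
        by - (rule exI[of _ "Suc k"], rule exI[of _ l], auto simp: pweight_append pweight_Cons LP.simps(3)[of _ _ _ "Suc k"] fwd_def[of _ "Suc k"] max_def simp del: of_nat_Suc LP.simps(3))
    next
      case 2
      then show ?thesis using kl
        by - (rule exI[of _ k], rule exI[of _ "Suc l"], auto simp: pweight_append pweight_Cons LP.simps(3)[of _ _ _ k "Suc l"] fwd_def[of _ k "Suc l"] max_def simp del: of_nat_Suc LP.simps(3))
    qed
  qed
qed simp

lemma dpath_le_fwd:
  assumes "dpath (0, 0) (int k, int l) \<gamma>"
  shows "pweight \<omega> \<gamma> \<le> LP0 (fwd \<omega>) (Suc k) (Suc l)"
  using path_le_LP0[of \<gamma> \<omega>] assms by (auto simp: dpath_successively simp del: LP.simps)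

lemma dpath_snoc: "dpath u v \<gamma> \<Longrightarrow> step v x \<Longrightarrow> dpath u x (\<gamma> @ [x])"
  by (auto simp: dpath_successively successively_append_iff)

lemma ex_dpath_fwd: "\<exists>\<gamma>. dpath (0, 0) (int k, int l) \<gamma> \<and> pweight \<omega> \<gamma> = LP0 (fwd \<omega>) (Suc k) (Suc l)"
proof (induction "k + l" arbitrary: k l)
  case 0
  then show ?case by (intro exI[of _ "[(0, 0)]"]) (auto simp: dpath_successively pweight_def fwd_def)
next
  case (Suc N)
  have rec: "LP0 (fwd \<omega>) (Suc k) (Suc l) = \<omega> (int k, int l) + max (LP0 (fwd \<omega>) k (Suc l)) (LP0 (fwd \<omega>) (Suc k) l)"
    by (simp add: fwd_def)
  consider k' where "k = Suc k'" "LP0 (fwd \<omega>) (Suc k) l \<le> LP0 (fwd \<omega>) k (Suc l)"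
    | l' where "l = Suc l'" "LP0 (fwd \<omega>) k (Suc l) \<le> LP0 (fwd \<omega>) (Suc k) l"
    using Suc.hyps(2)
    by (cases "LP0 (fwd \<omega>) (Suc k) l \<le> LP0 (fwd \<omega>) k (Suc l)"; cases k; cases l) (auto simp del: LP.simps(3))
  then show ?case
  proof cases
    case 1
    then obtain \<gamma> where "dpath (0, 0) (int k', int l) \<gamma>" "pweight \<omega> \<gamma> = LP0 (fwd \<omega>) (Suc k') (Suc l)"
      using Suc.hyps(1)[of k' l] Suc.hyps(2) by auto
    then show ?thesis unfolding rec using 1
      by (intro exI[of _ "\<gamma> @ [(int k, int l)]"]) (auto simp: pweight_append pweight_Cons step_def simp del: LP.simps(3) intro!: dpath_snoc)
  next
    case 2
    then obtain \<gamma> where "dpath (0, 0) (int k, int l') \<gamma>" "pweight \<omega> \<gamma> = LP0 (fwd \<omega>) (Suc k) (Suc l')"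
      using Suc.hyps(1)[of k l'] Suc.hyps(2) by auto
    then show ?thesis unfolding rec using 2
      by (intro exI[of _ "\<gamma> @ [(int k, int l)]"]) (auto simp: pweight_append pweight_Cons step_def simp del: LP.simps(3) intro!: dpath_snoc)
  qed
qed

section \<open>Reflections of the lattice\<close>

definition flip :: "nat \<Rightarrow> site \<Rightarrow> site" where
  "flip n x = (int n - fst x, int n - snd x)"

lemma flip_flip [simp]: "flip n (flip n x) = x"
  by (simp add: flip_def)

lemma dpath_flip: "dpath u v \<gamma> \<Longrightarrow> dpath (flip n v) (flip n u) (rev (map (flip n) \<gamma>))"
  by (auto simp: dpath_successively hd_rev last_rev last_map hd_map successively_map step_def flip_def
      elim!: successively_mono)

lemma pweight_flip: "pweight (\<omega> \<circ> flip n) (rev (map (flip n) \<gamma>)) = pweight \<omega> \<gamma>"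
  by (simp add: pweight_def rev_map[symmetric] o_def)

lemma fwd_flip: "fwd (\<omega> \<circ> flip n) = bwd n \<omega>"
  by (intro ext) (simp add: fwd_def bwd_def flip_def)

lemma dpath_le_bwd:
  assumes "dpath (int n - int i, int n - int j) (int n, int n) \<gamma>"
  shows "pweight \<omega> \<gamma> \<le> LP0 (bwd n \<omega>) (Suc i) (Suc j)"
proof -
  have "dpath (0, 0) (int i, int j) (rev (map (flip n) \<gamma>))"
    using dpath_flip[OF assms, of n] by (simp add: flip_def)
  from dpath_le_fwd[OF this, of "\<omega> \<circ> flip n"] show ?thesis
    by (simp only: pweight_flip fwd_flip)
qed

lemma ex_dpath_bwd: "\<exists>\<gamma>. dpath (int n - int i, int n - int j) (int n, int n) \<gamma> \<and> pweight \<omega> \<gamma> = LP0 (bwd n \<omega>) (Suc i) (Suc j)"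
proof -
  obtain \<gamma> where \<gamma>: "dpath (0, 0) (int i, int j) \<gamma>" "pweight (\<omega> \<circ> flip n) \<gamma> = LP0 (bwd n \<omega>) (Suc i) (Suc j)"
    using ex_dpath_fwd[of i j "\<omega> \<circ> flip n"] unfolding fwd_flip by blast
  have "dpath (int n - int i, int n - int j) (int n, int n) (rev (map (flip n) \<gamma>))"
    using dpath_flip[OF \<gamma>(1), of n] by (simp add: flip_def)
  moreover have "pweight \<omega> (rev (map (flip n) \<gamma>)) = LP0 (bwd n \<omega>) (Suc i) (Suc j)"
    using pweight_flip[of "\<omega> \<circ> flip n" n \<gamma>] \<gamma>(2) by (simp add: o_def)
  ultimately show ?thesis by blast
qed

lemma lpp_ge:
  assumes "dpath (0, 0) (int n, int n) \<gamma>"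
  shows "pweight \<omega> \<gamma> \<le> lpp \<omega> (0, 0) (int n, int n)"
proof -
  have "finite {pweight \<omega> \<gamma> | \<gamma>. dpath (0, 0) (int n, int n) \<gamma>}"
    by (rule finite_subset[of _ "{..LP0 (fwd \<omega>) (Suc n) (Suc n)}"]) (use dpath_le_fwd in blast, simp)
  then show ?thesis unfolding lpp_def using assms by (intro Max_ge) auto
qed

lemma geodesic_ge:
  assumes "geodesic \<omega> (0, 0) (int n, int n) \<gamma>" "dpath (0, 0) (int n, int n) \<gamma>'"
  shows "pweight \<omega> \<gamma>' \<le> pweight \<omega> \<gamma>"
  using lpp_ge[OF assms(2), of \<omega>] assms(1) by (simp add: geodesic_def)

definition swp :: "site \<Rightarrow> site" where "swp x = (snd x, fst x)"

lemma swp_swp [simp]: "swp (swp x) = x"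
  by (simp add: swp_def)

lemma dpath_swp: "dpath u v \<gamma> \<Longrightarrow> dpath (swp u) (swp v) (map swp \<gamma>)"
  by (auto simp: dpath_successively last_map hd_map successively_map step_def swp_def elim!: successively_mono)

lemma pweight_swp: "pweight (\<omega> \<circ> swp) (map swp \<gamma>) = pweight \<omega> \<gamma>"
  by (simp add: pweight_def o_def)

lemma geodesic_swp:
  assumes "geodesic \<omega> u v \<gamma>"
  shows "geodesic (\<omega> \<circ> swp) (swp u) (swp v) (map swp \<gamma>)"
proof -
  have "{pweight (\<omega> \<circ> swp) \<gamma> | \<gamma>. dpath (swp u) (swp v) \<gamma>} = {pweight \<omega> \<gamma> | \<gamma>. dpath u v \<gamma>}"
  proof (intro set_eqI iffI; clarsimp)
    fix \<gamma> assume "dpath (swp u) (swp v) \<gamma>"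
    then show "\<exists>\<gamma>'. pweight (\<omega> \<circ> swp) \<gamma> = pweight \<omega> \<gamma>' \<and> dpath u v \<gamma>'"
      using dpath_swp[of "swp u" "swp v" \<gamma>] pweight_swp[of "\<omega> \<circ> swp" \<gamma>]
      by (intro exI[of _ "map swp \<gamma>"]) (auto simp: o_def)
  next
    fix \<gamma> assume "dpath u v \<gamma>"
    then show "\<exists>\<gamma>'. pweight \<omega> \<gamma> = pweight (\<omega> \<circ> swp) \<gamma>' \<and> dpath (swp u) (swp v) \<gamma>'"
      using dpath_swp[of u v \<gamma>] by (intro exI[of _ "map swp \<gamma>"]) (auto simp: pweight_swp)
  qed
  then show ?thesis
    using assms dpath_swp[of u v \<gamma>] by (simp add: geodesic_def lpp_def pweight_swp)
qed

lemma geo_union_swp: "v \<in> geo_union \<omega> (0, 0) (int n, int n) \<Longrightarrow> swp v \<in> geo_union (\<omega> \<circ> swp) (0, 0) (int n, int n)"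
  unfolding geo_union_def using geodesic_swp[of \<omega> "(0, 0)" "(int n, int n)"] by (force simp: swp_def)

text \<open>An upward step separates the geodesic into a half in rows up to that of \<open>v\<close>
  and a half in the rows above, which carry independent weights. A rightward step becomes upward in
  the transposed environment (\<open>geo_union_cases\<close>).\<close>

definition up_geo :: "nat \<Rightarrow> (site \<Rightarrow> nat) \<Rightarrow> site \<Rightarrow> bool" where
  "up_geo n \<omega> v \<longleftrightarrow> (\<exists>\<gamma>1 \<gamma>2. geodesic \<omega> (0, 0) (int n, int n) (\<gamma>1 @ v # (fst v, snd v + 1) # \<gamma>2))"

lemma geo_union_cases:
  assumes "v \<in> geo_union \<omega> (0, 0) (int n, int n)" "v \<noteq> (int n, int n)"
  shows "up_geo n \<omega> v \<or> up_geo n (\<omega> \<circ> swp) (swp v)"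
proof -
  obtain \<gamma> where \<gamma>: "geodesic \<omega> (0, 0) (int n, int n) \<gamma>" "v \<in> set \<gamma>"
    using assms(1) by (auto simp: geo_union_def)
  then obtain \<gamma>1 \<gamma>2 where s: "\<gamma> = \<gamma>1 @ v # \<gamma>2" by (meson split_list)
  then obtain x \<gamma>3 where s2: "\<gamma>2 = x # \<gamma>3"
    using \<gamma>(1) assms(2) by (cases \<gamma>2) (auto simp: geodesic_def dpath_def)
  have "step v x"
    using \<gamma>(1) unfolding s s2 by (auto simp: geodesic_def dpath_successively successively_append_iff)
  then consider "x = (fst v, snd v + 1)" | "x = (fst v + 1, snd v)" by (auto simp: step_def)
  then show ?thesis
  proof cases
    case 1 then show ?thesis using \<gamma>(1) unfolding s s2 up_geo_def by blast
  next
    case 2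
    have "geodesic (\<omega> \<circ> swp) (0, 0) (int n, int n) (map swp \<gamma>1 @ swp v # (fst (swp v), snd (swp v) + 1) # map swp \<gamma>3)"
      using geodesic_swp[OF \<gamma>(1)] unfolding s s2 2 by (simp add: swp_def)
    then show ?thesis unfolding up_geo_def by blast
  qed
qed

text \<open>Crossing from row v2 to row v2 + 1 at column k instead of v1 gives a competitor to the
  geodesic. Row v2 + 1 has reflected coordinate n - v2 - 1, hence the index n - v2 after the shift
  by one.\<close>

lemma up_geo_inequality:
  assumes "up_geo n \<omega> (int v1, int v2)" "v1 \<le> n" "v2 < n" "k \<le> n"
  shows "LP0 (fwd \<omega>) (Suc k) (Suc v2) + LP0 (bwd n \<omega>) (Suc (n - k)) (n - v2)
       \<le> LP0 (fwd \<omega>) (Suc v1) (Suc v2) + LP0 (bwd n \<omega>) (Suc (n - v1)) (n - v2)"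
proof -
  obtain \<gamma>1 \<gamma>2 where \<gamma>: "geodesic \<omega> (0, 0) (int n, int n) (\<gamma>1 @ (int v1, int v2) # (int v1, int v2 + 1) # \<gamma>2)" (is "geodesic _ _ _ ?\<gamma>")
    using assms(1) by (auto simp: up_geo_def)
  have sites: "(int n - int (n - i), int n - int (n - Suc v2)) = (int i, int v2 + 1)" if "i \<le> n" for i
    using that assms by auto
  have S: "Suc (n - Suc v2) = n - v2" using assms by simp
  have d1: "dpath (0, 0) (int v1, int v2) (\<gamma>1 @ [(int v1, int v2)])"
    using \<gamma> by (auto simp: geodesic_def dpath_successively successively_append_iff hd_append)
  have d2: "dpath (int v1, int v2 + 1) (int n, int n) ((int v1, int v2 + 1) # \<gamma>2)"
    using \<gamma> by (auto simp: geodesic_def dpath_successively successively_append_iff)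
  have "pweight \<omega> ?\<gamma> = pweight \<omega> (\<gamma>1 @ [(int v1, int v2)]) + pweight \<omega> ((int v1, int v2 + 1) # \<gamma>2)"
    by (simp add: pweight_append pweight_Cons)
  also have "\<dots> \<le> LP0 (fwd \<omega>) (Suc v1) (Suc v2) + LP0 (bwd n \<omega>) (Suc (n - v1)) (Suc (n - Suc v2))"
    by (intro add_mono dpath_le_fwd dpath_le_bwd d1) (simp only: sites[OF assms(2)] d2)
  finally have up: "pweight \<omega> ?\<gamma> \<le> LP0 (fwd \<omega>) (Suc v1) (Suc v2) + LP0 (bwd n \<omega>) (Suc (n - v1)) (n - v2)"
    unfolding S .
  obtain \<delta>1 where \<delta>1: "dpath (0, 0) (int k, int v2) \<delta>1" "pweight \<omega> \<delta>1 = LP0 (fwd \<omega>) (Suc k) (Suc v2)"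
    using ex_dpath_fwd by blast
  obtain \<delta>2 where \<delta>2: "dpath (int k, int v2 + 1) (int n, int n) \<delta>2" "pweight \<omega> \<delta>2 = LP0 (bwd n \<omega>) (Suc (n - k)) (n - v2)"
    using ex_dpath_bwd[of n "n - k" "n - Suc v2" \<omega>] unfolding sites[OF assms(4)] S by blast
  have "dpath (0, 0) (int n, int n) (\<delta>1 @ \<delta>2)"
    by (rule dpath_append[OF \<delta>1(1) \<delta>2(1)]) (simp add: step_def)
  from geodesic_ge[OF \<gamma> this] show ?thesis
    using up \<delta>1(2) \<delta>2(2) by (simp only: pweight_append)
qed

text \<open>Seen from (n, n), a geodesic through v enters the rectangle between v and 0 by its left
  side; the constant on the bottom side offers no gain there. The corner index (Suc n - v1, n - v2)
  is chosen so that v is the first site of the left side, which is why the rectangle has v1 columns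
  but v2 + 1 rows.\<close>

lemma geo_union_detour:
  fixes v1 v2 n :: nat
  assumes v: "(int v1, int v2) \<in> geo_union \<omega> (0, 0) (int n, int n)" and le: "v1 \<le> n" "v2 \<le> n"
  defines "B \<equiv> LP0 (bwd n \<omega>)"
  shows "B (Suc n) (Suc n) \<le> LP (\<lambda>_. B (Suc n - v1) (n - v2)) (\<lambda>j. B (Suc n - v1) (n - v2 + j))
      (\<lambda>i j. bwd n \<omega> (Suc n - v1 + i) (n - v2 + j)) v1 (Suc v2)"
proof -
  define i0 where "i0 = Suc n - v1"
  define h where "h = n - v2"
  define U where "U = LP (\<lambda>_. B i0 h) (\<lambda>j. B i0 (h + j)) (\<lambda>i j. bwd n \<omega> (i0 + i) (h + j))"
  obtain i1 where i1: "i0 = Suc i1" using le by (cases i0) (auto simp: i0_def)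
  have U0: "U 0 j = B i0 (h + j)" for j unfolding U_def by (rule LP_0) simp
  have stepU: "\<omega> (int v1 - int (Suc i), int v2 - int j) + U i (Suc j) \<le> U (Suc i) (Suc j)" for i j
  proof -
    have "bwd n \<omega> (i0 + i) (h + j) = \<omega> (int v1 - int (Suc i), int v2 - int j)"
      using le by (simp add: bwd_def i0_def h_def of_nat_diff algebra_simps)
    then show ?thesis by (simp add: U_def)
  qed
  have stepV: "\<omega> (int v1 - int i, int v2 - int (Suc j)) + U i (Suc j) \<le> U i (Suc (Suc j))" for i j
  proof (cases i)
    case 0
    have "int n - int i1 = int v1" using le i1 by (simp add: i0_def)
    then have "bwd n \<omega> i1 (h + Suc j) = \<omega> (int v1 - int i, int v2 - int (Suc j))"
      using le 0 by (simp add: bwd_def i0_def h_def of_nat_diff algebra_simps)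
    moreover have "bwd n \<omega> i1 (h + Suc j) + B i0 (h + Suc j) \<le> B i0 (h + Suc (Suc j))"
      by (simp add: i1 B_def)
    ultimately show ?thesis by (simp add: 0 U0)
  next
    case (Suc i')
    have "bwd n \<omega> (i0 + i') (h + Suc j) = \<omega> (int v1 - int i, int v2 - int (Suc j))"
      using le Suc by (simp add: bwd_def i0_def h_def of_nat_diff algebra_simps)
    then show ?thesis by (simp add: U_def Suc)
  qed
  \<comment> \<open>Induction from v back along the path; \<open>butlast\<close> drops v, whose
    weight is already contained in \<open>U 0 1\<close>.\<close>
  have main: "\<exists>i j. hd \<delta> = (int v1 - int i, int v2 - int j) \<and> pweight \<omega> (butlast \<delta>) + U 0 1 \<le> U i (Suc j)"
    if "\<delta> \<noteq> []" "successively step \<delta>" "last \<delta> = (int v1, int v2)" for \<delta>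
    using that
  proof (induction \<delta>)
    case (Cons x \<delta>)
    show ?case
    proof (cases "\<delta> = []")
      case True
      then show ?thesis using Cons by (intro exI[of _ 0]) auto
    next
      case False
      then obtain i j where ij: "hd \<delta> = (int v1 - int i, int v2 - int j)" "pweight \<omega> (butlast \<delta>) + U 0 1 \<le> U i (Suc j)"
        using Cons by (auto simp: successively_Cons)
      have "step x (hd \<delta>)" using Cons.prems False by (auto simp: successively_Cons)
      then consider "x = (int v1 - int (Suc i), int v2 - int j)" | "x = (int v1 - int i, int v2 - int (Suc j))"
        unfolding step_def ij by (cases x) auto
      then show ?thesis
      proof cases
        case 1
        then show ?thesis using ij stepU[of i j] False
          by - (rule exI[of _ "Suc i"], rule exI[of _ j], auto simp: pweight_Cons simp del: of_nat_Suc)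
      next
        case 2
        then show ?thesis using ij stepV[of i j] False
          by - (rule exI[of _ i], rule exI[of _ "Suc j"], auto simp: pweight_Cons simp del: of_nat_Suc)
      qed
    qed
  qed simp
  obtain \<gamma> where \<gamma>: "geodesic \<omega> (0, 0) (int n, int n) \<gamma>" "(int v1, int v2) \<in> set \<gamma>"
    using v by (auto simp: geo_union_def)
  then obtain \<gamma>1 \<gamma>2 where s: "\<gamma> = \<gamma>1 @ (int v1, int v2) # \<gamma>2" by (meson split_list)
  have d1: "successively step (\<gamma>1 @ [(int v1, int v2)])" "hd (\<gamma>1 @ [(int v1, int v2)]) = (0, 0)"
    using \<gamma>(1) unfolding s by (auto simp: geodesic_def dpath_successively successively_append_iff hd_append)
  obtain i j where ij: "hd (\<gamma>1 @ [(int v1, int v2)]) = (int v1 - int i, int v2 - int j)"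
      "pweight \<omega> (butlast (\<gamma>1 @ [(int v1, int v2)])) + U 0 1 \<le> U i (Suc j)"
    using main[OF _ d1(1)] by auto
  then have ij2: "i = v1" "j = v2" "pweight \<omega> \<gamma>1 + B i0 (Suc h) \<le> U v1 (Suc v2)" using d1(2) U0 by auto
  have d2: "dpath (int v1, int v2) (int n, int n) ((int v1, int v2) # \<gamma>2)"
    using \<gamma>(1) unfolding s by (auto simp: geodesic_def dpath_successively successively_append_iff)
  have "pweight \<omega> ((int v1, int v2) # \<gamma>2) \<le> B (Suc (n - v1)) (Suc (n - v2))"
    unfolding B_def by (rule dpath_le_bwd) (use d2 le in \<open>simp add: of_nat_diff\<close>)
  also have "B (Suc (n - v1)) (Suc (n - v2)) = B i0 (Suc h)" using le by (simp add: i0_def h_def Suc_diff_le)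
  finally have "pweight \<omega> \<gamma> \<le> U v1 (Suc v2)"
    using ij2(3) by (simp add: s pweight_append)
  moreover have "B (Suc n) (Suc n) \<le> pweight \<omega> \<gamma>"
  proof -
    obtain \<delta> where \<delta>: "dpath (0, 0) (int n, int n) \<delta>" "pweight \<omega> \<delta> = B (Suc n) (Suc n)"
      using ex_dpath_bwd[of n n n \<omega>] unfolding B_def by auto
    show ?thesis using geodesic_ge[OF \<gamma>(1) \<delta>(1)] \<delta>(2) by simp
  qed
  ultimately show ?thesis unfolding U_def i0_def h_def by linarith
qed

section \<open>Transversal fluctuations\<close>

lemma LP_sub_split:
  fixes A B :: "nat \<Rightarrow> nat" and w :: "nat \<Rightarrow> nat \<Rightarrow> nat"
  assumes "mono A" "mono B" "A 0 = B 0"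
  defines "P \<equiv> LP A B w"
  shows "P (i0 + i) (h + j) = max (LP (\<lambda>i. P (i0 + i) h) (\<lambda>_. P i0 h) (\<lambda>i j. w (i0 + i) (h + j)) i j)
     (LP (\<lambda>_. P i0 h) (\<lambda>j. P i0 (h + j)) (\<lambda>i j. w (i0 + i) (h + j)) i j)"
proof -
  note m = LP_mono_bdry[OF assms(1-3), of w, folded P_def]
  have m1: "P i0 h \<le> P (i0 + i) h" for i by (induction i) (auto intro: order_trans m(1))
  have m2: "P i0 h \<le> P i0 (h + j)" for j by (induction j) (auto intro: order_trans m(2))
  have "P (i0 + i) (h + j) = LP (\<lambda>i. P (i0 + i) h) (\<lambda>j. P i0 (h + j)) (\<lambda>i j. w (i0 + i) (h + j)) i j"
    unfolding P_def by (rule LP_rebase)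
  also have "\<dots> = LP (\<lambda>i. max (P (i0 + i) h) (P i0 h)) (\<lambda>j. max (P i0 h) (P i0 (h + j))) (\<lambda>i j. w (i0 + i) (h + j)) i j"
    using m1 m2 by (simp add: max_absorb1 max_absorb2)
  also have "\<dots> = max (LP (\<lambda>i. P (i0 + i) h) (\<lambda>_. P i0 h) (\<lambda>i j. w (i0 + i) (h + j)) i j)
     (LP (\<lambda>_. P i0 h) (\<lambda>j. P i0 (h + j)) (\<lambda>i j. w (i0 + i) (h + j)) i j)"
    by (rule LP_max)
  finally show ?thesis .
qed

text \<open>If the bulk optimum runs through the left side of the sub-rectangle and the stationary
  optimum leaves through the vertical boundary, then the stationary optimum also runs through
  the left side of the sub-rectangle.\<close>

lemma sub_exit:
  fixes A Bd :: "nat \<Rightarrow> nat" and w :: "nat \<Rightarrow> nat \<Rightarrow> nat" and i0 h :: nat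
  assumes mA: "mono A" "A 0 = 0" and mB: "mono Bd" "Bd 0 = 0"
  defines "B \<equiv> LP0 w" and "V \<equiv> LP (\<lambda>_. 0) Bd w" and "H \<equiv> LP A (\<lambda>_. 0) w" and "G \<equiv> LP A Bd w"
    and "w' \<equiv> \<lambda>i j. w (i0 + i) (h + j)"
  assumes bulk: "B (i0 + v) (h + k) \<le> LP (\<lambda>_. B i0 h) (\<lambda>j. B i0 (h + j)) w' v k"
    and exit: "H (i0 + v) (h + k) \<le> V (i0 + v) (h + k)"
  shows "LP (\<lambda>i. G (i0 + i) h) (\<lambda>_. G i0 h) w' v k \<le> LP (\<lambda>_. G i0 h) (\<lambda>j. G i0 (h + j)) w' v k"
proof -
  have c: "mono (\<lambda>_::nat. 0::nat)" by (simp add: mono_def)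
  define hor where "hor P = LP (\<lambda>i. P (i0 + i) h) (\<lambda>_. P i0 h) w' v k" for P :: "nat \<Rightarrow> nat \<Rightarrow> nat"
  define ver where "ver P = LP (\<lambda>_. P i0 h) (\<lambda>j. P i0 (h + j)) w' v k" for P :: "nat \<Rightarrow> nat \<Rightarrow> nat"
  have sB: "B (i0 + v) (h + k) = max (hor B) (ver B)"
    unfolding hor_def ver_def B_def w'_def by (rule LP_sub_split) (auto simp: c)
  have sV: "V (i0 + v) (h + k) = max (hor V) (ver V)"
    unfolding hor_def ver_def V_def w'_def by (rule LP_sub_split) (auto simp: c mB)
  have sG: "G (i0 + v) (h + k) = max (hor G) (ver G)"
    unfolding hor_def ver_def G_def w'_def by (rule LP_sub_split) (auto simp: mA mB)
  have G: "G i j = max (H i j) (V i j)" for i j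
    unfolding G_def H_def V_def by (rule LP_split)
  \<comment> \<open>Left weights flatten horizontal and steepen vertical increments, so the
    preference of the bulk for the left side of the sub-rectangle passes to \<open>V\<close>; at the
    far corner \<open>G\<close> equals \<open>V\<close> by the exit hypothesis.\<close>
  have incr: "V (Suc i) j + B i j \<le> B (Suc i) j + V i j" "B i (Suc j) + V i j \<le> V i (Suc j) + B i j" for i j
    using LP_incr[of "\<lambda>_. 0" "\<lambda>_. 0" "\<lambda>_. 0" Bd w i j] mB unfolding B_def V_def by (auto simp: mono_def)
  have i1: "B i0 h + V (i0 + i) h \<le> V i0 h + B (i0 + i) h" for i
  proof (induction i)
    case (Suc i) then show ?case using incr(1)[of "i0 + i" h] by simp
  qed simp
  have i2: "V i0 h + B i0 (h + j) \<le> B i0 h + V i0 (h + j)" for j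
  proof (induction j)
    case (Suc j) then show ?case using incr(2)[of i0 "h + j"] by simp
  qed simp
  have "B i0 h + hor V = LP (\<lambda>i. B i0 h + V (i0 + i) h) (\<lambda>_. B i0 h + V i0 h) w' v k"
    unfolding hor_def by (rule LP_shift[symmetric])
  also have "\<dots> \<le> LP (\<lambda>i. V i0 h + B (i0 + i) h) (\<lambda>_. V i0 h + B i0 h) w' v k"
    using i1 by (intro LP_mono_abs) auto
  also have "\<dots> = V i0 h + hor B"
    unfolding hor_def by (rule LP_shift)
  finally have h1: "B i0 h + hor V \<le> V i0 h + hor B" .
  have "V i0 h + ver B = LP (\<lambda>_. V i0 h + B i0 h) (\<lambda>j. V i0 h + B i0 (h + j)) w' v k"
    unfolding ver_def by (rule LP_shift[symmetric])
  also have "\<dots> \<le> LP (\<lambda>_. B i0 h + V i0 h) (\<lambda>j. B i0 h + V i0 (h + j)) w' v k"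
    using i2 by (intro LP_mono_abs) auto
  also have "\<dots> = B i0 h + ver V"
    unfolding ver_def by (rule LP_shift)
  finally have h2: "V i0 h + ver B \<le> B i0 h + ver V" .
  have "hor B \<le> ver B" using bulk sB unfolding ver_def by simp
  then have "hor V \<le> ver V" using h1 h2 by linarith
  then have "V (i0 + v) (h + k) = ver V" using sV by simp
  moreover have "ver V \<le> ver G" unfolding ver_def by (intro LP_mono_abs) (auto simp: G)
  moreover have "G (i0 + v) (h + k) = V (i0 + v) (h + k)" using G exit by simp
  ultimately show ?thesis using sG unfolding hor_def ver_def by linarith
qed

section \<open>Stationarity seen from a sub-rectangle\<close>

lemma row_conservation: "length ws = length xs \<Longrightarrow> J + sum_list (dep J xs ws) = sum_list xs + carry J xs ws"
proof (induction J xs ws rule: dep.induct)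
  case (1 J x xs w ws)
  then have "w + (J - x) + sum_list (dep (w + (J - x)) xs ws) = sum_list xs + carry (w + (J - x)) xs ws" by simp
  then show ?case by simp
qed auto

text \<open>Both sides are the increment between opposite corners, along left and top or along
  bottom and right. It yields the values on the right side (\<open>LP_rights\<close>) from those on
  the top.\<close>

lemma block_conservation:
  "length xs = m \<Longrightarrow> rectangular h m wss \<Longrightarrow> length Js = h \<Longrightarrow>
    sum_list Js + sum_list (tops xs Js wss) = sum_list xs + sum_list (rights xs Js wss)"
proof (induction h arbitrary: xs Js wss)
  case (Suc h)
  obtain J Js' where J: "Js = J # Js'" "length Js' = h" using Suc.prems by (cases Js) auto
  obtain ws wss' where W: "wss = ws # wss'" "length ws = m" "rectangular h m wss'" using Suc.prems by (auto simp: rectangular_Suc_iff)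
  show ?case using Suc.IH[of "dep J xs ws" wss' Js'] row_conservation[of ws xs J] Suc.prems J W by simp
qed simp

lemma rights_take: "rights xs (take j Js) (take j wss) = take j (rights xs Js wss)"
proof (induction xs Js wss arbitrary: j rule: rights.induct)
  case (1 xs J Js ws wss) then show ?case by (cases j) auto
qed auto

lemma LP_rights:
  assumes "length xs = m" "rectangular h m wss" "length Js = h" "j \<le> h"
    "\<And>i. i \<le> m \<Longrightarrow> A i = ps xs i" "\<And>j. j \<le> h \<Longrightarrow> B j = ps Js j" "\<And>i j. i < m \<Longrightarrow> j < h \<Longrightarrow> w i j = wss ! j ! i"
  shows "LP A B w m j = sum_list xs + ps (rights xs Js wss) j"
proof -
  have mt: "rectangular j m (take j wss)" using assms(2,4) by (auto simp: rectangular_def dest: in_set_takeD)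
  have "LP A B w m j = sum_list (take j Js) + ps (tops xs (take j Js) (take j wss)) m"
    using assms mt by (intro LP_tops) auto
  also have "\<dots> = sum_list xs + sum_list (rights xs (take j Js) (take j wss))"
    using block_conservation[OF assms(1) mt, of "take j Js"] length_tops[OF assms(1) mt, of "take j Js"] assms by simp
  finally show ?thesis by (simp add: rights_take)
qed

text \<open>\<open>sub_x\<close> and \<open>sub_J\<close> are the increments that the large system
  induces on the bottom and left sides of the rectangle with corner (i0, h); prefix sums of them are
  its passage times less the corner value.\<close>

definition sub_x :: "nat \<Rightarrow> nat \<Rightarrow> nat list \<Rightarrow> nat list \<Rightarrow> nat list list \<Rightarrow> nat list" where
  "sub_x i0 h xs Js wss = drop i0 (tops xs (take h Js) (take h wss))"

definition sub_J :: "nat \<Rightarrow> nat \<Rightarrow> nat list \<Rightarrow> nat list \<Rightarrow> nat list list \<Rightarrow> nat list" where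
  "sub_J i0 h xs Js wss = rights (take i0 (tops xs (take h Js) (take h wss))) (drop h Js) (map (take i0) (drop h wss))"

definition sub_w :: "nat \<Rightarrow> nat \<Rightarrow> nat list list \<Rightarrow> nat list list" where
  "sub_w i0 h wss = map (drop i0) (drop h wss)"

lemma sub_system:
  assumes xs: "length xs = i0 + v" and W: "rectangular (h + k) (i0 + v) wss" and Js: "length Js = h + k"
  defines "G \<equiv> LP (ps xs) (ps Js) (wt wss)" and "w' \<equiv> \<lambda>i j. wt wss (i0 + i) (h + j)"
  shows "LP (\<lambda>i. G (i0 + i) h) (\<lambda>_. G i0 h) w' v k = G i0 h + sysval (sub_x i0 h xs Js wss) (zeros k) (sub_w i0 h wss)"
    and "LP (\<lambda>_. G i0 h) (\<lambda>j. G i0 (h + j)) w' v k = G i0 h + sysval (zeros v) (sub_J i0 h xs Js wss) (sub_w i0 h wss)"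
    and "length (sub_x i0 h xs Js wss) = v" "length (sub_J i0 h xs Js wss) = k" "rectangular k v (sub_w i0 h wss)"
proof -
  define X where "X = tops xs (take h Js) (take h wss)"
  have m1: "rectangular h (i0 + v) (take h wss)" and m2: "rectangular k (i0 + v) (drop h wss)"
    using W by (auto simp: rectangular_def dest: in_set_takeD in_set_dropD)
  have X: "length X = i0 + v" unfolding X_def using xs m1 Js by (intro length_tops) auto
  have wl: "rectangular k i0 (map (take i0) (drop h wss))" using m2 by (auto simp: rectangular_def)
  show lx: "length (sub_x i0 h xs Js wss) = v" using X by (simp add: sub_x_def X_def)
  show lJ: "length (sub_J i0 h xs Js wss) = k"
    unfolding sub_J_def using wl Js by (intro length_rights) auto
  show lw: "rectangular k v (sub_w i0 h wss)" using m2 by (auto simp: sub_w_def rectangular_def)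
  have len: "length wss = h + k" using W by (simp add: rectangular_def)
  have rowlen: "length (wss ! j) = i0 + v" if "j < h + k" for j using W that by (auto simp: rectangular_def)
  have G1: "G i h = sum_list (take h Js) + ps X i" if "i \<le> i0 + v" for i
    unfolding G_def X_def using that xs m1 Js by (intro LP_tops) (auto simp: min_def)
  have psd: "ps X (i0 + i) = ps X i0 + ps (drop i0 X) i" for i
    by (simp add: take_add)
  have Gx: "G (i0 + i) h = G i0 h + ps (sub_x i0 h xs Js wss) i" if "i \<le> v" for i
    using that G1[of "i0 + i"] G1[of i0] psd[of i] by (simp add: sub_x_def X_def)
  have GJ: "G i0 (h + j) = G i0 h + ps (sub_J i0 h xs Js wss) j" if "j \<le> k" for j
  proof -
    have "G (0 + i0) (h + j) = LP (\<lambda>i. G (0 + i) h) (\<lambda>j. G 0 (h + j)) (\<lambda>i j. wt wss (0 + i) (h + j)) i0 j"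
      unfolding G_def by (rule LP_rebase)
    also have "\<dots> = LP (\<lambda>i. sum_list (take h Js) + ps X i) (\<lambda>j. sum_list (take h Js) + ps (drop h Js) j) (\<lambda>i j. wt wss i (h + j)) i0 j"
      by (rule LP_cong) (auto simp: G1 G1[unfolded G_def] G_def LP_0 take_add)
    also have "\<dots> = sum_list (take h Js) + LP (ps X) (ps (drop h Js)) (\<lambda>i j. wt wss i (h + j)) i0 j"
      by (rule LP_shift)
    also have "LP (ps X) (ps (drop h Js)) (\<lambda>i j. wt wss i (h + j)) i0 j
        = sum_list (take i0 X) + ps (sub_J i0 h xs Js wss) j"
      unfolding sub_J_def X_def[symmetric]
      using X wl Js that len by (intro LP_rights) (auto simp: min_def)
    finally show ?thesis using G1[of i0] by simp
  qed
  have ww: "wt wss (i0 + i) (h + j) = wt (sub_w i0 h wss) i j" if "i < v" "j < k" for i j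
    using that len rowlen by (simp add: sub_w_def)
  have "LP (\<lambda>i. G (i0 + i) h) (\<lambda>_. G i0 h) w' v k
      = LP (\<lambda>i. G i0 h + ps (sub_x i0 h xs Js wss) i) (\<lambda>j. G i0 h + ps (zeros k) j) (wt (sub_w i0 h wss)) v k"
    by (rule LP_cong) (auto simp: Gx w'_def ww)
  also have "\<dots> = G i0 h + LP (ps (sub_x i0 h xs Js wss)) (ps (zeros k)) (wt (sub_w i0 h wss)) v k"
    by (rule LP_shift)
  finally show "LP (\<lambda>i. G (i0 + i) h) (\<lambda>_. G i0 h) w' v k = G i0 h + sysval (sub_x i0 h xs Js wss) (zeros k) (sub_w i0 h wss)"
    using sysval_LP[OF lx lw, of "zeros k"] by simp
  have "LP (\<lambda>_. G i0 h) (\<lambda>j. G i0 (h + j)) w' v k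
      = LP (\<lambda>i. G i0 h + ps (zeros v) i) (\<lambda>j. G i0 h + ps (sub_J i0 h xs Js wss) j) (wt (sub_w i0 h wss)) v k"
    by (rule LP_cong) (auto simp: GJ w'_def ww)
  also have "\<dots> = G i0 h + LP (ps (zeros v)) (ps (sub_J i0 h xs Js wss)) (wt (sub_w i0 h wss)) v k"
    by (rule LP_shift)
  finally show "LP (\<lambda>_. G i0 h) (\<lambda>j. G i0 (h + j)) w' v k = G i0 h + sysval (zeros v) (sub_J i0 h xs Js wss) (sub_w i0 h wss)"
    using sysval_LP[OF _ lw lJ, of "zeros v"] by simp
qed

lemma EE_iidm_cols: "EE (iidm k (m1 + m2) q) f = EE (iidm k m1 q) (\<lambda>A. EE (iidm k m2 q) (\<lambda>B. f (map2 (@) A B)))"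
proof (induction k arbitrary: f)
  case (Suc k)
  have "EE (iidm (Suc k) (m1 + m2) q) f
     = EE (iid m1 q) (\<lambda>a. EE (iid m2 q) (\<lambda>b. EE (iidm k m1 q) (\<lambda>A. EE (iidm k m2 q) (\<lambda>B. f ((a @ b) # map2 (@) A B)))))"
    by (simp add: EE_iid_append Suc)
  also have "\<dots> = EE (iid m1 q) (\<lambda>a. EE (iidm k m1 q) (\<lambda>A. EE (iid m2 q) (\<lambda>b. EE (iidm k m2 q) (\<lambda>B. f ((a @ b) # map2 (@) A B)))))"
    by (subst EE_swap[of "iid m2 q" "iidm k m1 q"]) simp
  finally show ?case by simp
qed simp

text \<open>Burke's property twice: the first \<open>h\<close> rows have i.i.d. outputs on top, and
  in the remaining rows the first \<open>i0\<close> columns have i.i.d. outputs on the right.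
  Neither use touches the weights of the sub-rectangle.\<close>

lemma sub_system_law:
  assumes "0 < a" "a < 1" "0 < b" "b < 1" and q: "q = a * b"
  shows "SE (h + k) (i0 + v) b a q (\<lambda>xs Js wss. f (sub_x i0 h xs Js wss) (sub_J i0 h xs Js wss) (sub_w i0 h wss))
       = SE k v b a q f"
proof -
  define F where "F xs Js wss = f (drop i0 xs) (rights (take i0 xs) Js (map (take i0) wss)) (map (drop i0) wss)" for xs Js wss
  have "SE (h + k) (i0 + v) b a q (\<lambda>xs Js wss. f (sub_x i0 h xs Js wss) (sub_J i0 h xs Js wss) (sub_w i0 h wss))
     = EE (iid h b) (\<lambda>Js1. EE (iid k b) (\<lambda>Js2. EE (iid (i0 + v) a) (\<lambda>xs. EE (iidm h (i0 + v) q) (\<lambda>W1. EE (iidm k (i0 + v) q) (\<lambda>W2.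
         F (tops xs Js1 W1) Js2 W2)))))"
    unfolding SE_def EE_iid_append[of h k]
  proof (intro EE_cong)
    fix Js1 Js2 xs W1 W2
    assume "Js1 \<in> set_pmf (iid h b)" "W1 \<in> set_pmf (iidm h (i0 + v) q)"
    then have "length Js1 = h" "length W1 = h" by (auto dest: set_iid set_iidm simp: rectangular_def)
    then show "f (sub_x i0 h xs (Js1 @ Js2) (W1 @ W2)) (sub_J i0 h xs (Js1 @ Js2) (W1 @ W2)) (sub_w i0 h (W1 @ W2)) = F (tops xs Js1 W1) Js2 W2"
      by (simp add: F_def sub_x_def sub_J_def sub_w_def)
  qed
  also have "\<dots> = EE (iid k b) (\<lambda>Js2. EE (iidm k (i0 + v) q) (\<lambda>W2. EE (iid h b) (\<lambda>Js1. EE (iid (i0 + v) a) (\<lambda>xs. EE (iidm h (i0 + v) q) (\<lambda>W1.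
         F (tops xs Js1 W1) Js2 W2)))))"
    by (subst EE_swap[of "iid h b" "iid k b"], subst EE_swap[of "iidm h (i0 + v) q" "iidm k (i0 + v) q"],
        subst EE_swap[of "iid (i0 + v) a" "iidm k (i0 + v) q"], subst EE_swap[of "iid h b" "iidm k (i0 + v) q"]) simp
  also have "\<dots> = EE (iid k b) (\<lambda>Js2. EE (iidm k (i0 + v) q) (\<lambda>W2. EE (iid h b) (\<lambda>Js1. EE (iid (i0 + v) a) (\<lambda>xs. EE (iidm h (i0 + v) q) (\<lambda>W1.
         F xs Js2 W2)))))"
    unfolding q by (subst burke_block[OF assms(1-4), of _ _ "\<lambda>xs _ _. F xs _ _"]) simp
  also have "\<dots> = EE (iid k b) (\<lambda>Js2. EE (iidm k (i0 + v) q) (\<lambda>W2. EE (iid (i0 + v) a) (\<lambda>xs. F xs Js2 W2)))"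
    by simp
  also have "\<dots> = EE (iid k b) (\<lambda>Js. EE (iidm k i0 q) (\<lambda>A. EE (iidm k v q) (\<lambda>B. EE (iid i0 a) (\<lambda>xl. EE (iid v a) (\<lambda>xr. F (xl @ xr) Js (map2 (@) A B))))))"
    by (simp only: EE_iidm_cols EE_iid_append)
  also have "\<dots> = EE (iid k b) (\<lambda>Js. EE (iidm k i0 q) (\<lambda>A. EE (iidm k v q) (\<lambda>B. EE (iid i0 a) (\<lambda>xl. EE (iid v a) (\<lambda>xr. f xr (rights xl Js A) B)))))"
  proof (intro EE_cong)
    fix Js A B xl xr
    assume "A \<in> set_pmf (iidm k i0 q)" "B \<in> set_pmf (iidm k v q)" "xl \<in> set_pmf (iid i0 a)"
    then have l: "rectangular k i0 A" "rectangular k v B" "length xl = i0" by (auto dest: set_iid set_iidm)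
    have 1: "map (take i0) (map2 (@) A B) = A"
      using l by (intro nth_equalityI) (auto simp: rectangular_def)
    have 2: "map (drop i0) (map2 (@) A B) = B"
      using l by (intro nth_equalityI) (auto simp: rectangular_def)
    show "F (xl @ xr) Js (map2 (@) A B) = f xr (rights xl Js A) B"
      using l by (simp only: F_def 1 2) simp
  qed
  also have "\<dots> = EE (iid v a) (\<lambda>xr. EE (iidm k v q) (\<lambda>B. EE (iid k b) (\<lambda>Js. EE (iid i0 a) (\<lambda>xl. EE (iidm k i0 q) (\<lambda>A. f xr (rights xl Js A) B)))))"
    by (subst EE_swap[of "iid i0 a" "iid v a"], subst EE_swap[of "iidm k v q" "iid v a"], subst EE_swap[of "iidm k i0 q" "iid v a"],
        subst EE_swap[of "iid k b" "iid v a"], subst EE_swap[of "iidm k i0 q" "iidm k v q"], subst EE_swap[of "iid k b" "iidm k v q"],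
        subst EE_swap[of "iidm k i0 q" "iid i0 a"]) simp
  also have "\<dots> = EE (iid v a) (\<lambda>xr. EE (iidm k v q) (\<lambda>B. EE (iid k b) (\<lambda>Js. EE (iid i0 a) (\<lambda>xl. EE (iidm k i0 q) (\<lambda>A. f xr Js B)))))"
    unfolding q by (subst burke_block[OF assms(1-4), of _ _ "\<lambda>_ Js _. f _ Js _"]) simp
  also have "\<dots> = EE (iid v a) (\<lambda>xr. EE (iidm k v q) (\<lambda>B. EE (iid k b) (\<lambda>Js. f xr Js B)))"
    by simp
  also have "\<dots> = SE k v b a q f"
    unfolding SE_def by (subst EE_swap[of "iidm k v q" "iid k b"], subst EE_swap[of "iid v a" "iid k b"]) simp
  finally show ?thesis .
qed

section \<open>Matrices of sites and the exit dichotomy\<close>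

definition grid :: "(nat \<Rightarrow> nat \<Rightarrow> 'a) \<Rightarrow> nat \<Rightarrow> nat \<Rightarrow> 'a list list" where
  "grid g h m = map (\<lambda>j. map (\<lambda>i. g i j) [0..<m]) [0..<h]"

lemma concat_grid: "concat (grid g h m) = map (\<lambda>(j, i). g i j) (List.product [0..<h] [0..<m])"
proof -
  have "concat (map (\<lambda>j. map (\<lambda>i. g i j) ys) xs) = map (\<lambda>(j, i). g i j) (List.product xs ys)" for xs ys
    by (induction xs) auto
  then show ?thesis by (simp add: grid_def)
qed

lemma grid_simps [simp]: "length (grid g h m) = h" "s \<in> set (grid g h m) \<Longrightarrow> length s = m"
  "map (map f) (grid g h m) = grid (\<lambda>i j. f (g i j)) h m"
  by (auto simp: grid_def)

lemma rectangular_grid: "rectangular h m (grid g h m)"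
  by (simp add: rectangular_def)

lemma wt_grid: "i < m \<Longrightarrow> j < h \<Longrightarrow> wt (grid g h m) i j = g i j"
  by (simp add: grid_def)

lemma distinct_concat_grid: "inj_on (\<lambda>(i, j). g i j) ({..<m} \<times> {..<h}) \<Longrightarrow> distinct (concat (grid g h m))"
  unfolding concat_grid by (auto simp: distinct_map distinct_product inj_on_def)

lemma set_concat_grid: "set (concat (grid g h m)) = (\<lambda>(i, j). g i j) ` ({..<m} \<times> {..<h})"
  unfolding concat_grid by force

text \<open>\<open>\<sigma>\<close> will be the identity or \<open>swp\<close>. The environment is
  queried only at distinct sites, so an injection is absorbed into the list of sites and no symmetry
  of \<open>env p\<close> has to be proved.\<close>

abbreviation hit :: "real \<Rightarrow> (site \<Rightarrow> site) \<Rightarrow> nat \<Rightarrow> nat \<Rightarrow> nat \<Rightarrow> (site \<Rightarrow> nat) set" where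
  "hit p \<sigma> n v1 v2 \<equiv> {\<omega> \<in> space (env p). (int v1, int v2) \<in> geo_union (\<omega> \<circ> \<sigma>) (0, 0) (int n, int n)}"

text \<open>Unless the stationary system on the whole square exits horizontally,
  \<open>sub_exit\<close> turns the passage of a geodesic through v into a vertical exit of the
  stationary system on the rectangle between v and 0, whose law is that of
  \<open>sub_system_law\<close>.\<close>

lemma geo_union_exit_bound:
  fixes \<sigma> :: "site \<Rightarrow> site"
  assumes p: "0 < p" "p < 1" and \<sigma>: "inj \<sigma>" and v: "v1 \<le> n" "v2 \<le> n"
    and ab: "0 < a" "a < 1" "0 < b" "b < 1" "1 - p = a * b"
  shows "emeasure (env p) (hit p \<sigma> n v1 v2)
    \<le> hor_exit (Suc n) (Suc n) b a (a * b)
      + ver_exit (Suc v2) v1 b a (a * b)"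
proof -
  define N where "N = Suc n"
  define i0 where "i0 = N - v1"
  define h where "h = n - v2"
  have N: "i0 + v1 = N" "h + Suc v2 = N" using v by (auto simp: N_def i0_def h_def)
  define R where "R A \<longleftrightarrow> LP0 (wt A) N N \<le> LP (\<lambda>_. LP0 (wt A) i0 h) (\<lambda>j. LP0 (wt A) i0 (h + j)) (\<lambda>i j. wt A (i0 + i) (h + j)) v1 (Suc v2)" for A
  define g where "g i j = \<sigma> (int n - int i, int n - int j)" for i j
  have "\<exists>S\<in>sets (env p). hit p \<sigma> n v1 v2 \<subseteq> S \<and>
    emeasure (env p) S = EE (iidm N N (1 - p)) (\<lambda>A. EE (iidm 0 0 (1 - p)) (\<lambda>B. of_bool (R A)))"
  proof (rule env_prob_matrices[OF p, where ss = "grid g N N" and ss' = "[]"])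
    show "distinct (concat (grid g N N) @ concat [])"
      by (auto simp: g_def inj_eq[OF \<sigma>] intro!: distinct_concat_grid inj_onI)
    fix \<omega> assume "(int v1, int v2) \<in> geo_union (\<omega> \<circ> \<sigma>) (0, 0) (int n, int n)"
    note det = geo_union_detour[OF this v]
    define A where "A = map (map \<omega>) (grid g N N)"
    have wA: "wt A i j = bwd n (\<omega> \<circ> \<sigma>) i j" if "i < N" "j < N" for i j
      using that by (simp add: A_def wt_grid bwd_def g_def)
    have L: "LP0 (wt A) i j = LP0 (bwd n (\<omega> \<circ> \<sigma>)) i j" if "i \<le> N" "j \<le> N" for i j
      using that by (intro LP_cong) (auto simp: wA)
    have "LP (\<lambda>_. LP0 (wt A) i0 h) (\<lambda>j. LP0 (wt A) i0 (h + j)) (\<lambda>i j. wt A (i0 + i) (h + j)) v1 (Suc v2)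
      = LP (\<lambda>_. LP0 (bwd n (\<omega> \<circ> \<sigma>)) i0 h) (\<lambda>j. LP0 (bwd n (\<omega> \<circ> \<sigma>)) i0 (h + j)) (\<lambda>i j. bwd n (\<omega> \<circ> \<sigma>) (i0 + i) (h + j)) v1 (Suc v2)"
      using N by (intro LP_cong) (auto intro!: L wA)
    then show "R (map (map \<omega>) (grid g N N))"
      using det unfolding A_def[symmetric] R_def by (simp only: L order_refl) (simp add: i0_def h_def N_def)
  qed auto
  then have "emeasure (env p) (hit p \<sigma> n v1 v2)
     \<le> EE (iidm N N (1 - p)) (\<lambda>A. EE (iidm 0 0 (1 - p)) (\<lambda>B. of_bool (R A)))"
    by (metis (no_types, lifting) emeasure_mono)
  also have "\<dots> = SE N N b a (a * b) (\<lambda>xs Js wss. of_bool (R wss))"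
    by (simp add: SE_def ab)
  also have "\<dots> \<le> SE N N b a (a * b) (\<lambda>xs Js wss. of_bool (sysval (zeros N) Js wss \<le> sysval xs (zeros N) wss)
      + of_bool (sysval (sub_x i0 h xs Js wss) (zeros (Suc v2)) (sub_w i0 h wss) \<le> sysval (zeros v1) (sub_J i0 h xs Js wss) (sub_w i0 h wss)))"
  proof (rule SE_mono)
    fix xs Js :: "nat list" and wss
    assume l: "length xs = N" "length Js = N" "rectangular N N wss"
    have "sysval (sub_x i0 h xs Js wss) (zeros (Suc v2)) (sub_w i0 h wss) \<le> sysval (zeros v1) (sub_J i0 h xs Js wss) (sub_w i0 h wss)"
      if "R wss" "sysval xs (zeros N) wss \<le> sysval (zeros N) Js wss"
    proof -
      have ex: "LP (ps xs) (\<lambda>_. 0) (wt wss) (i0 + v1) (h + Suc v2) \<le> LP (\<lambda>_. 0) (ps Js) (wt wss) (i0 + v1) (h + Suc v2)"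
        using that(2) sysval_LP[OF l(1,3), of "zeros N"] sysval_LP[OF _ l(3,2), of "zeros N"] by (simp only: N) simp
      have bk: "LP0 (wt wss) (i0 + v1) (h + Suc v2) \<le> LP (\<lambda>_. LP0 (wt wss) i0 h) (\<lambda>j. LP0 (wt wss) i0 (h + j)) (\<lambda>i j. wt wss (i0 + i) (h + j)) v1 (Suc v2)"
        using that(1) unfolding R_def N .
      have "G i0 h + sysval (sub_x i0 h xs Js wss) (zeros (Suc v2)) (sub_w i0 h wss)
          \<le> G i0 h + sysval (zeros v1) (sub_J i0 h xs Js wss) (sub_w i0 h wss)"
        if "G = LP (ps xs) (ps Js) (wt wss)" for G
        using sub_exit[of "ps xs" "ps Js", OF mono_ps _ mono_ps _ bk ex] l N
          sub_system(1,2)[of xs i0 v1 h "Suc v2" wss Js] that by simp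
      then show ?thesis by simp
    qed
    then show "of_bool (R wss) \<le> (of_bool (sysval (zeros N) Js wss \<le> sysval xs (zeros N) wss)
      + of_bool (sysval (sub_x i0 h xs Js wss) (zeros (Suc v2)) (sub_w i0 h wss) \<le> sysval (zeros v1) (sub_J i0 h xs Js wss) (sub_w i0 h wss)) :: ennreal)"
      by (cases "sysval xs (zeros N) wss \<le> sysval (zeros N) Js wss") (auto simp: of_bool_def)
  qed
  also have "\<dots> = hor_exit N N b a (a * b)
     + SE (h + Suc v2) (i0 + v1) b a (a * b) (\<lambda>xs Js wss. of_bool (sysval (sub_x i0 h xs Js wss) (zeros (Suc v2)) (sub_w i0 h wss) \<le> sysval (zeros v1) (sub_J i0 h xs Js wss) (sub_w i0 h wss)))"
    by (simp only: SE_add N)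
  also have "SE (h + Suc v2) (i0 + v1) b a (a * b) (\<lambda>xs Js wss. of_bool (sysval (sub_x i0 h xs Js wss) (zeros (Suc v2)) (sub_w i0 h wss) \<le> sysval (zeros v1) (sub_J i0 h xs Js wss) (sub_w i0 h wss)))
     = ver_exit (Suc v2) v1 b a (a * b)"
    by (rule sub_system_law[OF ab(1-4) refl, of h "Suc v2" i0 v1 "\<lambda>xs Js wss. of_bool (sysval xs (zeros (Suc v2)) wss \<le> sysval (zeros v1) Js wss)"])
  finally show ?thesis unfolding N_def .
qed

lemma emeasure_env_le_1: "emeasure (env p) A \<le> 1"
proof -
  interpret prob_space "env p" unfolding env_def by (intro prob_space_PiM prob_space_measure_pmf)
  show ?thesis using measure_le_1 emeasure_le_1 by blast
qed

lemma transversal_bound: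
  assumes p: "0 < p" "p < 1"
  obtains c C where "0 < c" "0 < C"
    "\<And>n v1 v2 \<sigma>. inj \<sigma> \<Longrightarrow> v1 + v2 \<le> n \<Longrightarrow> v2 \<le> v1 \<Longrightarrow> 0 < v1 \<Longrightarrow>
      emeasure (env p) (hit p \<sigma> n v1 v2)
       \<le> ennreal (C * exp (- (c * (real v1 - real v2)^3 / (real v1 + real v2)^2)))"
proof -
  define s where "s = sqrt (1 - p)"
  have s: "0 < s" "s < 1" "s * s = 1 - p" using p by (auto simp: s_def real_sqrt_lt_1_iff)
  obtain c1 \<kappa> \<delta>1 where c1: "0 < c1" "0 < \<kappa>" "0 < \<delta>1" "\<delta>1 \<le> 1" "s * exp (4 * \<delta>1) < 1"
    and near: "\<And>\<delta> h m. 0 < \<delta> \<Longrightarrow> \<delta> \<le> \<delta>1 \<Longrightarrow> real m \<le> real h * (1 + \<kappa> * \<delta>) \<Longrightarrow>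
       hor_exit h m (s * exp (2 * \<delta>)) (s * exp (- (2 * \<delta>))) (s * s)
       \<le> ennreal (3 * exp (- (c1 * \<delta>^3 * h)))"
    and "\<And>\<delta> h m. 0 < \<delta> \<Longrightarrow> \<delta> \<le> \<delta>1 \<Longrightarrow> real h \<le> real m * (1 + \<kappa> * \<delta>) \<Longrightarrow>
       ver_exit h m (s * exp (- (2 * \<delta>))) (s * exp (2 * \<delta>)) (s * s)
       \<le> ennreal (3 * exp (- (c1 * \<delta>^3 * m)))"
    by (rule exit_tail_near[OF s(1,2)]) blast
  obtain K \<delta>2 where K: "0 < K" "0 < \<delta>2" "\<delta>2 \<le> 1" "s * exp (4 * \<delta>2) < 1"
    and far: "\<And>\<delta> h m. 0 < \<delta> \<Longrightarrow> \<delta> \<le> \<delta>2 \<Longrightarrow> real h + K * \<delta> * real m \<le> real m \<Longrightarrow>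
       ver_exit h m (s * exp (2 * \<delta>)) (s * exp (- (2 * \<delta>))) (s * s)
       \<le> ennreal (3 * exp (- (\<delta>^3 * m / 3)))"
    by (rule exit_tail_far[OF s(1,2)]) blast
  define \<kappa>1 where "\<kappa>1 = Min {\<delta>1, \<delta>2, 1 / (2 * K)}"
  have \<kappa>1: "0 < \<kappa>1" "\<kappa>1 \<le> \<delta>1" "\<kappa>1 \<le> \<delta>2" "\<kappa>1 \<le> 1 / (2 * K)" using c1 K by (auto simp: \<kappa>1_def)
  define c where "c = min (c1 * \<kappa>1^3) (\<kappa>1^3 / 6)"
  have c: "0 < c" "c \<le> c1 * \<kappa>1^3" "c \<le> \<kappa>1^3 / 6" using c1 \<kappa>1 by (auto simp: c_def)
  show ?thesis
  proof (rule that[of c "6 * exp c"])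
    fix n v1 v2 :: nat and \<sigma> :: "site \<Rightarrow> site"
    assume \<sigma>: "inj \<sigma>" and v: "v1 + v2 \<le> n" "v2 \<le> v1" "0 < v1"
    define d where "d = real v1 - real v2"
    define r where "r = real v1 + real v2"
    have r: "1 \<le> r" "d \<le> r" "0 \<le> d" using v by (auto simp: d_def r_def)
    define P where "P = emeasure (env p) (hit p \<sigma> n v1 v2)"
    have "P \<le> ennreal (6 * exp c * exp (- (c * d^3 / r^2)))"
    \<comment> \<open>For v1 - v2 \<le> 1 the exponent is at most c, and the constant 6 exp c makes
      the bound trivial. Otherwise d is at least 2, which pays for the extra row in
      \<open>Suc v2\<close>.\<close>
    proof (cases "v1 \<le> Suc v2")
      case True
      then have d1: "d \<le> 1" by (auto simp: d_def)
      have "d^3 \<le> 1 ^ 3" using d1 r by (intro power_mono) auto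
      also have "\<dots> \<le> r^2" using r by simp
      finally have "d^3 / r^2 \<le> 1" using r by simp
      then have "c * (d^3 / r^2) \<le> c * 1" using c by (intro mult_left_mono) auto
      then have "1 \<le> exp c * exp (- (c * d^3 / r^2))" by (simp add: exp_add[symmetric])
      then have "1 \<le> 6 * exp c * exp (- (c * d^3 / r^2))" by linarith
      then have "ennreal 1 \<le> ennreal (6 * exp c * exp (- (c * d^3 / r^2)))" by (rule ennreal_leI)
      moreover have "P \<le> 1" unfolding P_def by (rule emeasure_env_le_1)
      ultimately show ?thesis unfolding ennreal_1 by (rule order_trans[rotated])
    next
      case False
      then have d2: "2 \<le> d" by (auto simp: d_def)
      \<comment> \<open>The largest order of tilt with K\<delta>r \<le> d/2 \<le> d - 1, the shape
        condition of the far bound; then \<delta>^3 r is \<kappa>1^3 d^3 / r^2, the required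
        exponent.\<close>
      define \<delta> where "\<delta> = \<kappa>1 * d / r"
      have \<delta>0: "0 < \<delta>" using \<kappa>1 d2 r by (simp add: \<delta>_def)
      have \<delta>\<kappa>: "\<delta> \<le> \<kappa>1" using \<kappa>1 r by (simp add: \<delta>_def field_simps)
      have lt: "s * exp (2 * \<delta>) < 1"
      proof -
        have "s * exp (2 * \<delta>) \<le> s * exp (4 * \<delta>1)" using s \<delta>\<kappa> \<kappa>1 \<delta>0 by simp
        then show ?thesis using c1 by linarith
      qed
      have a1: "s * exp (- (2 * \<delta>)) < 1"
      proof -
        have "s * exp (- (2 * \<delta>)) \<le> s * 1" using s \<delta>0 by (intro mult_left_mono) auto
        then show ?thesis using s by linarith
      qed
      have ab: "s * exp (- (2 * \<delta>)) * (s * exp (2 * \<delta>)) = s * s" by (simp add: exp_minus field_simps)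
      have "P \<le> hor_exit (Suc n) (Suc n) (s * exp (2 * \<delta>)) (s * exp (- (2 * \<delta>))) (s * s)
        + ver_exit (Suc v2) v1 (s * exp (2 * \<delta>)) (s * exp (- (2 * \<delta>))) (s * s)"
        unfolding P_def
        using geo_union_exit_bound[OF p \<sigma>, of v1 n v2 "s * exp (- (2 * \<delta>))" "s * exp (2 * \<delta>)"] v s lt a1 unfolding ab by simp
      also have "\<dots> \<le> ennreal (3 * exp (- (c1 * \<delta>^3 * Suc n))) + ennreal (3 * exp (- (\<delta>^3 * v1 / 3)))"
      proof (intro add_mono near far)
        have "real (Suc n) * 1 \<le> real (Suc n) * (1 + \<kappa> * \<delta>)" using c1 \<delta>0 by (intro mult_left_mono) auto
        then show "real (Suc n) \<le> real (Suc n) * (1 + \<kappa> * \<delta>)" by (simp only: mult_1_right)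
        have "K * \<delta> * real v1 \<le> K * \<delta> * r" using K \<delta>0 by (intro mult_left_mono) (auto simp: r_def)
        also have "\<dots> = K * \<kappa>1 * d" using r by (simp add: \<delta>_def)
        also have "\<dots> \<le> 1 / 2 * d" using \<kappa>1 K r by (intro mult_right_mono) (auto simp: field_simps)
        finally show "real (Suc v2) + K * \<delta> * real v1 \<le> real v1" using d2 by (simp add: d_def)
      qed (use \<delta>0 \<delta>\<kappa> \<kappa>1 in auto)
      also have "\<dots> \<le> ennreal (3 * exp (- (c * d^3 / r^2))) + ennreal (3 * exp (- (c * d^3 / r^2)))"
      proof (intro add_mono ennreal_leI mult_left_mono)
        have \<delta>3: "\<delta>^3 * r = \<kappa>1^3 * (d^3 / r^2)" using r by (simp add: \<delta>_def power_divide power_mult_distrib power2_eq_square power3_eq_cube)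
        have dr: "0 \<le> d^3 / r^2" using r by simp
        have "c * d^3 / r^2 \<le> c1 * \<kappa>1^3 * (d^3 / r^2)" using mult_right_mono[OF c(2) dr] by simp
        also have "\<dots> = c1 * (\<delta>^3 * r)" by (simp add: \<delta>3)
        also have "\<dots> \<le> c1 * (\<delta>^3 * Suc n)" using c1 \<delta>0 v by (intro mult_left_mono) (auto simp: r_def)
        finally show "exp (- (c1 * \<delta>^3 * Suc n)) \<le> exp (- (c * d^3 / r^2))" by (simp add: mult.assoc)
        have "c * d^3 / r^2 \<le> \<kappa>1^3 / 6 * (d^3 / r^2)" using mult_right_mono[OF c(3) dr] by simp
        also have "\<dots> = (\<kappa>1^3 * (d^3 / r^2)) / 6" by simp
        also have "\<dots> = \<delta>^3 * (r / 2) / 3" by (simp only: \<delta>3[symmetric])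
        also have "\<dots> \<le> \<delta>^3 * v1 / 3" using \<delta>0 v by (intro divide_right_mono mult_left_mono) (auto simp: r_def)
        finally show "exp (- (\<delta>^3 * v1 / 3)) \<le> exp (- (c * d^3 / r^2))" by simp
      qed auto
      also have "\<dots> = ennreal (6 * exp (- (c * d^3 / r^2)))"
        by (simp add: ennreal_plus[symmetric] del: ennreal_plus)
      also have "\<dots> \<le> ennreal (6 * exp c * exp (- (c * d^3 / r^2)))"
        using c by (intro ennreal_leI mult_right_mono) auto
      finally show ?thesis .
    qed
    then show "emeasure (env p) (hit p \<sigma> n v1 v2)
       \<le> ennreal (6 * exp c * exp (- (c * (real v1 - real v2)^3 / (real v1 + real v2)^2)))"
      by (simp add: P_def d_def r_def)
  qed (use c in auto)
qed

section \<open>Localisation at a point\<close>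

lemma EE_replicate_rev: "EE (replicate_pmf l P) (\<lambda>xs. f (rev xs)) = EE (replicate_pmf l P) f"
proof (induction l arbitrary: f)
  case (Suc l)
  have "EE (replicate_pmf (Suc l) P) (\<lambda>xs. f (rev xs)) = EE P (\<lambda>x. EE (replicate_pmf l P) (\<lambda>xs. f (rev xs @ [x])))"
    by simp
  also have "\<dots> = EE P (\<lambda>x. EE (replicate_pmf l P) (\<lambda>xs. f (xs @ [x])))"
    by (simp add: Suc[of "\<lambda>xs. f (xs @ [_])"])
  also have "\<dots> = EE (replicate_pmf l P) (\<lambda>xs. EE P (\<lambda>x. f (xs @ [x])))"
    by (rule EE_swap)
  also have "\<dots> = EE (replicate_pmf (l + 1) P) f"
    by (subst EE_iid_append) simp
  finally show ?case by simp
qed simp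

text \<open>A move to the right along the row gains forward increments \<open>XR\<close> and loses
  the backward increments nearest to v. Those are the last entries of \<open>YL\<close>, hence the
  \<open>rev\<close>; moves to the left exchange the roles.\<close>

definition window :: "nat \<Rightarrow> nat list \<Rightarrow> nat list \<Rightarrow> nat list \<Rightarrow> nat list \<Rightarrow> bool" where
  "window l XL XR YL YR \<longleftrightarrow> (\<forall>k\<le>l. ps XR k \<le> ps (rev YL) k) \<and> (\<forall>k\<le>l. ps YR k \<le> ps (rev XL) k)"

lemma list_all2_ps: "list_all2 (\<le>) xs ys \<Longrightarrow> ps xs k \<le> ps ys k"
proof (induction xs ys arbitrary: k rule: list_all2_induct)
  case (Cons x xs y ys) then show ?case by (cases k) (auto intro: add_mono)
qed simp

lemma list_all2_ps_rev: "list_all2 (\<le>) xs ys \<Longrightarrow> ps (rev xs) k \<le> ps (rev ys) k"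
  by (rule list_all2_ps) (simp add: list_all2_rev)

text \<open>Monotonicity in each pair separately lets \<open>dominate\<close> act on the forward row
  with the backward one frozen, and then on the backward row.\<close>

lemma mono_pair_window1: "mono_pair (\<lambda>XL XR. window l XL XR YL YR)"
  unfolding mono_pair_def window_def by (meson list_all2_ps list_all2_ps_rev order_trans)

lemma mono_pair_window2: "mono_pair (\<lambda>YL YR. window l XL XR YL YR)"
  unfolding mono_pair_def window_def by (meson list_all2_ps list_all2_ps_rev order_trans)

lemma ps_rev_window:
  assumes "length Y \<ge> k + l" "t \<le> l"
  shows "ps Y (k + l) = ps Y (k + l - t) + ps (rev (take l (drop k Y))) t"
proof -
  have "take t (rev (take l (drop k Y))) = rev (drop (l - t) (take l (drop k Y)))"
    using assms by (simp add: take_rev)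
  also have "drop (l - t) (take l (drop k Y)) = take t (drop (k + l - t) Y)"
    using assms by (simp add: drop_take add.commute)
  finally have "ps (rev (take l (drop k Y))) t = sum_list (take t (drop (k + l - t) Y))"
    by (simp add: sum_list_rev)
  moreover have "ps Y (k + l - t + t) = ps Y (k + l - t) + sum_list (take t (drop (k + l - t) Y))"
    by (subst take_add) simp
  ultimately show ?thesis using assms by simp
qed

lemma ps_drop_add: "ps X (c + t) = ps X c + ps (drop c X) t"
  by (simp add: take_add)

text \<open>Forward weights lie in rows up to v2 and backward ones in the rows above, so the two
  increment rows are independent. After two dominations all four lists are independent and
  \<open>window\<close> splits into conditions on disjoint pairs, whence the square.\<close>

lemma up_geo_window:
  fixes \<sigma> :: "site \<Rightarrow> site"
  assumes p: "0 < p" "p < 1" and \<sigma>: "inj \<sigma>" and v: "v1 \<le> n" "v2 < n" and l: "l \<le> v1" "l \<le> n - v1"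
    and \<kappa>: "0 < \<kappa>" "\<kappa> < 1" and ap: "0 < ap" "ap < 1" and bm: "0 < bm" "bm < 1"
    and q: "1 - p = ap * (\<kappa> * bm)" and k: "k = Suc v1 - l" "k' = Suc (n - v1) - l"
  shows "\<exists>S\<in>sets (env p). {\<omega> \<in> space (env p). up_geo n (\<omega> \<circ> \<sigma>) (int v1, int v2)} \<subseteq> S \<and> emeasure (env p) S
    \<le> (EE (iid l (\<kappa> * ap)) (\<lambda>R. EE (iid l ap) (\<lambda>L. of_bool (\<forall>k\<le>l. ps R k \<le> ps L k))))^2
      + (hor_exit (Suc v2) (k + l + l) bm (\<kappa> * ap) (1 - p)
      + ver_exit (Suc v2) k (\<kappa> * bm) ap (1 - p))
      + (hor_exit (n - v2) (k' + l + l) bm (\<kappa> * ap) (1 - p)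
      + ver_exit (n - v2) k' (\<kappa> * bm) ap (1 - p))"
    (is "\<exists>S\<in>_. _ \<and> _ \<le> ?W^2 + ?bX + ?bY")
proof -
  define hX where "hX = Suc v2"
  define hY where "hY = n - v2"
  define mX where "mX = k + l + l"
  define mY where "mY = k' + l + l"
  \<comment> \<open>In both orientations the left window ends exactly at the column of v, whose
    index carries the usual shift by one.\<close>
  have ks: "k + l = Suc v1" "k' + l = Suc (n - v1)" using k l v by auto
  have mXY: "mX \<le> Suc n" "mY \<le> Suc n" using ks l v by (auto simp: mX_def mY_def)
  define X where "X A = tops (zeros mX) (zeros hX) A" for A
  define Y where "Y B = tops (zeros mY) (zeros hY) B" for B
  define XL where "XL A = take l (drop k (X A))" for A
  define XR where "XR A = drop (k + l) (X A)" for A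
  define YL where "YL B = take l (drop k' (Y B))" for B
  define YR where "YR B = drop (k' + l) (Y B)" for B
  define gX where "gX i j = \<sigma> (int i, int j)" for i j
  define gY where "gY i j = \<sigma> (int n - int i, int n - int j)" for i j
  have "\<exists>S\<in>sets (env p). {\<omega> \<in> space (env p). up_geo n (\<omega> \<circ> \<sigma>) (int v1, int v2)} \<subseteq> S \<and> emeasure (env p) S
     = EE (iidm hX mX (1 - p)) (\<lambda>A. EE (iidm hY mY (1 - p)) (\<lambda>B. of_bool (window l (XL A) (XR A) (YL B) (YR B))))"
  proof (rule env_prob_matrices[OF p, where ss = "grid gX hX mX" and ss' = "grid gY hY mY"])
    have "distinct (concat (grid gX hX mX))" "distinct (concat (grid gY hY mY))"
      by (auto simp: gX_def gY_def inj_eq[OF \<sigma>] intro!: distinct_concat_grid inj_onI)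
    moreover have "set (concat (grid gX hX mX)) \<inter> set (concat (grid gY hY mY)) = {}"
      unfolding set_concat_grid by (auto simp: gX_def gY_def inj_eq[OF \<sigma>] hX_def hY_def)
    ultimately show "distinct (concat (grid gX hX mX) @ concat (grid gY hY mY))" by simp
    fix \<omega> assume "up_geo n (\<omega> \<circ> \<sigma>) (int v1, int v2)"
    note ineq = up_geo_inequality[OF this v]
    define A where "A = map (map \<omega>) (grid gX hX mX)"
    define B where "B = map (map \<omega>) (grid gY hY mY)"
    have A: "rectangular hX mX A" "rectangular hY mY B" by (auto simp: A_def B_def rectangular_grid)
    have lX: "length (X A) = mX" unfolding X_def by (rule length_tops) (auto simp: A)
    have lY: "length (Y B) = mY" unfolding Y_def by (rule length_tops) (auto simp: A)
    have LX: "LP0 (fwd (\<omega> \<circ> \<sigma>)) i hX = ps (X A) i" if "i \<le> mX" for i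
    proof -
      have "LP0 (fwd (\<omega> \<circ> \<sigma>)) i hX = sum_list (zeros hX) + ps (tops (zeros mX) (zeros hX) A) i"
        by (rule LP_tops[of _ mX]) (use that A in \<open>auto simp: A_def wt_grid fwd_def gX_def\<close>)
      then show ?thesis by (simp add: X_def)
    qed
    have LY: "LP0 (bwd n (\<omega> \<circ> \<sigma>)) i hY = ps (Y B) i" if "i \<le> mY" for i
    proof -
      have "LP0 (bwd n (\<omega> \<circ> \<sigma>)) i hY = sum_list (zeros hY) + ps (tops (zeros mY) (zeros hY) B) i"
        by (rule LP_tops[of _ mY]) (use that A in \<open>auto simp: B_def wt_grid bwd_def gY_def\<close>)
      then show ?thesis by (simp add: Y_def)
    qed
    have cmp: "ps (X A) (Suc i) + ps (Y B) (Suc (n - i)) \<le> ps (X A) (k + l) + ps (Y B) (k' + l)"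
      if "i \<le> n" "Suc i \<le> mX" "Suc (n - i) \<le> mY" for i
      using ineq[OF that(1)] LX[OF that(2)] LY[OF that(3)] LX[of "k + l"] LY[of "k' + l"]
      by (simp add: ks[symmetric] hX_def hY_def mX_def mY_def del: LP.simps)
    have "ps (XR A) t \<le> ps (rev (YL B)) t" if t: "t \<le> l" for t
    proof -
      have "ps (X A) (k + l + t) + ps (Y B) (k' + l - t) \<le> ps (X A) (k + l) + ps (Y B) (k' + l)"
        using cmp[of "v1 + t"] t l v ks by (simp add: mX_def mY_def Suc_diff_le)
      moreover have "ps (Y B) (k' + l) = ps (Y B) (k' + l - t) + ps (rev (YL B)) t"
        unfolding YL_def using t by (intro ps_rev_window) (auto simp: lY mY_def)
      ultimately show ?thesis using ps_drop_add[of "k + l" t "X A"] by (simp add: XR_def)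
    qed
    moreover have "ps (YR B) t \<le> ps (rev (XL A)) t" if t: "t \<le> l" for t
    proof -
      have "Suc (n - (v1 - t)) = k' + l + t" "Suc (v1 - t) = k + l - t" using t l v ks by auto
      then have "ps (X A) (k + l - t) + ps (Y B) (k' + l + t) \<le> ps (X A) (k + l) + ps (Y B) (k' + l)"
        using cmp[of "v1 - t"] t l v by (simp add: mX_def mY_def)
      moreover have "ps (X A) (k + l) = ps (X A) (k + l - t) + ps (rev (XL A)) t"
        unfolding XL_def using t by (intro ps_rev_window) (auto simp: lX mX_def)
      ultimately show ?thesis using ps_drop_add[of "k' + l" t "Y B"] by (simp add: YR_def)
    qed
    ultimately show "window l (XL (map (map \<omega>) (grid gX hX mX))) (XR (map (map \<omega>) (grid gX hX mX)))
        (YL (map (map \<omega>) (grid gY hY mY))) (YR (map (map \<omega>) (grid gY hY mY)))"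
      unfolding window_def A_def B_def by blast
  qed auto
  then obtain S where S: "S \<in> sets (env p)" "{\<omega> \<in> space (env p). up_geo n (\<omega> \<circ> \<sigma>) (int v1, int v2)} \<subseteq> S" and
    "emeasure (env p) S = EE (iidm hX mX (1 - p)) (\<lambda>A. EE (iidm hY mY (1 - p)) (\<lambda>B. of_bool (window l (XL A) (XR A) (YL B) (YR B))))"
    by blast
  note this(3)
  also have "\<dots> = EE (iidm hY mY (1 - p)) (\<lambda>B. EE (iidm hX mX (1 - p)) (\<lambda>A. of_bool (window l (XL A) (XR A) (YL B) (YR B))))"
    by (rule EE_swap)
  also have "\<dots> \<le> EE (iidm hY mY (1 - p)) (\<lambda>B. EE (iid l ap) (\<lambda>L. EE (iid l (\<kappa> * ap)) (\<lambda>R. of_bool (window l L R (YL B) (YR B)))) + ?bX)"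
    using dominate[OF \<kappa> ap bm q mono_pair_window1, of hX k l]
    by (intro EE_mono) (simp add: XL_def XR_def X_def mX_def hX_def add.assoc)
  also have "\<dots> = EE (iid l ap) (\<lambda>L. EE (iid l (\<kappa> * ap)) (\<lambda>R. EE (iidm hY mY (1 - p)) (\<lambda>B. of_bool (window l L R (YL B) (YR B))))) + ?bX"
    unfolding EE_add EE_const
    by (subst EE_swap[of "iidm hY mY (1 - p)"], subst EE_swap[of "iidm hY mY (1 - p)"]) simp
  also have "\<dots> \<le> EE (iid l ap) (\<lambda>L. EE (iid l (\<kappa> * ap)) (\<lambda>R. EE (iid l ap) (\<lambda>L'. EE (iid l (\<kappa> * ap)) (\<lambda>R'. of_bool (window l L R L' R'))) + ?bY)) + ?bX"
    using dominate[OF \<kappa> ap bm q mono_pair_window2, of hY k' l]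
    by (intro EE_mono add_mono order_refl) (simp add: YL_def YR_def Y_def mY_def hY_def add.assoc)
  also have "\<dots> = EE (iid l ap) (\<lambda>L. EE (iid l (\<kappa> * ap)) (\<lambda>R. EE (iid l ap) (\<lambda>L'. EE (iid l (\<kappa> * ap)) (\<lambda>R'. of_bool (window l L R L' R'))))) + ?bX + ?bY"
    by (simp only: EE_add EE_const ac_simps)
  also have "EE (iid l ap) (\<lambda>L. EE (iid l (\<kappa> * ap)) (\<lambda>R. EE (iid l ap) (\<lambda>L'. EE (iid l (\<kappa> * ap)) (\<lambda>R'. of_bool (window l L R L' R'))))) = ?W^2"
  proof -
    define f where "f R L = (of_bool (\<forall>k\<le>l. ps R k \<le> ps L k) :: ennreal)" for R L
    have W: "EE (iid l (\<kappa> * ap)) (\<lambda>R. EE (iid l ap) (\<lambda>L. f R (rev L))) = ?W"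
      unfolding f_def using EE_replicate_rev[of l "geo ap" "\<lambda>L. of_bool (\<forall>k\<le>l. ps _ k \<le> ps L k)"] by simp
    have "EE (iid l ap) (\<lambda>L. EE (iid l (\<kappa> * ap)) (\<lambda>R. EE (iid l ap) (\<lambda>L'. EE (iid l (\<kappa> * ap)) (\<lambda>R'. of_bool (window l L R L' R')))))
      = EE (iid l ap) (\<lambda>L. EE (iid l (\<kappa> * ap)) (\<lambda>R. EE (iid l ap) (\<lambda>L'. EE (iid l (\<kappa> * ap)) (\<lambda>R'. f R (rev L') * f R' (rev L)))))"
      by (simp add: window_def f_def of_bool_conj)
    also have "\<dots> = EE (iid l ap) (\<lambda>L. EE (iid l (\<kappa> * ap)) (\<lambda>R. EE (iid l ap) (\<lambda>L'. f R (rev L')) * EE (iid l (\<kappa> * ap)) (\<lambda>R'. f R' (rev L))))"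
      by (simp only: EE_cmult EE_multc)
    also have "\<dots> = EE (iid l ap) (\<lambda>L. ?W * EE (iid l (\<kappa> * ap)) (\<lambda>R'. f R' (rev L)))"
      by (simp only: EE_multc W)
    also have "\<dots> = ?W * EE (iid l (\<kappa> * ap)) (\<lambda>R'. EE (iid l ap) (\<lambda>L. f R' (rev L)))"
      by (simp only: EE_cmult EE_swap[of "iid l ap" "iid l (\<kappa> * ap)"])
    finally show ?thesis by (simp only: W power2_eq_square)
  qed
  finally have "emeasure (env p) S \<le> ?W^2 + ?bX + ?bY" by (simp only: ac_simps)
  then show ?thesis using S by blast
qed

section \<open>Choice of tilt and window, and assembly of the bounds\<close>

lemma near_diagonal_bound:
  assumes p: "0 < p" "p < 1"
  obtains \<theta> \<delta>0 c C where "0 < \<theta>" "0 < \<delta>0" "0 < c" "0 < C"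
    "\<And>\<delta> n v1 v2 \<sigma>. inj \<sigma> \<Longrightarrow> 0 < \<delta> \<Longrightarrow> \<delta> \<le> \<delta>0 \<Longrightarrow> v1 + v2 \<le> n \<Longrightarrow>
      \<bar>real v1 - real v2\<bar> \<le> \<theta> * \<delta> * real (v1 + v2) \<Longrightarrow> 2 \<le> \<theta> * \<delta>^3 * real (v1 + v2) \<Longrightarrow>
      \<exists>S\<in>sets (env p). {\<omega> \<in> space (env p). up_geo n (\<omega> \<circ> \<sigma>) (int v1, int v2)} \<subseteq> S \<and>
       emeasure (env p) S \<le> ennreal (C * \<delta>^2 + 12 * exp (- (c * \<delta>^3 * real (v1 + v2))))"
proof -
  define s where "s = sqrt (1 - p)"
  have s: "0 < s" "s < 1" "s * s = 1 - p" using p by (auto simp: s_def real_sqrt_lt_1_iff)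
  obtain c1 \<kappa> \<delta>1 where c1: "0 < c1" "0 < \<kappa>" "0 < \<delta>1" "\<delta>1 \<le> 1" "s * exp (4 * \<delta>1) < 1"
    and hor: "\<And>\<delta> h m. 0 < \<delta> \<Longrightarrow> \<delta> \<le> \<delta>1 \<Longrightarrow> real m \<le> real h * (1 + \<kappa> * \<delta>) \<Longrightarrow>
       hor_exit h m (s * exp (2 * \<delta>)) (s * exp (- (2 * \<delta>))) (s * s)
       \<le> ennreal (3 * exp (- (c1 * \<delta>^3 * h)))"
    and ver: "\<And>\<delta> h m. 0 < \<delta> \<Longrightarrow> \<delta> \<le> \<delta>1 \<Longrightarrow> real h \<le> real m * (1 + \<kappa> * \<delta>) \<Longrightarrow>
       ver_exit h m (s * exp (- (2 * \<delta>))) (s * exp (2 * \<delta>)) (s * s)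
       \<le> ennreal (3 * exp (- (c1 * \<delta>^3 * m)))"
    by (rule exit_tail_near[OF s(1,2)]) blast
  \<comment> \<open>With E = \<theta>\<delta>r, the offset of v from the diagonal and the window
    length are at most E, so the sides of each rectangle differ by at most 3E. The bound 12\<theta>
    \<le> \<kappa> fits this into the slack \<kappa>\<delta> for a side of length at least r/4, and
    \<theta> \<le> 1/6 keeps E below r/6.\<close>
  define \<theta> where "\<theta> = min (1/6) (\<kappa> / 12)"
  have \<theta>: "0 < \<theta>" "\<theta> \<le> 1/6" "12 * \<theta> \<le> \<kappa>" using c1 by (auto simp: \<theta>_def)
  \<comment> \<open>Z\<delta> will be the \<zeta> of \<open>walk_bound\<close>. The 16 covers the
    drift, as b = a exp (4\<delta>) exceeds a by at most 8\<delta>a; the other summand covers the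
    condition on the window length.\<close>
  define Z where "Z = 16 + 4 / (s * exp (- 1))"
  have Z: "16 \<le> Z" "4 \<le> s * exp (- 1) * Z" using s by (auto simp: Z_def field_simps)
  define \<delta>0 where "\<delta>0 = Min {\<delta>1, 1/4, 1 / Z, (1 - s) / (2 * s * Z)}"
  have \<delta>0: "0 < \<delta>0" "\<delta>0 \<le> \<delta>1" "\<delta>0 \<le> 1/4" "\<delta>0 \<le> 1 / Z" "\<delta>0 \<le> (1 - s) / (2 * s * Z)"
    using c1 Z s unfolding \<delta>0_def by auto
  define C where "C = (2 * Z / (1 - s))^2"
  show ?thesis
  proof (rule that[of \<theta> \<delta>0 "c1 / 4" C])
    fix \<delta> :: real and n v1 v2 :: nat and \<sigma> :: "site \<Rightarrow> site"
    assume \<sigma>: "inj \<sigma>" and \<delta>: "0 < \<delta>" "\<delta> \<le> \<delta>0" and vn: "v1 + v2 \<le> n"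
      and diag: "\<bar>real v1 - real v2\<bar> \<le> \<theta> * \<delta> * real (v1 + v2)" and big: "2 \<le> \<theta> * \<delta>^3 * real (v1 + v2)"
    define r where "r = real (v1 + v2)"
    define E where "E = \<theta> * \<delta> * r"
    have \<delta>1: "\<delta> \<le> \<delta>1" "\<delta> \<le> 1/4" "\<delta> \<le> 1 / Z" "\<delta> \<le> (1 - s) / (2 * s * Z)" using \<delta> \<delta>0 by auto
    have r0: "0 \<le> r" by (simp add: r_def)
    have E6: "E \<le> r / 6"
    proof -
      have "\<theta> * \<delta> \<le> 1/6 * 1" using \<theta> \<delta> \<delta>1 by (intro mult_mono) auto
      then show ?thesis using mult_right_mono[of "\<theta> * \<delta>" "1/6" r] r0 by (simp add: E_def)
    qed
    have El: "2 / \<delta>^2 \<le> E"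
    proof -
      have "2 / \<delta>^2 \<le> \<theta> * \<delta>^3 * r / \<delta>^2" using big by (intro divide_right_mono) (auto simp: r_def)
      also have "\<dots> = E" using \<delta> by (simp add: E_def power2_eq_square power3_eq_cube)
      finally show ?thesis .
    qed
    have \<delta>2: "1 \<le> 1 / \<delta>^2"
    proof -
      have "\<delta>^2 \<le> 1" using \<delta> \<delta>1 by (intro power_le_one) auto
      then show ?thesis using \<delta> by simp
    qed
    have E2: "2 \<le> E" using El \<delta>2 by linarith
    \<comment> \<open>About \<delta>^-2 steps, the time scale of a walk with drift of order
      \<delta>; the assumption 2 \<le> \<theta>\<delta>^3 r keeps this below E.\<close>
    define l where "l = nat \<lceil>1 / \<delta>^2\<rceil>"
    have l: "1 / \<delta>^2 \<le> real l" "real l \<le> E"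
    proof -
      show "1 / \<delta>^2 \<le> real l" unfolding l_def by linarith
      have "real l \<le> 1 / \<delta>^2 + 1" unfolding l_def using \<delta>2 by linarith
      then show "real l \<le> E" using El \<delta>2 by linarith
    qed
    have d: "real v1 - real v2 \<le> E" "real v2 - real v1 \<le> E" using diag by (auto simp: E_def r_def)
    have rv: "real v1 + real v2 = r" "r \<le> real n" using vn by (auto simp: r_def)
    have v1: "r \<le> 4 * real v1" "r \<le> 4 * real v2" "real v1 \<le> real n - r / 4" "real v2 \<le> real n - r / 4" "real v1 - real l \<ge> r / 4" "real n - real v1 - real l \<ge> r / 4"
      using d rv E6 l(2) r0 by linarith+
    have lv: "l \<le> v1" "l \<le> n - v1" "v1 \<le> n" "v2 < n"
    proof -
      show "l \<le> v1" using v1(5) r0 by linarith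
      show "v1 \<le> n" using v1(3) r0 by linarith
      then show "l \<le> n - v1" using v1(6) r0 by linarith
      show "v2 < n" using v1(4) E2 E6 by linarith
    qed
    define k where "k = Suc v1 - l"
    define k' where "k' = Suc (n - v1) - l"
    have rk: "real k = real v1 + 1 - real l" "real k' = real n - real v1 + 1 - real l" "real (n - v2) = real n - real v2"
      using lv by (auto simp: k_def k'_def of_nat_diff)
    have sz: "real (k + l + l) \<le> real (Suc v2) + 3 * E" "r / 4 \<le> real (Suc v2)"
        "real (Suc v2) \<le> real k + 3 * E" "r / 4 \<le> real k"
        "real (k' + l + l) \<le> real (n - v2) + 3 * E" "r / 4 \<le> real (n - v2)"
        "real (n - v2) \<le> real k' + 3 * E" "r / 4 \<le> real k'"
      unfolding of_nat_add of_nat_Suc rk using d l v1 E2 by linarith+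
    have room: "y \<le> x * (1 + \<kappa> * \<delta>)" if "y \<le> x + 3 * E" "r / 4 \<le> x" for x y
    proof -
      have "12 * \<theta> * (\<delta> * r) \<le> \<kappa> * (\<delta> * r)" using \<theta> \<delta> r0 by (intro mult_right_mono) auto
      then have "3 * E \<le> \<kappa> * \<delta> * (r / 4)" by (simp add: E_def algebra_simps)
      also have "\<dots> \<le> \<kappa> * \<delta> * x" using that c1 \<delta> by (intro mult_left_mono) auto
      finally show ?thesis using that by (simp add: algebra_simps)
    qed
    have expo: "ennreal (3 * exp (- (c1 * \<delta>^3 * h))) \<le> ennreal (3 * exp (- (c1 / 4 * \<delta>^3 * r)))" if "r / 4 \<le> h" for h
    proof -
      have "c1 * \<delta>^3 * (r / 4) \<le> c1 * \<delta>^3 * h" using that c1 \<delta> by (intro mult_left_mono) auto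
      then show ?thesis by (intro ennreal_leI) simp
    qed
    define x where "x = ennreal (3 * exp (- (c1 / 4 * \<delta>^3 * r)))"
    define a where "a = s * exp (- (2 * \<delta>))"
    define b where "b = s * exp (2 * \<delta>)"
    have b: "0 < b" "b < 1"
    proof -
      have "s * exp (2 * \<delta>) \<le> s * exp (4 * \<delta>1)" using s \<delta> \<delta>1 by simp
      then show "b < 1" using c1 by (simp add: b_def)
    qed (use s in \<open>simp add: b_def\<close>)
    have a: "0 < a" "a \<le> s" "s * exp (- 1) \<le> a"
    proof -
      have "s * exp (- (2 * \<delta>)) \<le> s * 1" using s \<delta> by (intro mult_left_mono) auto
      then show "a \<le> s" by (simp add: a_def)
      show "s * exp (- 1) \<le> a" using s \<delta>1 unfolding a_def by simp
    qed (use s in \<open>simp add: a_def\<close>)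
    \<comment> \<open>\<open>up_geo_window\<close> is applied with \<open>ap\<close> and
      \<open>bm\<close> both equal to \<open>b\<close> and ratio exp (-4\<delta>): the lower system
      then has bottom \<open>a\<close> and left \<open>b\<close>, the upper one the reverse.\<close>
    have ka: "exp (- (4 * \<delta>)) * b = a" by (simp add: a_def b_def mult.left_commute flip: exp_add)
    have q: "1 - p = b * (exp (- (4 * \<delta>)) * b)" unfolding ka by (simp add: a_def b_def exp_minus field_simps flip: s(3))
    have wk: "a < 1" "a \<le> b" "Z * \<delta> \<le> 1" "a * (1 + Z * \<delta>) < 1" "2 * (b - a) \<le> a * (Z * \<delta>)" "4 \<le> a * (Z * \<delta>)^2 * real l"
    proof -
      show "a < 1" using a s by simp
      show "a \<le> b" using s \<delta> by (simp add: a_def b_def)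
      show "Z * \<delta> \<le> 1" using \<delta>1(3) Z by (simp add: field_simps)
      have Z\<delta>: "s * (Z * \<delta>) \<le> (1 - s) / 2" using \<delta>1(4) Z s by (simp add: field_simps)
      have "a * (1 + Z * \<delta>) \<le> s * (1 + Z * \<delta>)" using a Z \<delta> by (intro mult_right_mono) auto
      also have "\<dots> = s + s * (Z * \<delta>)" by (simp add: algebra_simps)
      also have "\<dots> \<le> s + (1 - s) / 2" using Z\<delta> by (rule add_left_mono)
      also have "\<dots> < 1" using s(2) by (simp add: field_simps)
      finally show "a * (1 + Z * \<delta>) < 1" .
      have "exp (4 * \<delta>) \<le> 1 + 4 * \<delta> + (4 * \<delta>)^2" using \<delta> \<delta>1 by (intro exp_bound) auto
      also have "(4 * \<delta>)^2 \<le> 4 * \<delta>" using \<delta> \<delta>1 by (simp add: power2_eq_square)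
      finally have e: "exp (4 * \<delta>) - 1 \<le> 8 * \<delta>" by simp
      have "b = a * exp (4 * \<delta>)" by (simp add: a_def b_def mult.assoc flip: exp_add)
      then have "2 * (b - a) = a * (2 * (exp (4 * \<delta>) - 1))" by (simp add: algebra_simps)
      also have "\<dots> \<le> a * (Z * \<delta>)"
      proof (intro mult_left_mono)
        have "16 * \<delta> \<le> Z * \<delta>" using Z \<delta> by (intro mult_right_mono) auto
        then show "2 * (exp (4 * \<delta>) - 1) \<le> Z * \<delta>" using e by argo
      qed (use a in auto)
      finally show "2 * (b - a) \<le> a * (Z * \<delta>)" .
      have "4 \<le> s * exp (- 1) * Z" by (rule Z)
      also have "\<dots> \<le> a * Z" using a Z by (intro mult_right_mono) auto
      also have "\<dots> \<le> a * Z * Z" using mult_left_mono[of 1 Z "a * Z"] a Z by simp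
      also have "\<dots> = a * (Z * \<delta>)^2 * (1 / \<delta>^2)" using \<delta> by (simp add: power2_eq_square)
      also have "\<dots> \<le> a * (Z * \<delta>)^2 * real l" using l a by (intro mult_left_mono) auto
      finally show "4 \<le> a * (Z * \<delta>)^2 * real l" .
    qed
    define W where "W = EE (iid l a) (\<lambda>R. EE (iid l b) (\<lambda>L. of_bool (\<forall>k\<le>l. ps R k \<le> ps L k)))"
    have "\<exists>S\<in>sets (env p). {\<omega> \<in> space (env p). up_geo n (\<omega> \<circ> \<sigma>) (int v1, int v2)} \<subseteq> S \<and> emeasure (env p) S
      \<le> W^2 + (hor_exit (Suc v2) (k + l + l) b a (s * s)
      + ver_exit (Suc v2) k a b (s * s))
      + (hor_exit (n - v2) (k' + l + l) b a (s * s)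
      + ver_exit (n - v2) k' a b (s * s))"
      using up_geo_window[OF p \<sigma> lv(3,4) lv(1,2) _ _ b b q k_def k'_def] \<delta> unfolding ka W_def s(3) by simp
    then obtain S where S: "S \<in> sets (env p)" "{\<omega> \<in> space (env p). up_geo n (\<omega> \<circ> \<sigma>) (int v1, int v2)} \<subseteq> S" and
      "emeasure (env p) S
      \<le> W^2 + (hor_exit (Suc v2) (k + l + l) b a (s * s)
      + ver_exit (Suc v2) k a b (s * s))
      + (hor_exit (n - v2) (k' + l + l) b a (s * s)
      + ver_exit (n - v2) k' a b (s * s))"
      by blast
    note this(3)
    also have "W^2 + (hor_exit (Suc v2) (k + l + l) b a (s * s)
      + ver_exit (Suc v2) k a b (s * s))
      + (hor_exit (n - v2) (k' + l + l) b a (s * s)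
      + ver_exit (n - v2) k' a b (s * s))
      \<le> (ennreal (2 * (Z * \<delta>) / (1 - a)))^2 + (x + x) + (x + x)"
    proof (intro add_mono)
      show "W^2 \<le> (ennreal (2 * (Z * \<delta>) / (1 - a)))^2"
      proof (intro power_mono)
        show "W \<le> ennreal (2 * (Z * \<delta>) / (1 - a))"
          unfolding W_def
        proof (rule walk_bound)
          show "a < 1" "a \<le> b" "Z * \<delta> \<le> 1" "a * (1 + Z * \<delta>) < 1" "2 * (b - a) \<le> a * (Z * \<delta>)" "4 \<le> a * (Z * \<delta>)^2 * real l"
            by (fact wk)+
        qed (use a b Z \<delta> in auto)
      qed simp
    next
      show "hor_exit (Suc v2) (k + l + l) b a (s * s) \<le> x"
        unfolding x_def a_def b_def
        by (rule order_trans[OF hor[OF \<delta>(1) \<delta>1(1) room[OF sz(1) sz(2)]] expo[OF sz(2)]])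
      show "ver_exit (Suc v2) k a b (s * s) \<le> x"
        unfolding x_def a_def b_def
        by (rule order_trans[OF ver[OF \<delta>(1) \<delta>1(1) room[OF sz(3) sz(4)]] expo[OF sz(4)]])
      show "hor_exit (n - v2) (k' + l + l) b a (s * s) \<le> x"
        unfolding x_def a_def b_def
        by (rule order_trans[OF hor[OF \<delta>(1) \<delta>1(1) room[OF sz(5) sz(6)]] expo[OF sz(6)]])
      show "ver_exit (n - v2) k' a b (s * s) \<le> x"
        unfolding x_def a_def b_def
        by (rule order_trans[OF ver[OF \<delta>(1) \<delta>1(1) room[OF sz(7) sz(8)]] expo[OF sz(8)]])
    qed
    also have "\<dots> \<le> ennreal (C * \<delta>^2) + (x + x) + (x + x)"
    proof (intro add_mono order_refl)
      have "(2 * (Z * \<delta>) / (1 - a))^2 \<le> (2 * (Z * \<delta>) / (1 - s))^2"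
        using a s Z \<delta> by (intro power_mono divide_left_mono) auto
      also have "\<dots> = C * \<delta>^2" by (simp add: C_def power_mult_distrib power_divide)
      finally show "(ennreal (2 * (Z * \<delta>) / (1 - a)))^2 \<le> ennreal (C * \<delta>^2)"
        using a s Z \<delta> by (subst ennreal_power) (auto intro!: ennreal_leI)
    qed
    also have "\<dots> = ennreal (C * \<delta>^2 + 12 * exp (- (c1 / 4 * \<delta>^3 * r)))"
      unfolding x_def by (simp add: C_def ennreal_plus[symmetric] del: ennreal_plus)
    finally show "\<exists>S\<in>sets (env p). {\<omega> \<in> space (env p). up_geo n (\<omega> \<circ> \<sigma>) (int v1, int v2)} \<subseteq> S \<and>
       emeasure (env p) S \<le> ennreal (C * \<delta>^2 + 12 * exp (- (c1 / 4 * \<delta>^3 * real (v1 + v2))))"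
      using S unfolding r_def by blast
  qed (use \<theta> \<delta>0 c1 s Z in \<open>auto simp: C_def\<close>)
qed

lemma inj_swp: "inj swp"
  by (rule inj_on_inverseI[of _ swp]) simp

lemma geo_union_swp_iff:
  "(int v1, int v2) \<in> geo_union \<omega> (0, 0) (int n, int n) \<longleftrightarrow> (int v2, int v1) \<in> geo_union (\<omega> \<circ> swp) (0, 0) (int n, int n)"
proof -
  have "\<omega> \<circ> swp \<circ> swp = \<omega>" by (auto simp: o_def)
  then show ?thesis
    using geo_union_swp[of "(int v1, int v2)" \<omega> n] geo_union_swp[of "(int v2, int v1)" "\<omega> \<circ> swp" n]
    by (auto simp: swp_def)
qed

lemma transversal_bound_abs:
  assumes p: "0 < p" "p < 1"
  obtains c C where "0 < c" "0 < C"
    "\<And>n v1 v2 :: nat. v1 + v2 \<le> n \<Longrightarrow> 0 < v1 + v2 \<Longrightarrow>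
      emeasure (env p) {\<omega> \<in> space (env p). (int v1, int v2) \<in> geo_union \<omega> (0, 0) (int n, int n)}
       \<le> ennreal (C * exp (- (c * \<bar>real v2 - real v1\<bar>^3 / (real (v1 + v2))^2)))"
proof -
  obtain c C where c: "0 < c" "0 < C" and b: "\<And>n v1 v2 \<sigma>. inj \<sigma> \<Longrightarrow> v1 + v2 \<le> n \<Longrightarrow> v2 \<le> v1 \<Longrightarrow> 0 < v1 \<Longrightarrow>
      emeasure (env p) (hit p \<sigma> n v1 v2)
       \<le> ennreal (C * exp (- (c * (real v1 - real v2)^3 / (real v1 + real v2)^2)))"
    by (rule transversal_bound[OF p]) blast
  show ?thesis
  proof (rule that[OF c])
    fix n v1 v2 :: nat assume v: "v1 + v2 \<le> n" "0 < v1 + v2"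
    show "emeasure (env p) {\<omega> \<in> space (env p). (int v1, int v2) \<in> geo_union \<omega> (0, 0) (int n, int n)}
       \<le> ennreal (C * exp (- (c * \<bar>real v2 - real v1\<bar>^3 / (real (v1 + v2))^2)))"
    proof (cases "v2 \<le> v1")
      case True
      then show ?thesis using b[of id v1 v2 n] v by (simp add: abs_of_nonpos)
    next
      case False
      then show ?thesis using b[of swp v2 v1 n] v inj_swp unfolding geo_union_swp_iff[of v1 v2]
        by (simp add: abs_of_nonneg add.commute)
    qed
  qed
qed

lemma localisation_bound:
  assumes p: "0 < p" "p < 1"
  obtains C where "0 < C"
    "\<And>n v1 v2 :: nat. v1 + v2 \<le> n \<Longrightarrow> 2 \<le> v1 + v2 \<Longrightarrow>
      emeasure (env p) {\<omega> \<in> space (env p). (int v1, int v2) \<in> geo_union \<omega> (0, 0) (int n, int n)}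
       \<le> ennreal (C * (ln (real (v1 + v2)) / real (v1 + v2)) powr (2/3))"
proof -
  obtain ct Ct where ct: "0 < ct" "0 < Ct" and far: "\<And>n v1 v2 :: nat. v1 + v2 \<le> n \<Longrightarrow> 0 < v1 + v2 \<Longrightarrow>
      emeasure (env p) {\<omega> \<in> space (env p). (int v1, int v2) \<in> geo_union \<omega> (0, 0) (int n, int n)}
       \<le> ennreal (Ct * exp (- (ct * \<bar>real v2 - real v1\<bar>^3 / (real (v1 + v2))^2)))"
    by (rule transversal_bound_abs[OF p]) blast
  obtain \<theta> \<delta>0 cn Cn where cn: "0 < \<theta>" "0 < \<delta>0" "0 < cn" "0 < Cn" and near:
    "\<And>\<delta> n v1 v2 \<sigma>. inj \<sigma> \<Longrightarrow> 0 < \<delta> \<Longrightarrow> \<delta> \<le> \<delta>0 \<Longrightarrow> v1 + v2 \<le> n \<Longrightarrow>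
      \<bar>real v1 - real v2\<bar> \<le> \<theta> * \<delta> * real (v1 + v2) \<Longrightarrow> 2 \<le> \<theta> * \<delta>^3 * real (v1 + v2) \<Longrightarrow>
      \<exists>S\<in>sets (env p). {\<omega> \<in> space (env p). up_geo n (\<omega> \<circ> \<sigma>) (int v1, int v2)} \<subseteq> S \<and>
       emeasure (env p) S \<le> ennreal (Cn * \<delta>^2 + 12 * exp (- (cn * \<delta>^3 * real (v1 + v2))))"
    by (rule near_diagonal_bound[OF p]) blast
  \<comment> \<open>Each fraction serves one bound on K^3: decay 1/r of the near and of the far
    exponential, and the hypothesis 2 \<le> \<theta>\<delta>^3 r, given L \<ge> 1/2. The 1 ensures K
    \<le> K^3.\<close>
  define K where "K = 1 + 1 / cn + 1 / (ct * \<theta>^3) + 4 / \<theta>"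
  have K: "1 \<le> K" "1 / cn \<le> K" "1 / (ct * \<theta>^3) \<le> K" "4 / \<theta> \<le> K" using ct cn by (auto simp: K_def)
  have K3: "K \<le> K^3" using K(1) power_increasing[of 1 3 K] by simp
  have K1: "1 \<le> cn * K^3" "1 \<le> ct * \<theta>^3 * K^3" "4 \<le> \<theta> * K^3"
  proof -
    show "1 \<le> cn * K^3" using order_trans[OF K(2) K3] cn by (simp add: field_simps)
    show "1 \<le> ct * \<theta>^3 * K^3" using order_trans[OF K(3) K3] cn ct by (simp add: field_simps)
    show "4 \<le> \<theta> * K^3" using order_trans[OF K(4) K3] cn by (simp add: field_simps)
  qed
  \<comment> \<open>The first summand covers \<delta> > \<delta>0, the last one points far from the
    diagonal. The two in the middle cover both directions of the step out of v, with 48 = 2 * 12 *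
    2.\<close>
  define C where "C = (K / \<delta>0)^2 + 2 * (Cn * K^2) + 48 + 2 * Ct"
  have C: "0 \<le> (K / \<delta>0)^2" "0 \<le> Cn * K^2" using cn by auto
  show ?thesis
  proof (rule that[of C])
    show "0 < C" using C ct unfolding C_def by linarith
    fix n v1 v2 :: nat assume v: "v1 + v2 \<le> n" "2 \<le> v1 + v2"
    define r where "r = real (v1 + v2)"
    define L where "L = ln r"
    define y where "y = (L / r) powr (2/3)"
    define P where "P = emeasure (env p) {\<omega> \<in> space (env p). (int v1, int v2) \<in> geo_union \<omega> (0, 0) (int n, int n)}"
    have r: "2 \<le> r" using v by (simp add: r_def)
    have L: "1/2 \<le> L"
    proof -
      have "1/2 \<le> ln (2::real)" using ln2_ge_two_thirds by simp
      also have "\<dots> \<le> L" using r by (simp add: L_def)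
      finally show ?thesis .
    qed
    have y0: "0 \<le> y" by (simp add: y_def)
    \<comment> \<open>L \<ge> 1/2 gives 1/(2r) \<le> L/r, and a number in (0, 1] is at most its
      power 2/3; so every term of order 1/r is absorbed by y.\<close>
    have ry: "1 / r \<le> 2 * y"
    proof -
      define z where "z = 1 / (2 * r)"
      have z: "0 < z" "z \<le> 1" using r by (auto simp: z_def)
      have "z = z powr 1" using z by simp
      also have "\<dots> \<le> z powr (2/3)" using z by (intro powr_mono') auto
      also have "\<dots> \<le> y" unfolding y_def using z L r by (intro powr_mono2) (auto simp: z_def field_simps)
      finally show ?thesis by (simp add: z_def)
    qed
    \<comment> \<open>Makes \<delta>^3 r equal to K^3 log r, so the exit errors are of order 1/r,
      while \<delta>^2 is the target rate y up to the factor K^2.\<close>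
    define \<delta> where "\<delta> = K * (L / r) powr (1/3)"
    have Lr: "0 < L / r" using L r by simp
    have z0: "0 < (L / r) powr (1/3)" using Lr by (metis less_irrefl powr_gt_zero)
    have \<delta>: "0 < \<delta>" unfolding \<delta>_def by (rule mult_pos_pos[OF _ z0]) (use K(1) in linarith)
    have \<delta>2: "\<delta>^2 = K^2 * y"
    proof -
      have "((L / r) powr (1/3))^2 = ((L / r) powr (1/3)) powr (real 2)" using z0 by (intro powr_realpow[symmetric])
      also have "\<dots> = y" by (simp add: powr_powr y_def)
      finally show ?thesis by (simp add: \<delta>_def power_mult_distrib)
    qed
    have \<delta>3: "\<delta>^3 * r = K^3 * L"
    proof -
      have "((L / r) powr (1/3))^3 = ((L / r) powr (1/3)) powr (real 3)" using z0 by (intro powr_realpow[symmetric])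
      also have "\<dots> = L / r" using L r by (simp add: powr_powr)
      finally have "((L / r) powr (1/3))^3 = L / r" .
      then show ?thesis using r by (simp add: \<delta>_def power_mult_distrib)
    qed
    have expr: "exp (- (c * (\<delta>^3 * r))) \<le> 2 * y" if "1 \<le> c * K^3" for c
    proof -
      have "1 * L \<le> c * K^3 * L" using that L by (intro mult_right_mono) auto
      then have "exp (- (c * (\<delta>^3 * r))) \<le> exp (- L)" by (simp add: \<delta>3 mult.assoc)
      also have "\<dots> = 1 / r" using r by (simp add: L_def exp_minus field_simps)
      finally show ?thesis using ry by linarith
    qed
    have "P \<le> ennreal (C * y)"
    proof (cases "\<delta> \<le> \<delta>0")
      case False
      have "1 \<le> (\<delta> / \<delta>0)^2" using False cn by (intro one_le_power) auto
      also have "\<dots> = (K / \<delta>0)^2 * y" by (simp add: power_divide \<delta>2)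
      also have "\<dots> \<le> C * y" unfolding C_def using C ct cn y0 by (intro mult_right_mono) auto
      finally have "ennreal 1 \<le> ennreal (C * y)" by (rule ennreal_leI)
      moreover have "P \<le> 1" unfolding P_def by (rule emeasure_env_le_1)
      ultimately show ?thesis unfolding ennreal_1 by (rule order_trans[rotated])
    next
      case \<delta>le: True
      show ?thesis
      proof (cases "\<bar>real v1 - real v2\<bar> \<le> \<theta> * \<delta> * r")
        case False
        have "P \<le> ennreal (Ct * exp (- (ct * \<bar>real v2 - real v1\<bar>^3 / r^2)))"
          unfolding P_def r_def using v by (intro far) auto
        also have "\<dots> \<le> ennreal (Ct * (2 * y))"
        proof (intro ennreal_leI mult_left_mono)
          have "(\<theta> * \<delta> * r)^3 \<le> \<bar>real v2 - real v1\<bar>^3"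
            using False cn \<delta> r by (intro power_mono) auto
          then have "(\<theta> * \<delta> * r)^3 / r^2 \<le> \<bar>real v2 - real v1\<bar>^3 / r^2"
            by (intro divide_right_mono) auto
          moreover have "(\<theta> * \<delta> * r)^3 / r^2 = \<theta>^3 * (\<delta>^3 * r)"
            using r by (simp add: power_mult_distrib power2_eq_square power3_eq_cube)
          ultimately have "ct * (\<theta>^3 * (\<delta>^3 * r)) \<le> ct * (\<bar>real v2 - real v1\<bar>^3 / r^2)"
            using ct by (intro mult_left_mono) auto
          then have "exp (- (ct * \<bar>real v2 - real v1\<bar>^3 / r^2)) \<le> exp (- (ct * \<theta>^3 * (\<delta>^3 * r)))"
            by (simp add: mult.assoc)
          also have "\<dots> \<le> 2 * y" using K1(2) by (rule expr)
          finally show "exp (- (ct * \<bar>real v2 - real v1\<bar>^3 / r^2)) \<le> 2 * y" .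
        qed (use ct in auto)
        also have "\<dots> \<le> ennreal (C * y)"
        proof (intro ennreal_leI)
          have "2 * Ct * y \<le> C * y" unfolding C_def using C ct cn y0 by (intro mult_right_mono) auto
          then show "Ct * (2 * y) \<le> C * y" by simp
        qed
        finally show ?thesis .
      next
        case True
        have big: "2 \<le> \<theta> * \<delta>^3 * r"
        proof -
          have "4 * (1/2) \<le> \<theta> * K^3 * L" using K1(3) L by (intro mult_mono) auto
          then show ?thesis by (simp add: mult.assoc \<delta>3)
        qed
        define x where "x = Cn * \<delta>^2 + 12 * exp (- (cn * \<delta>^3 * r))"
        obtain S1 where S1: "S1 \<in> sets (env p)" "{\<omega> \<in> space (env p). up_geo n (\<omega> \<circ> id) (int v1, int v2)} \<subseteq> S1" "emeasure (env p) S1 \<le> ennreal x"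
          using near[of id \<delta> v1 v2 n] \<delta> \<delta>le v True big unfolding x_def r_def by auto
        obtain S2 where S2: "S2 \<in> sets (env p)" "{\<omega> \<in> space (env p). up_geo n (\<omega> \<circ> swp) (int v2, int v1)} \<subseteq> S2" "emeasure (env p) S2 \<le> ennreal x"
          using near[of swp \<delta> v2 v1 n] inj_swp \<delta> \<delta>le v True big unfolding x_def r_def
          by (auto simp: add.commute abs_minus_commute)
        have "{\<omega> \<in> space (env p). (int v1, int v2) \<in> geo_union \<omega> (0, 0) (int n, int n)} \<subseteq> S1 \<union> S2"
        proof
          fix \<omega> assume \<omega>: "\<omega> \<in> {\<omega> \<in> space (env p). (int v1, int v2) \<in> geo_union \<omega> (0, 0) (int n, int n)}"
          have "(int v1, int v2) \<noteq> (int n, int n)" using v by auto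
          then have "up_geo n \<omega> (int v1, int v2) \<or> up_geo n (\<omega> \<circ> swp) (int v2, int v1)"
            using geo_union_cases[of "(int v1, int v2)" \<omega> n] \<omega> by (auto simp: swp_def)
          then show "\<omega> \<in> S1 \<union> S2" using \<omega> S1(2) S2(2) by auto
        qed
        then have "P \<le> emeasure (env p) (S1 \<union> S2)"
          unfolding P_def using S1 S2 by (intro emeasure_mono) auto
        also have "\<dots> \<le> emeasure (env p) S1 + emeasure (env p) S2"
          using S1 S2 by (intro emeasure_subadditive)
        also have "\<dots> \<le> ennreal x + ennreal x" using S1 S2 by (intro add_mono)
        also have "\<dots> = ennreal (2 * x)"
          using cn by (simp add: x_def ennreal_plus[symmetric] del: ennreal_plus)
        also have "\<dots> \<le> ennreal (C * y)"
        proof (intro ennreal_leI)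
          have "exp (- (cn * \<delta>^3 * r)) \<le> 2 * y" using expr[OF K1(1)] by (simp add: mult.assoc)
          then have "2 * x \<le> 2 * (Cn * (K^2 * y)) + 48 * y" by (simp add: x_def \<delta>2)
          also have "\<dots> = (2 * (Cn * K^2) + 48) * y" by (simp add: algebra_simps)
          also have "\<dots> \<le> C * y" unfolding C_def using C ct cn y0 by (intro mult_right_mono) auto
          finally show "2 * x \<le> C * y" .
        qed
        finally show ?thesis .
      qed
    qed
    then show "emeasure (env p) {\<omega> \<in> space (env p). (int v1, int v2) \<in> geo_union \<omega> (0, 0) (int n, int n)}
       \<le> ennreal (C * (ln (real (v1 + v2)) / real (v1 + v2)) powr (2/3))"
      by (simp add: P_def y_def L_def r_def)
  qed
qed

theorem theorem1p3:
  fixes p :: real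
  assumes "0 < p" and "p < 1"
  shows "\<exists>c C :: real. 0 < c \<and> 0 < C \<and>
    (\<forall>(n::int) (v1::int) (v2::int). 1 \<le> n \<and> 0 \<le> v1 \<and> v1 \<le> n \<and> 0 \<le> v2 \<and> v2 \<le> n \<and> v1 + v2 \<le> n \<longrightarrow>
      ((v1, v2) \<noteq> (0, 0) \<longrightarrow>
         measure (env p) {\<omega> \<in> space (env p). (v1, v2) \<in> geo_union \<omega> (0, 0) (n, n)}
           \<le> C * exp (- c * \<bar>real_of_int (v2 - v1)\<bar> ^ 3 / (real_of_int (v1 + v2)) ^ 2)) \<and>
      (2 \<le> v1 + v2 \<longrightarrow>
         measure (env p) {\<omega> \<in> space (env p). (v1, v2) \<in> geo_union \<omega> (0, 0) (n, n)}
           \<le> C * (ln (real_of_int (v1 + v2)) / real_of_int (v1 + v2)) powr (2/3)))"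
proof -
  interpret prob_space "env p" unfolding env_def by (intro prob_space_PiM prob_space_measure_pmf)
  obtain c C1 where c: "0 < c" "0 < C1" and i: "\<And>n v1 v2 :: nat. v1 + v2 \<le> n \<Longrightarrow> 0 < v1 + v2 \<Longrightarrow>
      emeasure (env p) {\<omega> \<in> space (env p). (int v1, int v2) \<in> geo_union \<omega> (0, 0) (int n, int n)}
       \<le> ennreal (C1 * exp (- (c * \<bar>real v2 - real v1\<bar>^3 / (real (v1 + v2))^2)))"
    by (rule transversal_bound_abs[OF assms]) blast
  obtain C2 where C2: "0 < C2" and ii: "\<And>n v1 v2 :: nat. v1 + v2 \<le> n \<Longrightarrow> 2 \<le> v1 + v2 \<Longrightarrow>
      emeasure (env p) {\<omega> \<in> space (env p). (int v1, int v2) \<in> geo_union \<omega> (0, 0) (int n, int n)}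
       \<le> ennreal (C2 * (ln (real (v1 + v2)) / real (v1 + v2)) powr (2/3))"
    by (rule localisation_bound[OF assms]) blast
  show ?thesis
  proof (rule exI[of _ c], rule exI[of _ "max C1 C2"], intro conjI allI impI)
    show "0 < c" "0 < max C1 C2" using c by auto
    fix n v1 v2 :: int
    assume h: "1 \<le> n \<and> 0 \<le> v1 \<and> v1 \<le> n \<and> 0 \<le> v2 \<and> v2 \<le> n \<and> v1 + v2 \<le> n"
    define N a b where "N = nat n" and "a = nat v1" and "b = nat v2"
    have nat: "n = int N" "v1 = int a" "v2 = int b" using h by (auto simp: N_def a_def b_def)
    have abn: "a + b \<le> N" using h unfolding nat by linarith
    {
      assume "(v1, v2) \<noteq> (0, 0)"
      then have "0 < a + b" unfolding nat by auto
      from i[OF abn this] have "measure (env p) {\<omega> \<in> space (env p). (v1, v2) \<in> geo_union \<omega> (0, 0) (n, n)}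
         \<le> C1 * exp (- (c * \<bar>real b - real a\<bar>^3 / (real (a + b))^2))"
        unfolding nat emeasure_eq_measure using c by (simp add: ennreal_le_iff)
      also have "\<dots> \<le> max C1 C2 * exp (- c * \<bar>real_of_int (v2 - v1)\<bar> ^ 3 / (real_of_int (v1 + v2)) ^ 2)"
        unfolding nat by (simp add: mult_right_mono)
      finally show "measure (env p) {\<omega> \<in> space (env p). (v1, v2) \<in> geo_union \<omega> (0, 0) (n, n)}
           \<le> max C1 C2 * exp (- c * \<bar>real_of_int (v2 - v1)\<bar> ^ 3 / (real_of_int (v1 + v2)) ^ 2)" .
    }
    {
      assume "2 \<le> v1 + v2"
      then have "2 \<le> a + b" unfolding nat by linarith
      from ii[OF abn this] have "measure (env p) {\<omega> \<in> space (env p). (v1, v2) \<in> geo_union \<omega> (0, 0) (n, n)}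
         \<le> C2 * (ln (real (a + b)) / real (a + b)) powr (2/3)"
        unfolding nat emeasure_eq_measure using C2 by (simp add: ennreal_le_iff)
      also have "\<dots> \<le> max C1 C2 * (ln (real_of_int (v1 + v2)) / real_of_int (v1 + v2)) powr (2/3)"
        unfolding nat by (simp add: mult_right_mono)
      finally show "measure (env p) {\<omega> \<in> space (env p). (v1, v2) \<in> geo_union \<omega> (0, 0) (n, n)}
           \<le> max C1 C2 * (ln (real_of_int (v1 + v2)) / real_of_int (v1 + v2)) powr (2/3)" .
    }
  qed
qed

end
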